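(* Suppose that $p$ is a hyperbolic polynomial of degree $d$ in $n$ real variables, hyperbolic with respect to $e\in\mathbb{R}^n$, with associated hyperbolicity cone $\Lambda_+$. Let $C$ be a closed convex cone (in a finite-dimensional real vector space). If $C$ has a $\Lambda_+$-lift then $\mathrm{sp}_C(\epsilon)\le\lceil 4d/\epsilon^2\rceil$ for all $\epsilon\in(0,1)$.
   Context: Hyperbolic polynomials. A polynomial $p$ with real coefficients in $n$ variables, homogeneous of degree $d$, is hyperbolic with respect to $e\in\mathbb{R}^n$ if $p(e)>0$ and, for every fixed $x\in\mathbb{R}^n$, every root $t$ of $p(te-x)=0$ is real. The $d$ roots (with multiplicity) are the hyperbolic eigenvalues $\lambda_1^{(p,e)}(x)\ge\cdots\ge\lambda_d^{(p,e)}(x)$ of $x$. The hyperbolicity cone is $\Lambda_+=\Lambda_+(p,e)=\{x\in\mathbb{R}^n:\lambda_i^{(p,e)}(x)\ge0,\ i=1,\dots,d\}$, which is a closed convex cone. Lifts. For closed convex cones $C,K$, $C$ has a $K$-lift if there is a linear subspace $L\subseteq\mathrm{span}(K)$ and a linear map $\pi:\mathrm{span}(K)\to\mathrm{span}(C)$ such that $C=\pi(L\cap K)$ (it is not required that $L$ meets the relative interior of $K$). Sparsification function. For a closed convex cone $K$ and $x,y\in\mathrm{span}(K)$, write $x\preceq_K y$ if $y-x\in K$. A sparsification function for $K$ is a monotonically non-increasing upper semi-continuous function $\alpha:(0,1)\to\mathbb{R}$ such that for any $x_1,\dots,x_m\in K$ with $\sum_{i=1}^m x_i=e\in\mathrm{relint}(K)$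 and any $0<\epsilon<1$, there exist $S\subseteq[m]$ with $|S|\le\alpha(\epsilon)$ and positive scalars $(\lambda_i)_{i\in S}$ such that $(1-\epsilon)e\preceq_K\sum_{i\in S}\lambda_i x_i\preceq_K(1+\epsilon)e$. Let $\mathcal{F}_K$ be the collection of all sparsification functions for $K$; the sparsification function of $K$ is $\mathrm{sp}_K(\epsilon)=\inf_{\alpha\in\mathcal{F}_K}\alpha(\epsilon)$, $\epsilon\in(0,1)$. *)

theory Defs
  imports "HOL-Analysis.Analysis" "HOL-Library.Poly_Mapping"
    "HOL-Computational_Algebra.Computational_Algebra"
begin

text \<open>Real polynomials in the variables \<open>'n\<close>, as finitely supported coefficient functions
  on exponent vectors.\<close>

type_synonym 'n mpol = "('n \<Rightarrow>\<^sub>0 nat) \<Rightarrow>\<^sub>0 real"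

definition mpol_eval :: "'n::finite mpol \<Rightarrow> ('n \<Rightarrow> 'b::real_field) \<Rightarrow> 'b" where
  "mpol_eval p x =
     (\<Sum>m\<in>Poly_Mapping.keys p. of_real (Poly_Mapping.lookup p m) * (\<Prod>i\<in>UNIV. x i ^ Poly_Mapping.lookup m i))"

definition homogeneous :: "nat \<Rightarrow> 'n::finite mpol \<Rightarrow> bool" where
  "homogeneous d p \<longleftrightarrow> (\<forall>m\<in>Poly_Mapping.keys p. (\<Sum>i\<in>UNIV. Poly_Mapping.lookup m i) = d)"

text \<open>Real-rootedness ranges over the complex roots \<open>z\<close> of \<open>t \<mapsto> p(t e - x)\<close>.
  Since \<open>p(e) > 0\<close> forces \<open>p \<noteq> 0\<close>, the degree of \<open>p\<close> is exactly \<open>d\<close>.\<close>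

definition hyperbolic :: "nat \<Rightarrow> 'n::finite mpol \<Rightarrow> real^'n \<Rightarrow> bool" where
  "hyperbolic d p e \<longleftrightarrow> homogeneous d p \<and> mpol_eval p (($) e) > 0 \<and>
     (\<forall>x :: real^'n. \<forall>z :: complex.
        mpol_eval p (\<lambda>i. z * of_real (e $ i) - of_real (x $ i)) = 0 \<longrightarrow> z \<in> \<real>)"

text \<open>The univariate polynomial \<open>p(t e - x)\<close> in \<open>t\<close>, needed to count roots with multiplicity.\<close>

definition line_poly :: "'n::finite mpol \<Rightarrow> real^'n \<Rightarrow> real^'n \<Rightarrow> real poly" where
  "line_poly p e x =
     (\<Sum>m\<in>Poly_Mapping.keys p. smult (Poly_Mapping.lookup p m)
        (\<Prod>i\<in>UNIV. [:- (x $ i), e $ i:] ^ Poly_Mapping.lookup m i))"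

lemma poly_line_poly: "poly (line_poly p e x) t = mpol_eval p (($) (t *\<^sub>R e - x))"
  by (simp add: line_poly_def mpol_eval_def poly_sum poly_prod poly_power)

lemma poly_of_real_mult:
  "poly (map_poly of_real (p * q)) (z :: complex)
     = poly (map_poly of_real p) z * poly (map_poly of_real q) z"
proof -
  have "map_poly (of_real :: real \<Rightarrow> complex) (p * q) = map_poly of_real p * map_poly of_real q"
    by (rule poly_eqI) (simp add: coeff_map_poly coeff_mult)
  then show ?thesis by simp
qed

lemma poly_of_real_power:
  "poly (map_poly of_real (p ^ k)) (z :: complex) = poly (map_poly of_real p) z ^ k"
  by (induction k) (simp_all add: poly_of_real_mult)

lemma poly_of_real_prod:
  "poly (map_poly of_real (\<Prod>i\<in>A. f i)) (z :: complex) = (\<Prod>i\<in>A. poly (map_poly of_real (f i)) z)"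
  by (induction A rule: infinite_finite_induct) (simp_all add: poly_of_real_mult)

lemma poly_of_real_sum:
  "poly (map_poly of_real (\<Sum>i\<in>A. f i)) (z :: complex) = (\<Sum>i\<in>A. poly (map_poly of_real (f i)) z)"
proof -
  have "map_poly (of_real :: real \<Rightarrow> complex) (\<Sum>i\<in>A. f i) = (\<Sum>i\<in>A. map_poly of_real (f i))"
    by (rule poly_eqI) (simp add: coeff_map_poly coeff_sum)
  then show ?thesis by (simp add: poly_sum)
qed

lemma poly_line_poly_complex:
  "poly (map_poly of_real (line_poly p e x)) z
     = mpol_eval p (\<lambda>i. z * of_real (e $ i) - of_real (x $ i) :: complex)"
proof -
  have smult: "poly (map_poly of_real (smult c q)) z = of_real c * poly (map_poly of_real q) z"
    for c :: real and q
    using poly_of_real_mult[of "[:c:]" q z] by (simp add: map_poly_pCons)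
  show ?thesis
    by (simp add: line_poly_def mpol_eval_def poly_of_real_sum smult poly_of_real_prod
        poly_of_real_power map_poly_pCons)
qed

text \<open>The list \<open>\<lambda>\<^sub>1 \<ge> \<dots> \<ge> \<lambda>\<^sub>d\<close>, entry \<open>i\<close> being \<open>\<lambda>\<^sub>i\<^sub>+\<^sub>1\<close>.\<close>

definition hyp_eigenvalues :: "'n::finite mpol \<Rightarrow> real^'n \<Rightarrow> real^'n \<Rightarrow> real list" where
  "hyp_eigenvalues p e x = rev (sorted_list_of_multiset (proots (line_poly p e x)))"

lemma coeff_mult_bound:
  fixes p q :: "real poly"
  assumes "degree p \<le> a" "degree q \<le> b"
  shows "coeff (p * q) (a + b) = coeff p a * coeff q b"
proof -
  have "coeff (p * q) (a + b) = (\<Sum>i\<le>a + b. coeff p i * coeff q (a + b - i))"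
    by (simp add: coeff_mult)
  also have "\<dots> = (\<Sum>i\<in>{a}. coeff p i * coeff q (a + b - i))"
  proof (rule sum.mono_neutral_right)
    show "\<forall>i\<in>{..a + b} - {a}. coeff p i * coeff q (a + b - i) = 0"
    proof
      fix i assume "i \<in> {..a + b} - {a}"
      then have "i < a \<or> a < i" by auto
      then show "coeff p i * coeff q (a + b - i) = 0"
      proof
        assume "i < a"
        then have "degree q < a + b - i" using assms by linarith
        then show ?thesis by (simp add: coeff_eq_0)
      next
        assume "a < i"
        then have "degree p < i" using assms by linarith
        then show ?thesis by (simp add: coeff_eq_0)
      qed
    qed
  qed auto
  finally show ?thesis by simp
qed

lemma linear_power_top:
  fixes a b :: real
  shows "degree ([:a, b:] ^ k) \<le> k \<and> coeff ([:a, b:] ^ k) k = b ^ k"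
proof (induction k)
  case (Suc k)
  have "degree [:a, b:] \<le> 1" by simp
  moreover have "degree ([:a, b:] ^ Suc k) \<le> 1 + k"
    unfolding power_Suc
    using degree_mult_le[of "[:a, b:]" "[:a, b:] ^ k"] Suc \<open>degree [:a, b:] \<le> 1\<close> by linarith
  ultimately show ?case
    using Suc coeff_mult_bound[of "[:a, b:]" 1 "[:a, b:] ^ k" k]
    by (simp del: mult_pCons_left)
qed simp

lemma prod_top:
  fixes f :: "'i \<Rightarrow> real poly"
  assumes "finite A" "\<And>i. i \<in> A \<Longrightarrow> degree (f i) \<le> k i"
  shows "degree (\<Prod>i\<in>A. f i) \<le> (\<Sum>i\<in>A. k i) \<and>
         coeff (\<Prod>i\<in>A. f i) (\<Sum>i\<in>A. k i) = (\<Prod>i\<in>A. coeff (f i) (k i))"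
  using assms
proof (induction A rule: finite_induct)
  case (insert j A)
  then have IH: "degree (\<Prod>i\<in>A. f i) \<le> (\<Sum>i\<in>A. k i)"
    "coeff (\<Prod>i\<in>A. f i) (\<Sum>i\<in>A. k i) = (\<Prod>i\<in>A. coeff (f i) (k i))" "degree (f j) \<le> k j"
    by auto
  have "degree (f j * (\<Prod>i\<in>A. f i)) \<le> k j + (\<Sum>i\<in>A. k i)"
    using degree_mult_le[of "f j" "\<Prod>i\<in>A. f i"] IH by linarith
  with coeff_mult_bound[OF IH(3,1)] IH(2) insert.hyps show ?case by simp
qed simp

lemma degree_line_poly:
  assumes "hyperbolic d p e"
  shows "degree (line_poly p e x) = d"
proof (rule antisym)
  let ?g = "\<lambda>m. \<Prod>i\<in>UNIV. [:- (x $ i), e $ i:] ^ Poly_Mapping.lookup m i"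
  have hom: "(\<Sum>i\<in>UNIV. Poly_Mapping.lookup m i) = d" if "m \<in> Poly_Mapping.keys p" for m
    using assms that by (auto simp: hyperbolic_def homogeneous_def)
  have top: "degree (?g m) \<le> d" "coeff (?g m) d = (\<Prod>i\<in>UNIV. e $ i ^ Poly_Mapping.lookup m i)"
    if "m \<in> Poly_Mapping.keys p" for m
    using prod_top[of UNIV "\<lambda>i. [:- (x $ i), e $ i:] ^ Poly_Mapping.lookup m i" "Poly_Mapping.lookup m"]
      linear_power_top hom[OF that] by auto
  show "degree (line_poly p e x) \<le> d"
    unfolding line_poly_def
    by (rule degree_sum_le) (auto intro: order.trans[OF degree_smult_le] top(1))
  have "coeff (line_poly p e x) d = mpol_eval p (($) e)"
    unfolding line_poly_def mpol_eval_def by (simp add: coeff_sum top(2))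
  also have "\<dots> \<noteq> 0" using assms by (auto simp: hyperbolic_def)
  finally show "d \<le> degree (line_poly p e x)" by (rule le_degree)
qed

lemma size_proots_real_rooted:
  fixes q :: "real poly"
  assumes "q \<noteq> 0" "\<And>z :: complex. poly (map_poly of_real q) z = 0 \<Longrightarrow> z \<in> \<real>"
  shows "size (proots q) = degree q"
  using assms
proof (induction "degree q" arbitrary: q)
  case 0
  then show ?case using size_proots_le[of q] by simp
next
  case (Suc k)
  have deg: "degree (map_poly (of_real :: real \<Rightarrow> complex) q) = degree q"
    by (rule degree_map_poly) simp
  have "\<not> constant (poly (map_poly (of_real :: real \<Rightarrow> complex) q))"
    using Suc.hyps(2) deg by (simp add: constant_degree)
  then obtain z :: complex where z: "poly (map_poly of_real q) z = 0"
    using fundamental_theorem_of_algebra by blast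
  with Suc.prems obtain r where r: "z = of_real r" by (metis Reals_cases)
  have ev: "poly (map_poly of_real q) (complex_of_real r) = of_real (poly q r)" for q r
    by (induction q) (simp_all add: map_poly_pCons)
  from z r ev have "poly q r = 0" by simp
  then obtain s where s: "q = [:- r, 1:] * s" by (auto simp: poly_eq_0_iff_dvd elim: dvdE)
  have s0: "s \<noteq> 0" using s Suc.prems(1) by auto
  have d: "degree q = Suc (degree s)"
    unfolding s using s0 by (subst degree_mult_eq) auto
  have "size (proots s) = degree s"
    using Suc.hyps(1)[of s] Suc.hyps(2) d s0 Suc.prems(2)
    by (simp add: s poly_of_real_mult del: mult_pCons_left)
  moreover have "proots q = {#r#} + proots s"
    unfolding s using s0 by (subst proots_mult) (auto simp del: mult_pCons_left)
  ultimately show ?case using d by simp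
qed

lemma length_hyp_eigenvalues:
  assumes "hyperbolic d p e"
  shows "length (hyp_eigenvalues p e x) = d"
proof -
  have "line_poly p e x \<noteq> 0"
  proof
    assume 0: "line_poly p e x = 0"
    then have d: "d = 0" using degree_line_poly[OF assms, of x] by simp
    have "Poly_Mapping.lookup m i = 0" if "m \<in> Poly_Mapping.keys p" for m i
      using assms that by (auto simp: hyperbolic_def homogeneous_def d)
    then have "poly (line_poly p e x) 0 = mpol_eval p (($) e)"
      unfolding poly_line_poly mpol_eval_def by (intro sum.cong) auto
    with 0 assms show False by (auto simp: hyperbolic_def)
  qed
  then have "size (proots (line_poly p e x)) = d"
    using size_proots_real_rooted[of "line_poly p e x"] degree_line_poly[OF assms, of x] assms
    by (auto simp: poly_line_poly_complex hyperbolic_def)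
  then show ?thesis
    by (metis hyp_eigenvalues_def length_rev mset_sorted_list_of_multiset size_mset)
qed

definition hyperbolicity_cone :: "'n::finite mpol \<Rightarrow> real^'n \<Rightarrow> (real^'n) set" where
  "hyperbolicity_cone p e = {x. \<forall>l\<in>set (hyp_eigenvalues p e x). 0 \<le> l}"

text \<open>The linear map \<open>\<pi> : span K \<rightarrow> span C\<close> is a total function of which only the values
  on \<open>span K\<close> are constrained.\<close>

definition has_lift :: "'a::euclidean_space set \<Rightarrow> 'b::euclidean_space set \<Rightarrow> bool" where
  "has_lift C K \<longleftrightarrow> (\<exists>L \<pi>. subspace L \<and> L \<subseteq> span K \<and>
     \<pi> ` span K \<subseteq> span C \<and>
     (\<forall>x\<in>span K. \<forall>y\<in>span K. \<pi> (x + y) = \<pi> x + \<pi> y) \<and>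
     (\<forall>c. \<forall>x\<in>span K. \<pi> (c *\<^sub>R x) = c *\<^sub>R \<pi> x) \<and>
     C = \<pi> ` (L \<inter> K))"

definition cone_le :: "'a::real_vector set \<Rightarrow> 'a \<Rightarrow> 'a \<Rightarrow> bool" where
  "cone_le K x y \<longleftrightarrow> y - x \<in> K"

definition usc_on :: "'a::topological_space set \<Rightarrow> ('a \<Rightarrow> real) \<Rightarrow> bool" where
  "usc_on S f \<longleftrightarrow> (\<forall>x\<in>S. \<forall>y>f x. \<forall>\<^sub>F t in at x within S. f t < y)"

text \<open>Functions on \<open>(0,1)\<close> are total functions whose values outside \<open>(0,1)\<close> are irrelevant.\<close>

definition sparsification_fun :: "'a::euclidean_space set \<Rightarrow> (real \<Rightarrow> real) \<Rightarrow> bool" where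
  "sparsification_fun K \<alpha> \<longleftrightarrow>
     antimono_on {0<..<1} \<alpha> \<and> usc_on {0<..<1} \<alpha> \<and>
     (\<forall>m (x :: nat \<Rightarrow> 'a) e \<epsilon>.
        (\<forall>i\<in>{1..m}. x i \<in> K) \<and> (\<Sum>i=1..m. x i) = e \<and> e \<in> rel_interior K \<and> 0 < \<epsilon> \<and> \<epsilon> < 1 \<longrightarrow>
        (\<exists>S c. S \<subseteq> {1..m} \<and> real (card S) \<le> \<alpha> \<epsilon> \<and> (\<forall>i\<in>S. 0 < c i) \<and>
           cone_le K ((1 - \<epsilon>) *\<^sub>R e) (\<Sum>i\<in>S. c i *\<^sub>R x i) \<and>
           cone_le K (\<Sum>i\<in>S. c i *\<^sub>R x i) ((1 + \<epsilon>) *\<^sub>R e)))"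

text \<open>The infimum is taken in the extended reals, so it is \<open>\<infinity>\<close> if there is no
  sparsification function.\<close>

definition sp :: "'a::euclidean_space set \<Rightarrow> real \<Rightarrow> ereal" where
  "sp K \<epsilon> = (INF \<alpha>\<in>Collect (sparsification_fun K). ereal (\<alpha> \<epsilon>))"

end

theory Submission
  imports Defs
begin

text \<open>
  The proof is the barrier argument of Batson, Spielman and Srivastava, with the trace of the
  resolvent replaced by the logarithmic derivative \<open>\<Phi>(M) = D\<^sub>z p(M) / p(M)\<close> in the direction of the
  vector \<open>z = \<Sum>i. x\<^sub>i\<close> to be sparsified. What makes it work without a determinantal
  representation is that, for \<open>x\<close> in the cone, \<open>t \<mapsto> \<Phi>(M + t x)\<close> has real nonpositive poles
  \<open>- 1 / \<mu>\<^sub>k\<close> and a partial fraction expansion \<open>\<Sum>k. w\<^sub>k / (1 + t \<mu>\<^sub>k)\<close> with \<open>w\<^sub>k \<ge> 0\<close>, since it maps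
  the upper half-plane to the lower one. This gives the inequality
  \<open>\<Phi>(M + t x) \<le> \<Phi>(M) + t D\<^sub>x \<Phi>(M) / (1 + t D\<^sub>x log p(M))\<close> that the Sherman-Morrison formula provides
  in the matrix case, and its right-hand side involves only linear functions of \<open>x\<close>, which can be
  summed over the family.

  For \<open>z\<close> in the boundary, a small multiple of \<open>e\<close> is added to the family and removed again by
  compactness. A lift transports sparsifiers from the hyperbolicity cone to \<open>C\<close>. The number of
  vectors obtained is \<open>\<lfloor>4 d / \<epsilon>\<^sup>2\<rfloor>\<close>; the floor is upper semicontinuous, unlike the ceiling.
\<close>

section \<open>Roots of complex polynomials depending on a parameter\<close>

text \<open>The barriers are measured in the direction \<open>z\<close>, not \<open>e\<close>,
  because the potentials are linear in the direction: summing over the family turns every derivative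
  along an \<open>x i\<close> into one along \<open>z\<close>, where barrier shifts are explicit.
  For this \<open>z\<close> must itself be a direction of hyperbolicity, so Garding's theorem that
  the cone does not depend on its direction comes first; it rests on roots not crossing a line that
  is forbidden to them. The constant comes from the final ratio
  \<open>((q + 1) / (q - 1))\<^sup>2\<close> of the two barriers, with
  \<open>q\<^sup>2 = N / d\<close>. Centred at 1 this is a relative error
  \<open>2 * q / (q\<^sup>2 + 1)\<close>, at most \<epsilon> once
  \<open>q\<^sup>2 + 1 \<ge> 4 / \<epsilon>\<^sup>2\<close>, that is
  \<open>N \<ge> 4 * d / \<epsilon>\<^sup>2 - d\<close>. The spare \<open>d\<close> pays for
  rounding down. Boundary points are unavoidable, since the subspace of a lift may miss the interior
  of the cone. The compactness argument in turn fails for vectors whose negative also lies in the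
  cone; these get weight 0, as their sum can be added or subtracted freely.\<close>

lemma complex_poly_factorization:
  fixes q :: "complex poly"
  assumes "degree q \<le> d" "coeff q d \<noteq> 0"
  shows "\<exists>\<rho>. \<forall>z. poly q z = coeff q d * (\<Prod>k<d. z - \<rho> k)"
  using assms
proof (induction d arbitrary: q)
  case 0
  then obtain c where "q = [:c:]" by (metis degree_eq_zeroE le_zero_eq)
  then show ?case by simp
next
  case (Suc d)
  then have deg: "degree q = Suc d" by (simp add: le_degree le_antisym)
  then have "\<not> constant (poly q)" by (simp add: constant_degree)
  then obtain a where "poly q a = 0" using fundamental_theorem_of_algebra by blast
  then obtain s where s: "q = [:- a, 1:] * s" by (auto simp: poly_eq_0_iff_dvd elim: dvdE)
  have "s \<noteq> 0" using s Suc.prems(2) by auto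
  then have "degree q = Suc (degree s)" unfolding s by (subst degree_mult_eq) auto
  with deg have ds: "degree s = d" by simp
  have cs: "coeff q (Suc d) = coeff s d"
    using s ds by (simp add: coeff_eq_0)
  obtain \<rho> where \<rho>: "\<And>z. poly s z = coeff s d * (\<Prod>k<d. z - \<rho> k)"
    using Suc.IH[of s] ds cs Suc.prems(2) by auto
  have "poly q z = coeff q (Suc d) * (\<Prod>k<Suc d. z - (\<rho>(d := a)) k)" for z
  proof -
    have "(\<Prod>k<d. z - (\<rho>(d := a)) k) = (\<Prod>k<d. z - \<rho> k)" by (rule prod.cong) auto
    then show ?thesis unfolding cs by (simp add: s \<rho> algebra_simps)
  qed
  then show ?case by blast
qed

lemma real_rooted_factorization:
  fixes q :: "real poly"
  assumes "degree q \<le> d" "coeff q d \<noteq> 0"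
    and "\<And>z :: complex. poly (map_poly of_real q) z = 0 \<Longrightarrow> z \<in> \<real>"
  shows "\<exists>\<rho>. \<forall>x. poly q x = coeff q d * (\<Prod>k<d. x - \<rho> k)"
proof -
  let ?Q = "map_poly of_real q :: complex poly"
  have Qd: "degree ?Q \<le> d" "coeff ?Q d \<noteq> 0"
    using assms(1,2) by (auto simp: coeff_map_poly intro: order.trans[OF map_poly_degree_leq])
  obtain \<sigma> where \<sigma>: "\<And>z. poly ?Q z = coeff ?Q d * (\<Prod>k<d. z - \<sigma> k)"
    using complex_poly_factorization[OF Qd] by blast
  have "\<sigma> k \<in> \<real>" if "k < d" for k
    using that by (intro assms(3)) (auto simp: \<sigma>)
  then have re: "\<sigma> k = of_real (Re (\<sigma> k))" if "k < d" for k
    using that by (simp add: of_real_Re)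
  have "of_real (poly q x) = complex_of_real (coeff q d * (\<Prod>k<d. x - Re (\<sigma> k)))" for x
  proof -
    have "of_real (poly q x) = poly ?Q (complex_of_real x)"
      by (induction q) (simp_all add: map_poly_pCons)
    also have "\<dots> = of_real (coeff q d) * (\<Prod>k<d. of_real x - \<sigma> k)"
      by (simp add: \<sigma> coeff_map_poly)
    also have "(\<Prod>k<d. of_real x - \<sigma> k) = (\<Prod>k<d. of_real (x - Re (\<sigma> k)))"
      using re by (intro prod.cong) auto
    finally show ?thesis by simp
  qed
  then show ?thesis by (metis of_real_eq_iff)
qed

lemma poly_altdef_le:
  fixes p :: "'b::comm_ring_1 poly"
  assumes "degree p \<le> d"
  shows "poly p x = (\<Sum>i\<le>d. coeff p i * x ^ i)"
proof -
  have "(\<Sum>i\<le>degree p. coeff p i * x ^ i) = (\<Sum>i\<le>d. coeff p i * x ^ i)"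
    using assms by (intro sum.mono_neutral_left) (auto simp: coeff_eq_0)
  then show ?thesis by (simp add: poly_altdef)
qed

text \<open>The distances from \<open>z\<close> to the roots multiply to the modulus of
  \<open>q\<close> at \<open>z\<close> divided by that of the top coefficient, so one of them is
  below \<epsilon>. The criterion involves only values of \<open>q\<close>, hence survives small
  changes of \<open>q\<close>: this is continuity of roots.\<close>

lemma poly_root_near:
  fixes q :: "complex poly"
  assumes "degree q \<le> d" "0 < \<epsilon>" "cmod (poly q z) < cmod (coeff q d) * \<epsilon> ^ d"
  shows "\<exists>w. poly q w = 0 \<and> dist w z < \<epsilon>"
proof -
  have c: "coeff q d \<noteq> 0"
    using assms(3) by (auto simp: dest: le_less_trans[OF norm_ge_zero])
  obtain \<rho> where \<rho>: "\<And>z. poly q z = coeff q d * (\<Prod>k<d. z - \<rho> k)"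
    using complex_poly_factorization[OF assms(1) c] by blast
  have "\<exists>k<d. cmod (z - \<rho> k) < \<epsilon>"
  proof (rule ccontr)
    assume "\<not> ?thesis"
    then have "(\<Prod>k<d. \<epsilon>) \<le> (\<Prod>k<d. cmod (z - \<rho> k))"
      using assms(2) by (intro prod_mono) force
    then have "cmod (coeff q d) * \<epsilon> ^ d \<le> cmod (poly q z)"
      by (simp add: \<rho> norm_mult prod_norm[symmetric] mult_left_mono)
    with assms(3) show False by simp
  qed
  then obtain k where "k < d" "cmod (z - \<rho> k) < \<epsilon>" by blast
  then show ?thesis
    by (intro exI[of _ "\<rho> k"]) (auto simp: \<rho> dist_norm norm_minus_commute)
qed

text \<open>Cauchy's bound. It is continuous in the coefficients while the top one does not vanish,
  so over a compact set of parameters all roots stay in one disc.\<close>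

lemma poly_root_bound:
  fixes q :: "complex poly"
  assumes "degree q \<le> d" "coeff q d \<noteq> 0" "poly q z = 0"
  shows "cmod z \<le> 1 + (\<Sum>i<d. cmod (coeff q i)) / cmod (coeff q d)"
proof (cases "cmod z \<le> 1")
  case True
  then show ?thesis by (smt (verit) divide_nonneg_nonneg norm_ge_zero sum_nonneg)
next
  case False
  then have z1: "1 < cmod z" by simp
  show ?thesis
  proof (cases d)
    case 0
    then obtain c where "q = [:c:]" using assms(1) by (metis degree_eq_zeroE le_zero_eq)
    with assms 0 show ?thesis by simp
  next
    case (Suc n)
    have "poly q z = (\<Sum>i\<le>d. coeff q i * z ^ i)"
      using poly_altdef_le[OF assms(1)] by simp
    then have "coeff q d * z ^ d = - (\<Sum>i<d. coeff q i * z ^ i)"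
      using assms(3) by (simp add: lessThan_Suc_atMost[symmetric] add_eq_0_iff)
    then have "cmod (coeff q d) * cmod z ^ d = cmod (\<Sum>i<d. coeff q i * z ^ i)"
      by (metis norm_minus_cancel norm_mult norm_power)
    also have "\<dots> \<le> (\<Sum>i<d. cmod (coeff q i) * cmod z ^ i)"
      by (rule order.trans[OF norm_sum]) (simp add: norm_mult norm_power)
    also have "\<dots> \<le> (\<Sum>i<d. cmod (coeff q i) * cmod z ^ n)"
      using z1 Suc by (intro sum_mono mult_left_mono power_increasing) auto
    also have "\<dots> = (\<Sum>i<d. cmod (coeff q i)) * cmod z ^ n"
      by (simp add: sum_distrib_right)
    finally have "(cmod (coeff q d) * cmod z) * cmod z ^ n \<le> (\<Sum>i<d. cmod (coeff q i)) * cmod z ^ n"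
      by (simp add: Suc mult_ac)
    moreover have "0 < cmod z ^ n" using z1 by (intro zero_less_power) linarith
    ultimately have "cmod (coeff q d) * cmod z \<le> (\<Sum>i<d. cmod (coeff q i))"
      by (simp only: mult_le_cancel_right_pos)
    then have "cmod z \<le> (\<Sum>i<d. cmod (coeff q i)) / cmod (coeff q d)"
      using assms(2) by (simp add: field_simps)
    then show ?thesis by simp
  qed
qed

lemma continuous_on_poly_family:
  fixes F :: "'a::topological_space \<Rightarrow> complex poly"
  assumes "\<And>k. continuous_on S (\<lambda>\<theta>. coeff (F \<theta>) k)" "\<And>\<theta>. \<theta> \<in> S \<Longrightarrow> degree (F \<theta>) \<le> d"
  shows "continuous_on (S \<times> UNIV) (\<lambda>(\<theta>, z). poly (F \<theta>) z)"
proof -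
  have "continuous_on (S \<times> UNIV) (\<lambda>x. coeff (F (fst x)) i)" for i
    by (rule continuous_on_compose2[OF assms(1)[of i]]) (auto intro: continuous_intros)
  then have "continuous_on (S \<times> UNIV) (\<lambda>x. \<Sum>i\<le>d. coeff (F (fst x)) i * snd x ^ i)"
    by (intro continuous_intros)
  moreover have "(\<Sum>i\<le>d. coeff (F (fst x)) i * snd x ^ i) = poly (F (fst x)) (snd x)"
    if "x \<in> S \<times> UNIV" for x
    using that assms(2) by (subst poly_altdef_le[of "F (fst x)" d]) auto
  ultimately show ?thesis
    by (auto simp: case_prod_unfold cong: continuous_on_cong)
qed

text \<open>The parameters for which a root lies in \<open>U\<close> form an open set because roots move continuously,
  and a closed set because they are the parameters with a root in \<open>closure U\<close>.\<close>

lemma no_root_along_path: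
  fixes F :: "real \<Rightarrow> complex poly"
  assumes cont: "\<And>k. continuous_on {0..1} (\<lambda>\<theta>. coeff (F \<theta>) k)"
    and deg: "\<And>\<theta>. \<theta> \<in> {0..1} \<Longrightarrow> degree (F \<theta>) \<le> d"
    and lc: "\<And>\<theta>. \<theta> \<in> {0..1} \<Longrightarrow> coeff (F \<theta>) d \<noteq> 0"
    and U: "open U"
    and frontier: "\<And>\<theta> z. \<theta> \<in> {0..1} \<Longrightarrow> z \<in> closure U \<Longrightarrow> poly (F \<theta>) z = 0 \<Longrightarrow> z \<in> U"
    and start: "\<And>z. z \<in> U \<Longrightarrow> poly (F 0) z \<noteq> 0"
    and "z \<in> U"
  shows "poly (F 1) z \<noteq> 0"
proof -
  define B where "B = {\<theta>\<in>{0..1}. \<exists>z\<in>U. poly (F \<theta>) z = 0}"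
  have joint: "continuous_on ({0..1} \<times> UNIV) (\<lambda>(\<theta>, z). poly (F \<theta>) z)"
    using continuous_on_poly_family[OF cont deg] by blast
  have op: "openin (top_of_set {0..1}) B"
    unfolding openin_subtopology_self openin_euclidean_subtopology_iff
  proof (intro conjI ballI)
    show "B \<subseteq> {0..1}" by (auto simp: B_def)
  next
    fix \<theta> assume "\<theta> \<in> B"
    then obtain z where z: "\<theta> \<in> {0..1}" "z \<in> U" "poly (F \<theta>) z = 0" by (auto simp: B_def)
    obtain \<epsilon> where \<epsilon>: "0 < \<epsilon>" "ball z \<epsilon> \<subseteq> U" using U z(2) open_contains_ball by blast
    \<comment> \<open>Positivity of \<open>h\<close> is the hypothesis of
      \<open>poly_root_near\<close>. It holds at \<theta> because \<open>z\<close> is a root there,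
      and so also nearby.\<close>
    define h where "h = (\<lambda>\<theta>. cmod (coeff (F \<theta>) d) * \<epsilon> ^ d - cmod (poly (F \<theta>) z))"
    have "continuous_on {0..1} (\<lambda>\<theta>. poly (F \<theta>) z)"
      using continuous_on_compose2[OF joint, of "{0..1}" "\<lambda>\<theta>. (\<theta>, z)"]
      by (simp add: continuous_on_Pair image_subset_iff)
    then have "continuous_on {0..1} h"
      unfolding h_def by (intro continuous_intros cont)
    moreover have "0 < h \<theta>" using z(3) \<epsilon>(1) lc[OF z(1)] by (simp add: h_def)
    ultimately obtain \<delta> where \<delta>: "0 < \<delta>" "\<And>y. y \<in> {0..1} \<Longrightarrow> dist y \<theta> < \<delta> \<Longrightarrow> dist (h y) (h \<theta>) < h \<theta>"
      using z(1) unfolding continuous_on_iff by metis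
    have "y \<in> B" if y: "y \<in> {0..1}" "dist y \<theta> < \<delta>" for y
    proof -
      have "0 < h y" using \<delta>(2)[OF y] by (auto simp: dist_real_def)
      then obtain w where "poly (F y) w = 0" "dist w z < \<epsilon>"
        using poly_root_near[OF deg[OF y(1)] \<epsilon>(1), of z] by (auto simp: h_def)
      then show ?thesis using y \<epsilon>(2) by (auto simp: B_def dist_commute subset_iff)
    qed
    then show "\<exists>\<delta>>0. \<forall>y\<in>{0..1}. dist y \<theta> < \<delta> \<longrightarrow> y \<in> B" using \<delta>(1) by blast
  qed
  have cl: "closedin (top_of_set {0..1}) B"
  proof -
    \<comment> \<open>A common disc for all roots: without it, a limit of parameters with a root in
      \<open>U\<close> could lose that root to infinity.\<close>
    define b where "b = (\<lambda>\<theta>. 1 + (\<Sum>i<d. cmod (coeff (F \<theta>) i)) / cmod (coeff (F \<theta>) d))"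
    have "continuous_on {0..1} b"
      unfolding b_def using lc by (intro continuous_intros cont) auto
    then have "compact (b ` {0..1})" by (intro compact_continuous_image) auto
    then obtain R where R: "\<And>\<theta>. \<theta> \<in> {0..1} \<Longrightarrow> b \<theta> \<le> R"
      by (meson bdd_above.E bounded_imp_bdd_above compact_imp_bounded imageI)
    \<comment> \<open>The pairs of a parameter and a root in the closure of \<open>U\<close> form a
      compact set, and by \<open>frontier\<close> its projection is exactly
      \<open>B\<close>.\<close>
    define Z where "Z = {x \<in> {0..1} \<times> (closure U \<inter> cball 0 R). (\<lambda>(\<theta>, z). poly (F \<theta>) z) x = 0}"
    have comp: "compact ({0..1::real} \<times> (closure U \<inter> cball 0 R))"
      by (intro compact_Times closed_Int_compact) auto
    have "continuous_on ({0..1} \<times> (closure U \<inter> cball 0 R)) (\<lambda>(\<theta>, z). poly (F \<theta>) z)"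
      using joint by (rule continuous_on_subset) auto
    then have "closed Z"
      unfolding Z_def
      by (rule continuous_closed_preimage_constant) (rule compact_imp_closed[OF comp])
    then have "compact Z"
      using comp by (metis (no_types, lifting) Z_def compact_Int_closed inf.absorb_iff2 mem_Collect_eq subsetI)
    then have "compact (fst ` Z)" by (intro compact_continuous_image continuous_intros)
    moreover have "B = fst ` Z"
    proof
      show "B \<subseteq> fst ` Z"
      proof
        fix \<theta> assume "\<theta> \<in> B"
        then obtain z where z: "\<theta> \<in> {0..1}" "z \<in> U" "poly (F \<theta>) z = 0" by (auto simp: B_def)
        then have "cmod z \<le> R"
          using poly_root_bound[OF deg lc z(3)] R[OF z(1)] by (force simp: b_def)
        with z have "(\<theta>, z) \<in> Z" using closure_subset by (auto simp: Z_def)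
        then show "\<theta> \<in> fst ` Z" by force
      qed
    qed (use frontier in \<open>auto simp: Z_def B_def\<close>)
    ultimately have "compact B" by simp
    then show ?thesis
      by (intro closed_subset compact_imp_closed) (auto simp: B_def)
  qed
  have "B = {} \<or> B = {0..1}"
    using op cl connected_Icc[of "0::real" 1] unfolding connected_clopen by blast
  moreover have "0 \<notin> B" using start by (auto simp: B_def)
  ultimately have "1 \<notin> B" by auto
  then show ?thesis using \<open>z \<in> U\<close> by (auto simp: B_def)
qed

section \<open>Restrictions to lines and directional derivatives\<close>

text \<open>Base point and direction may be complex, unlike in \<open>line_poly\<close>; the
  homotopy in the upper half-plane has a complex base point.\<close>

definition affine_poly ::
  "'n::finite mpol \<Rightarrow> ('n \<Rightarrow> 'b::real_field) \<Rightarrow> ('n \<Rightarrow> 'b) \<Rightarrow> 'b poly" where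
  "affine_poly p v a =
     (\<Sum>m\<in>Poly_Mapping.keys p. smult (of_real (Poly_Mapping.lookup p m))
        (\<Prod>i\<in>UNIV. [:v i, a i:] ^ Poly_Mapping.lookup m i))"

lemma poly_affine_poly: "poly (affine_poly p v a) t = mpol_eval p (\<lambda>i. v i + t * a i)"
  by (simp add: affine_poly_def mpol_eval_def poly_sum poly_prod poly_power)

lemma coeff_mult_top:
  fixes p q :: "'b::idom poly"
  assumes "degree p \<le> a" "degree q \<le> b"
  shows "coeff (p * q) (a + b) = coeff p a * coeff q b"
proof (cases "degree p = a \<and> degree q = b")
  case True
  then show ?thesis by (metis coeff_mult_degree_sum)
next
  case False
  then have "degree p < a \<or> degree q < b" using assms by auto
  moreover from this have "degree (p * q) < a + b"
    using degree_mult_le[of p q] assms by linarith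
  ultimately show ?thesis by (auto simp: coeff_eq_0)
qed

lemma linear_power_top_idom:
  fixes a b :: "'b::idom"
  shows "degree ([:a, b:] ^ k) \<le> k \<and> coeff ([:a, b:] ^ k) k = b ^ k"
proof (induction k)
  case (Suc k)
  have "degree [:a, b:] \<le> 1" by simp
  moreover have "degree ([:a, b:] ^ Suc k) \<le> 1 + k"
    unfolding power_Suc
    using degree_mult_le[of "[:a, b:]" "[:a, b:] ^ k"] Suc \<open>degree [:a, b:] \<le> 1\<close> by linarith
  ultimately show ?case
    using Suc coeff_mult_top[of "[:a, b:]" 1 "[:a, b:] ^ k" k]
    by (simp del: mult_pCons_left)
qed simp

lemma prod_top_idom:
  fixes f :: "'i \<Rightarrow> 'b::idom poly"
  assumes "finite A" "\<And>i. i \<in> A \<Longrightarrow> degree (f i) \<le> k i"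
  shows "degree (\<Prod>i\<in>A. f i) \<le> (\<Sum>i\<in>A. k i) \<and>
         coeff (\<Prod>i\<in>A. f i) (\<Sum>i\<in>A. k i) = (\<Prod>i\<in>A. coeff (f i) (k i))"
  using assms
proof (induction A rule: finite_induct)
  case (insert j A)
  then have IH: "degree (\<Prod>i\<in>A. f i) \<le> (\<Sum>i\<in>A. k i)"
    "coeff (\<Prod>i\<in>A. f i) (\<Sum>i\<in>A. k i) = (\<Prod>i\<in>A. coeff (f i) (k i))" "degree (f j) \<le> k j"
    by auto
  have "degree (f j * (\<Prod>i\<in>A. f i)) \<le> k j + (\<Sum>i\<in>A. k i)"
    using degree_mult_le[of "f j" "\<Prod>i\<in>A. f i"] IH by linarith
  with coeff_mult_top[OF IH(3,1)] IH(2) insert.hyps show ?case by simp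
qed simp

text \<open>The power \<open>t ^ d\<close> arises only by picking the direction in every factor of a
  monomial. So the top coefficient ignores the base point, and it survives along a path exactly
  while \<open>p\<close> does not vanish at the direction.\<close>

lemma affine_poly_top:
  assumes "homogeneous d p"
  shows "degree (affine_poly p v a) \<le> d" "coeff (affine_poly p v a) d = mpol_eval p a"
proof -
  let ?g = "\<lambda>m. \<Prod>i\<in>UNIV. [:v i, a i:] ^ Poly_Mapping.lookup m i"
  have top: "degree (?g m) \<le> d" "coeff (?g m) d = (\<Prod>i\<in>UNIV. a i ^ Poly_Mapping.lookup m i)"
    if "m \<in> Poly_Mapping.keys p" for m
  proof -
    have "(\<Sum>i\<in>UNIV. Poly_Mapping.lookup m i) = d"
      using assms that by (auto simp: homogeneous_def)
    then show "degree (?g m) \<le> d" "coeff (?g m) d = (\<Prod>i\<in>UNIV. a i ^ Poly_Mapping.lookup m i)"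
      using prod_top_idom[of UNIV "\<lambda>i. [:v i, a i:] ^ Poly_Mapping.lookup m i" "Poly_Mapping.lookup m"]
        linear_power_top_idom[of "v i" "a i" for i] by simp_all
  qed
  show "degree (affine_poly p v a) \<le> d"
    unfolding affine_poly_def
    by (rule degree_sum_le) (auto intro: order.trans[OF degree_smult_le] top(1))
  show "coeff (affine_poly p v a) d = mpol_eval p a"
    unfolding affine_poly_def mpol_eval_def by (simp add: coeff_sum top(2))
qed

lemma continuous_on_coeff_affine_poly:
  fixes v a :: "'t::topological_space \<Rightarrow> 'n::finite \<Rightarrow> 'b::{real_field, real_normed_algebra}"
  assumes "\<And>i. continuous_on S (\<lambda>t. v t i)" "\<And>i. continuous_on S (\<lambda>t. a t i)"
  shows "continuous_on S (\<lambda>t. coeff (affine_poly p (v t) (a t)) k)"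
proof -
  define good where "good F \<longleftrightarrow> (\<forall>k. continuous_on S (\<lambda>t. coeff (F t) k))" for F :: "'t \<Rightarrow> 'b poly"
  have mult: "good (\<lambda>t. F t * G t)" if "good F" "good G" for F G
    using that unfolding good_def coeff_mult by (auto intro!: continuous_intros)
  have const: "good (\<lambda>t. c)" for c by (simp add: good_def)
  have lin: "good (\<lambda>t. [:v t i, a t i:])" for i
    unfolding good_def
  proof
    fix k
    show "continuous_on S (\<lambda>t. coeff [:v t i, a t i:] k)"
      using assms by (cases k; cases "k - 1") (auto simp: coeff_pCons split: nat.splits)
  qed
  have pow: "good (\<lambda>t. F t ^ j)" if "good F" for F j
    using that by (induction j) (auto intro: mult const)
  have prd: "good (\<lambda>t. \<Prod>i\<in>A. F i t)" if "\<And>i. good (F i)" for A :: "'n set" and F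
    using that by (induction A rule: infinite_finite_induct) (auto intro: mult const)
  show ?thesis
    unfolding affine_poly_def coeff_sum coeff_smult
    by (intro continuous_intros) (use prd[OF pow[OF lin]] in \<open>auto simp: good_def\<close>)
qed

lemma mpol_eval_scale:
  assumes "homogeneous d p"
  shows "mpol_eval p (\<lambda>i. c * v i) = c ^ d * mpol_eval p v"
  unfolding mpol_eval_def sum_distrib_left
  using assms
  by (intro sum.cong refl)
    (simp add: power_mult_distrib prod.distrib homogeneous_def flip: power_sum)

lemma mpol_eval_of_real: "mpol_eval p (\<lambda>i. of_real (v i)) = of_real (mpol_eval p v)"
  by (simp add: mpol_eval_def)

lemma continuous_on_mpol_eval:
  fixes v :: "'t::topological_space \<Rightarrow> 'n::finite \<Rightarrow> 'b::{real_field, real_normed_algebra}"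
  assumes "\<And>i. continuous_on S (\<lambda>t. v t i)"
  shows "continuous_on S (\<lambda>t. mpol_eval p (v t))"
  unfolding mpol_eval_def using assms
  by (intro continuous_intros)

section \<open>Formal directional derivatives\<close>

lemma mpol_eval_superset:
  assumes "finite A" "Poly_Mapping.keys p \<subseteq> A"
  shows "mpol_eval p x = (\<Sum>m\<in>A. of_real (Poly_Mapping.lookup p m) * (\<Prod>i\<in>UNIV. x i ^ Poly_Mapping.lookup m i))"
  unfolding mpol_eval_def using assms
  by (intro sum.mono_neutral_left) (auto simp: in_keys_iff)

lemma mpol_eval_add: "mpol_eval (p + q) x = mpol_eval p x + mpol_eval q x"
proof -
  let ?A = "Poly_Mapping.keys p \<union> Poly_Mapping.keys q"
  have "Poly_Mapping.keys (p + q) \<subseteq> ?A" by (rule keys_add)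
  then show ?thesis
    using mpol_eval_superset[of ?A "p + q" x] mpol_eval_superset[of ?A p x] mpol_eval_superset[of ?A q x]
    by (simp add: lookup_add ring_distribs sum.distrib)
qed

lemma mpol_eval_zero: "mpol_eval 0 x = 0"
  by (simp add: mpol_eval_def)

lemma mpol_eval_sum: "mpol_eval (\<Sum>i\<in>A. f i) x = (\<Sum>i\<in>A. mpol_eval (f i) x)"
  by (induction A rule: infinite_finite_induct) (simp_all add: mpol_eval_add mpol_eval_zero)

lemma mpol_eval_single:
  "mpol_eval (Poly_Mapping.single m c) x = of_real c * (\<Prod>i\<in>UNIV. x i ^ Poly_Mapping.lookup m i)"
  using mpol_eval_superset[of "{m}" "Poly_Mapping.single m c" x] by simp

text \<open>Kept as a polynomial so that it can be differentiated again and evaluated at complex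
  points. If the variable \<open>i\<close> is absent from \<open>m\<close>, the truncated
  subtraction is harmless because the coefficient is 0.\<close>

definition dir_deriv :: "real^'n \<Rightarrow> 'n::finite mpol \<Rightarrow> 'n mpol" where
  "dir_deriv u p = (\<Sum>m\<in>Poly_Mapping.keys p. \<Sum>i\<in>UNIV.
     Poly_Mapping.single (m - Poly_Mapping.single i 1)
       (Poly_Mapping.lookup p m * (of_nat (Poly_Mapping.lookup m i) * u $ i)))"

lemma mpol_eval_dir_deriv:
  fixes p :: "'n::finite mpol"
  shows "mpol_eval (dir_deriv u p) x = (\<Sum>m\<in>Poly_Mapping.keys p. \<Sum>i\<in>UNIV.
     of_real (Poly_Mapping.lookup p m) * (of_nat (Poly_Mapping.lookup m i) * of_real (u $ i)) *
     (x i ^ (Poly_Mapping.lookup m i - 1) * (\<Prod>j\<in>UNIV - {i}. x j ^ Poly_Mapping.lookup m j)))"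
proof -
  have "(\<Prod>j\<in>UNIV. x j ^ Poly_Mapping.lookup (m - Poly_Mapping.single i 1) j) =
      x i ^ (Poly_Mapping.lookup m i - 1) * (\<Prod>j\<in>UNIV - {i}. x j ^ Poly_Mapping.lookup m j)"
    for m :: "'n \<Rightarrow>\<^sub>0 nat" and i
    by (subst prod.remove[of UNIV i])
      (auto simp: lookup_minus lookup_single when_def intro!: prod.cong)
  then show ?thesis
    by (simp add: dir_deriv_def mpol_eval_sum mpol_eval_single)
qed

lemma mpol_eval_has_field_derivative:
  fixes x :: "'n::finite \<Rightarrow> 'b::{real_field, real_normed_field}"
  shows "((\<lambda>s. mpol_eval p (\<lambda>i. x i + s * of_real (u $ i))) has_field_derivative
     mpol_eval (dir_deriv u p) (\<lambda>i. x i + s * of_real (u $ i))) (at s)"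
proof -
  have "((\<lambda>s. \<Prod>i\<in>UNIV. (x i + s * of_real (u $ i)) ^ Poly_Mapping.lookup m i) has_field_derivative
      (\<Sum>i\<in>UNIV. of_nat (Poly_Mapping.lookup m i) * of_real (u $ i) * (x i + s * of_real (u $ i)) ^ (Poly_Mapping.lookup m i - 1)
        * (\<Prod>j\<in>UNIV - {i}. (x j + s * of_real (u $ j)) ^ Poly_Mapping.lookup m j))) (at s)"
    for m :: "'n \<Rightarrow>\<^sub>0 nat"
    by (rule has_field_derivative_prod) (auto intro!: derivative_eq_intros)
  then have "((\<lambda>s. mpol_eval p (\<lambda>i. x i + s * of_real (u $ i))) has_field_derivative
     (\<Sum>m\<in>Poly_Mapping.keys p. of_real (Poly_Mapping.lookup p m) *
      (\<Sum>i\<in>UNIV. of_nat (Poly_Mapping.lookup m i) * of_real (u $ i) * (x i + s * of_real (u $ i)) ^ (Poly_Mapping.lookup m i - 1)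
        * (\<Prod>j\<in>UNIV - {i}. (x j + s * of_real (u $ j)) ^ Poly_Mapping.lookup m j)))) (at s)"
    unfolding mpol_eval_def by (intro DERIV_sum DERIV_cmult)
  then show ?thesis
    by (simp add: mpol_eval_dir_deriv sum_distrib_left mult_ac)
qed

text \<open>Linearity in the direction is what allows the barrier inequalities to be summed over the
  family.\<close>

lemma mpol_eval_dir_deriv_sum:
  fixes x :: "'n::finite \<Rightarrow> real"
  shows "mpol_eval (dir_deriv (\<Sum>k\<in>A. c k *\<^sub>R u k) p) x = (\<Sum>k\<in>A. c k * mpol_eval (dir_deriv (u k) p) x)"
proof -
  define f where "f k m i = c k * (Poly_Mapping.lookup p m * (real (Poly_Mapping.lookup m i) * u k $ i) *
     (x i ^ (Poly_Mapping.lookup m i - 1) * (\<Prod>j\<in>UNIV - {i}. x j ^ Poly_Mapping.lookup m j)))" for k m i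
  have "mpol_eval (dir_deriv (\<Sum>k\<in>A. c k *\<^sub>R u k) p) x =
      (\<Sum>m\<in>Poly_Mapping.keys p. \<Sum>i\<in>UNIV. \<Sum>k\<in>A. f k m i)"
    by (simp add: mpol_eval_dir_deriv f_def sum_distrib_left sum_distrib_right sum_component mult_ac)
  also have "\<dots> = (\<Sum>m\<in>Poly_Mapping.keys p. \<Sum>k\<in>A. \<Sum>i\<in>UNIV. f k m i)"
    by (intro sum.cong refl sum.swap)
  also have "\<dots> = (\<Sum>k\<in>A. \<Sum>m\<in>Poly_Mapping.keys p. \<Sum>i\<in>UNIV. f k m i)"
    by (rule sum.swap)
  also have "\<dots> = (\<Sum>k\<in>A. c k * mpol_eval (dir_deriv (u k) p) x)"
    by (simp add: mpol_eval_dir_deriv f_def sum_distrib_left)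
  finally show ?thesis .
qed

lemma homogeneous_dir_deriv:
  assumes "homogeneous d p"
  shows "homogeneous (d - 1) (dir_deriv u p)"
  unfolding homogeneous_def
proof
  fix m' assume "m' \<in> Poly_Mapping.keys (dir_deriv u p)"
  then obtain m where m: "m \<in> Poly_Mapping.keys p" and
    "m' \<in> Poly_Mapping.keys (\<Sum>i\<in>UNIV. Poly_Mapping.single (m - Poly_Mapping.single i 1)
       (Poly_Mapping.lookup p m * (of_nat (Poly_Mapping.lookup m i) * u $ i)))"
    unfolding dir_deriv_def using keys_sum by fastforce
  then obtain i where "m' \<in> Poly_Mapping.keys (Poly_Mapping.single (m - Poly_Mapping.single i 1)
       (Poly_Mapping.lookup p m * (of_nat (Poly_Mapping.lookup m i) * u $ i)))"
    using keys_sum by fastforce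
  then have m': "m' = m - Poly_Mapping.single i 1" and "Poly_Mapping.lookup m i > 0"
    by (auto split: if_splits)
  then have "(\<Sum>j\<in>UNIV. Poly_Mapping.lookup m j) = (\<Sum>j\<in>UNIV. Poly_Mapping.lookup m' j) + 1"
    by (subst (1 2) sum.remove[of UNIV i])
      (auto simp: lookup_minus lookup_single when_def intro!: sum.cong)
  moreover have "(\<Sum>j\<in>UNIV. Poly_Mapping.lookup m j) = d"
    using m assms by (simp add: homogeneous_def)
  ultimately show "(\<Sum>j\<in>UNIV. Poly_Mapping.lookup m' j) = d - 1" by simp
qed

section \<open>Garding's theory of hyperbolicity cones\<close>

text \<open>Garding's open cone: if \<open>p\<close> is hyperbolic in the direction
  \<open>a\<close>, these are the vectors with only positive eigenvalues relative to
  \<open>a\<close>. The direction is a parameter because the theory consists in changing it.\<close>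

definition pos_cone :: "'n::finite mpol \<Rightarrow> real^'n \<Rightarrow> (real^'n) set" where
  "pos_cone p a = {b. \<forall>s\<ge>0. mpol_eval p (($) (b + s *\<^sub>R a)) \<noteq> 0}"

lemma mpol_eval_scaleR:
  assumes "homogeneous d p"
  shows "mpol_eval p (($) (c *\<^sub>R v)) = c ^ d * mpol_eval p (($) v)"
proof -
  have "($) (c *\<^sub>R v) = (\<lambda>i. c * v $ i)" by (simp add: fun_eq_iff)
  then show ?thesis using mpol_eval_scale[OF assms, of c "($) v"] by simp
qed

lemma continuous_on_mpol_eval_vec [continuous_intros]:
  fixes v :: "'t::topological_space \<Rightarrow> real^'n"
  assumes "continuous_on S v"
  shows "continuous_on S (\<lambda>t. mpol_eval p (($) (v t)))"
  using assms by (intro continuous_on_mpol_eval continuous_intros)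

lemma hyperbolic_nonreal:
  fixes z :: complex
  assumes "hyperbolic d p e" "z \<notin> \<real>"
  shows "mpol_eval p (\<lambda>i. of_real (v $ i) + z * of_real (e $ i)) \<noteq> 0"
proof -
  have "mpol_eval p (\<lambda>i. z * of_real (e $ i) - of_real ((- v) $ i)) \<noteq> 0"
    using assms unfolding hyperbolic_def by blast
  then show ?thesis by (simp add: add.commute)
qed

text \<open>Scale \<open>v\<close> down to 0. On the real axis \<tau> is never a root, by
  hyperbolicity in the direction \<open>e\<close>, so no root can enter the upper half-plane along
  the way. At \<open>v = 0\<close> a root \<open>z\<close> would make
  \<open>\<i> * \<alpha> / z\<close> a real number \<rho> with \<open>p(a + \<rho> e) = 0\<close>;
  comparing imaginary parts gives \<open>\<alpha> = \<rho> * Im z\<close>, so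
  \<open>\<rho> \<ge> 0\<close>, which contradicts that \<open>a\<close> is in the cone.\<close>

lemma hyperbolic_upper_half_plane:
  assumes hyp: "hyperbolic d p e" and a: "a \<in> pos_cone p e" and "0 < \<alpha>" "0 \<le> Im \<tau>"
  shows "mpol_eval p (\<lambda>i. of_real (v $ i) + \<tau> * of_real (a $ i) + \<i> * of_real (\<alpha> * e $ i)) \<noteq> 0"
proof (cases "Im \<tau> = 0")
  case True
  then have \<tau>: "\<tau> = of_real (Re \<tau>)" by (simp add: complex_eq_iff)
  have "\<i> * of_real \<alpha> \<notin> \<real>" using \<open>0 < \<alpha>\<close> by (simp add: complex_is_Real_iff)
  from hyperbolic_nonreal[OF hyp this, of "v + Re \<tau> *\<^sub>R a"]
  show ?thesis by (subst \<tau>) (simp add: mult_ac)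
next
  case False
  then have "0 < Im \<tau>" using assms by simp
  have hom: "homogeneous d p" using hyp by (simp add: hyperbolic_def)
  have pa: "mpol_eval p (($) a) \<noteq> 0" using a by (auto simp: pos_cone_def dest: spec[of _ 0])
  define F where "F = (\<lambda>\<theta>. affine_poly p (\<lambda>i. of_real (\<theta> * v $ i) + \<i> * of_real (\<alpha> * e $ i))
    (\<lambda>i. complex_of_real (a $ i)))"
  have F: "poly (F \<theta>) z =
      mpol_eval p (\<lambda>i. of_real (\<theta> * v $ i) + z * of_real (a $ i) + \<i> * of_real (\<alpha> * e $ i))" for \<theta> z
    by (simp add: F_def poly_affine_poly add_ac)
  have real_case: "poly (F \<theta>) z \<noteq> 0" if "Im z = 0" for \<theta> z
  proof -
    have z: "z = of_real (Re z)" using that by (simp add: complex_eq_iff)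
    have "\<i> * of_real \<alpha> \<notin> \<real>" using \<open>0 < \<alpha>\<close> by (simp add: complex_is_Real_iff)
    from hyperbolic_nonreal[OF hyp this, of "\<theta> *\<^sub>R v + Re z *\<^sub>R a"]
    show ?thesis unfolding F by (subst z) (simp add: mult_ac)
  qed
  have "poly (F 1) \<tau> \<noteq> 0"
  proof (rule no_root_along_path[where F = F and d = d and U = "{z. 0 < Im z}"])
    show "continuous_on {0..1} (\<lambda>\<theta>. coeff (F \<theta>) k)" for k
      unfolding F_def by (intro continuous_on_coeff_affine_poly continuous_intros)
    show "degree (F \<theta>) \<le> d" for \<theta> unfolding F_def by (rule affine_poly_top[OF hom])
    show "coeff (F \<theta>) d \<noteq> 0" for \<theta>
      unfolding F_def affine_poly_top(2)[OF hom] mpol_eval_of_real using pa by simp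
    show "open {z. 0 < Im z}" by (rule open_halfspace_Im_gt)
    show "z \<in> {z. 0 < Im z}" if "z \<in> closure {z. 0 < Im z}" "poly (F \<theta>) z = 0" for \<theta> z
    proof -
      have "closure {z. 0 < Im z} \<subseteq> {z. 0 \<le> Im z}"
        by (rule closure_minimal) (auto simp: closed_halfspace_Im_ge)
      with that real_case[of z \<theta>] show ?thesis by force
    qed
    show "\<tau> \<in> {z. 0 < Im z}" using \<open>0 < Im \<tau>\<close> by simp
    show "poly (F 0) z \<noteq> 0" if "z \<in> {z. 0 < Im z}" for z
    proof
      assume 0: "poly (F 0) z = 0"
      have z: "0 < Im z" "z \<noteq> 0" using that by auto
      have "poly (F 0) z = mpol_eval p (\<lambda>i. z * (of_real (a $ i) + (\<i> * of_real \<alpha> / z) * of_real (e $ i)))"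
        using z by (simp add: F distrib_left mult_ac)
      also have "\<dots> = z ^ d * mpol_eval p (\<lambda>i. of_real (a $ i) + (\<i> * of_real \<alpha> / z) * of_real (e $ i))"
        by (rule mpol_eval_scale[OF hom])
      finally have 1: "mpol_eval p (\<lambda>i. of_real (a $ i) + (\<i> * of_real \<alpha> / z) * of_real (e $ i)) = 0"
        using 0 z by simp
      then have "\<i> * of_real \<alpha> / z \<in> \<real>" using hyperbolic_nonreal[OF hyp] by blast
      then obtain \<rho> where \<rho>: "\<i> * of_real \<alpha> / z = of_real \<rho>" by (auto elim: Reals_cases)
      then have "\<i> * of_real \<alpha> = of_real \<rho> * z" using z by (simp add: field_simps)
      from arg_cong[OF this, of Im] have "\<alpha> = \<rho> * Im z" by simp
      then have "0 \<le> \<rho>" using \<open>0 < \<alpha>\<close> z by (metis less_eq_real_def not_less zero_less_mult_pos2)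
      have "mpol_eval p (\<lambda>i. complex_of_real ((a + \<rho> *\<^sub>R e) $ i)) = 0" using 1 by (simp add: \<rho>)
      then have "mpol_eval p (($) (a + \<rho> *\<^sub>R e)) = 0" unfolding mpol_eval_of_real by (simp only: of_real_eq_0_iff)
      with a \<open>0 \<le> \<rho>\<close> show False by (auto simp: pos_cone_def)
    qed
  qed
  then show ?thesis by (simp add: F)
qed

lemma pos_cone_nonzero: "a \<in> pos_cone p e \<Longrightarrow> mpol_eval p (($) a) \<noteq> 0"
  by (auto simp: pos_cone_def dest: spec[of _ 0])

lemma pos_cone_add_dir: "a \<in> pos_cone p e \<Longrightarrow> 0 \<le> s \<Longrightarrow> a + s *\<^sub>R e \<in> pos_cone p e"
  by (auto simp: pos_cone_def add.assoc simp flip: scaleR_left_distrib)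

lemma pos_cone_self:
  assumes "hyperbolic d p e"
  shows "e \<in> pos_cone p e"
  unfolding pos_cone_def
proof (safe)
  fix s :: real assume "0 \<le> s" "mpol_eval p (($) (e + s *\<^sub>R e)) = 0"
  moreover have "e + s *\<^sub>R e = (1 + s) *\<^sub>R e" by (simp add: scaleR_left_distrib)
  ultimately show False
    using assms mpol_eval_scaleR[of d p "1 + s" e] by (auto simp: hyperbolic_def)
qed

lemma pos_cone_scale:
  assumes "hyperbolic d p e" "a \<in> pos_cone p e" "0 < r"
  shows "r *\<^sub>R a \<in> pos_cone p e"
  unfolding pos_cone_def
proof (safe)
  fix s :: real assume s: "0 \<le> s" "mpol_eval p (($) (r *\<^sub>R a + s *\<^sub>R e)) = 0"
  have "r *\<^sub>R a + s *\<^sub>R e = r *\<^sub>R (a + (s / r) *\<^sub>R e)"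
    using \<open>0 < r\<close> by (simp add: scaleR_right_distrib)
  then have "mpol_eval p (($) (a + (s / r) *\<^sub>R e)) = 0"
    using s assms mpol_eval_scaleR[of d p r "a + (s / r) *\<^sub>R e"] by (auto simp: hyperbolic_def)
  with assms s show False by (auto simp: pos_cone_def)
qed

lemma pos_cone_pos:
  assumes hyp: "hyperbolic d p e" and a: "a \<in> pos_cone p e"
  shows "0 < mpol_eval p (($) a)"
proof -
  define h where "h = (\<lambda>\<theta>. mpol_eval p (($) ((1 - \<theta>) *\<^sub>R e + \<theta> *\<^sub>R a)))"
  have nz: "h \<theta> \<noteq> 0" if "0 \<le> \<theta>" "\<theta> \<le> 1" for \<theta>
  proof (cases "\<theta> = 0")
    case True
    then show ?thesis using hyp by (simp add: h_def hyperbolic_def)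
  next
    case False
    then have "\<theta> *\<^sub>R a \<in> pos_cone p e" using pos_cone_scale[OF hyp a, of \<theta>] that by simp
    from pos_cone_add_dir[OF this, of "1 - \<theta>"] that show ?thesis
      using pos_cone_nonzero by (auto simp: h_def add.commute)
  qed
  have "continuous_on {0..1} h" unfolding h_def by (intro continuous_intros)
  moreover have "0 < h 0" using hyp by (simp add: h_def hyperbolic_def)
  ultimately have "0 < h 1"
    using IVT2'[of h 1 0 0] nz by (metis atLeastAtMost_iff le_less_linear less_imp_le zero_le_one)
  then show ?thesis by (simp add: h_def)
qed

text \<open>Openness in the direction \<open>e\<close>: near 0 by continuity, further out by the
  definition of the cone. It allows \<open>a\<close> to be split into a member of the cone and a
  positive multiple of \<open>e\<close>.\<close>

lemma pos_cone_sub_dir: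
  assumes hyp: "hyperbolic d p e" and a: "a \<in> pos_cone p e"
  shows "\<exists>s>0. a - s *\<^sub>R e \<in> pos_cone p e"
proof -
  define h where "h = (\<lambda>s. mpol_eval p (($) (a - s *\<^sub>R e)))"
  have "continuous_on UNIV h" unfolding h_def by (intro continuous_intros)
  moreover have "h 0 \<noteq> 0" using pos_cone_nonzero[OF a] by (simp add: h_def)
  ultimately obtain \<delta> where \<delta>: "0 < \<delta>" "\<And>s. dist s 0 < \<delta> \<Longrightarrow> h s \<noteq> 0"
    using continuous_on_open_avoid[of UNIV h 0 0] by auto
  have "mpol_eval p (($) (a - (\<delta> / 2) *\<^sub>R e + s *\<^sub>R e)) \<noteq> 0" if "0 \<le> s" for s
  proof (cases "s \<le> \<delta> / 2")
    case True
    have eq: "a - (\<delta> / 2) *\<^sub>R e + s *\<^sub>R e = a - (\<delta> / 2 - s) *\<^sub>R e" by (simp add: algebra_simps)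
    show ?thesis
      unfolding eq using \<delta>(2)[of "\<delta> / 2 - s"] \<delta>(1) True that by (simp add: h_def dist_real_def)
  next
    case False
    have eq: "a - (\<delta> / 2) *\<^sub>R e + s *\<^sub>R e = a + (s - \<delta> / 2) *\<^sub>R e" by (simp add: algebra_simps)
    show ?thesis unfolding eq using a False by (simp add: pos_cone_def)
  qed
  then show ?thesis using \<delta>(1) by (intro exI[of _ "\<delta> / 2"]) (simp add: pos_cone_def)
qed

text \<open>Split \<open>a\<close> as \<open>(a - s *\<^sub>R e) + s *\<^sub>R e\<close> with both
  summands in the cone. The imaginary part of \<open>v + z a\<close> then has the shape that
  \<open>hyperbolic_upper_half_plane\<close> excludes; the lower half-plane follows by
  homogeneity.\<close>

lemma hyperbolic_pos_cone:
  assumes hyp: "hyperbolic d p e" and a: "a \<in> pos_cone p e"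
  shows "hyperbolic d p a"
proof -
  have hom: "homogeneous d p" using hyp by (simp add: hyperbolic_def)
  obtain s where s: "0 < s" "a - s *\<^sub>R e \<in> pos_cone p e" using pos_cone_sub_dir[OF hyp a] by blast
  have up: "mpol_eval p (\<lambda>i. of_real (v $ i) + z * of_real (a $ i)) \<noteq> 0" if "0 < Im z" for v z
  proof -
    have nz: "mpol_eval p (\<lambda>i. of_real ((v + Re z *\<^sub>R a) $ i) + (\<i> * of_real (Im z)) * of_real ((a - s *\<^sub>R e) $ i)
        + \<i> * of_real ((Im z * s) * e $ i)) \<noteq> 0"
      using that s by (intro hyperbolic_upper_half_plane[OF hyp s(2)]) auto
    have eq: "of_real ((v + Re z *\<^sub>R a) $ i) + (\<i> * of_real (Im z)) * of_real ((a - s *\<^sub>R e) $ i)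
        + \<i> * of_real ((Im z * s) * e $ i) = of_real (v $ i) + z * of_real (a $ i)" for i
      by (simp add: complex_eq_iff algebra_simps)
    show ?thesis using nz unfolding eq .
  qed
  have "z \<in> \<real>" if z: "mpol_eval p (\<lambda>i. z * of_real (a $ i) - of_real (x $ i)) = 0" for x and z :: complex
  proof (rule ccontr)
    assume "z \<notin> \<real>"
    then consider "0 < Im z" | "0 < Im (- z)" by (force simp: complex_is_Real_iff)
    then show False
    proof cases
      case 1
      from up[OF this, of "- x"] z show False by (simp add: add.commute)
    next
      case 2
      have "mpol_eval p (\<lambda>i. (-1) * (z * of_real (a $ i) - of_real (x $ i))) = 0"
        unfolding mpol_eval_scale[OF hom] z by simp
      with up[OF 2, of x] show False by simp
    qed
  qed
  with hom pos_cone_pos[OF hyp a] show ?thesis by (auto simp: hyperbolic_def)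
qed

text \<open>Rotate the direction from \<open>e\<close> to \<open>a\<close> along a segment in the
  cone. Every direction on it is hyperbolic, so the roots of \<open>z \<mapsto> p(b + z c)\<close>
  stay real, and they avoid 0 because \<open>p(b)\<close> is nonzero. Hence they cannot cross the
  imaginary axis, and none becomes positive.\<close>

lemma pos_cone_change_dir:
  assumes hyp: "hyperbolic d p e" and a: "a \<in> pos_cone p e" and b: "b \<in> pos_cone p e"
  shows "b \<in> pos_cone p a"
  unfolding pos_cone_def
proof safe
  fix s :: real assume "0 \<le> s" and eq: "mpol_eval p (($) (b + s *\<^sub>R a)) = 0"
  have hom: "homogeneous d p" using hyp by (simp add: hyperbolic_def)
  define c where "c \<theta> = (1 - \<theta>) *\<^sub>R e + \<theta> *\<^sub>R a" for \<theta>
  have c: "c \<theta> \<in> pos_cone p e" if "0 \<le> \<theta>" "\<theta> \<le> 1" for \<theta>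
  proof (cases "\<theta> = 0")
    case True
    then show ?thesis using pos_cone_self[OF hyp] by (simp add: c_def)
  next
    case False
    then have "\<theta> *\<^sub>R a \<in> pos_cone p e" using pos_cone_scale[OF hyp a, of \<theta>] that by simp
    from pos_cone_add_dir[OF this, of "1 - \<theta>"] that show ?thesis
      by (simp add: c_def add.commute)
  qed
  define F where "F = (\<lambda>\<theta>. affine_poly p (\<lambda>i. complex_of_real (b $ i)) (\<lambda>i. complex_of_real (c \<theta> $ i)))"
  have F: "poly (F \<theta>) z = mpol_eval p (\<lambda>i. of_real (b $ i) + z * of_real (c \<theta> $ i))" for \<theta> z
    by (simp add: F_def poly_affine_poly)
  have b0: "mpol_eval p (\<lambda>i. complex_of_real (b $ i)) \<noteq> 0"
    unfolding mpol_eval_of_real using pos_cone_nonzero[OF b] by simp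
  have "s \<noteq> 0" using eq pos_cone_nonzero[OF b] by auto
  then have "0 < s" using \<open>0 \<le> s\<close> by simp
  have "poly (F 1) (of_real s) \<noteq> 0"
  proof (rule no_root_along_path[where F = F and d = d and U = "{z. 0 < Re z}"])
    show "continuous_on {0..1} (\<lambda>\<theta>. coeff (F \<theta>) k)" for k
      unfolding F_def c_def by (intro continuous_on_coeff_affine_poly continuous_intros)
    show "degree (F \<theta>) \<le> d" for \<theta> unfolding F_def by (rule affine_poly_top[OF hom])
    show "coeff (F \<theta>) d \<noteq> 0" if "\<theta> \<in> {0..1}" for \<theta>
      unfolding F_def affine_poly_top(2)[OF hom] mpol_eval_of_real
      using pos_cone_nonzero[OF c] that by simp
    show "open {z. 0 < Re z}" by (rule open_halfspace_Re_gt)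
    show "z \<in> {z. 0 < Re z}"
      if "\<theta> \<in> {0..1}" "z \<in> closure {z. 0 < Re z}" and 0: "poly (F \<theta>) z = 0" for \<theta> z
    proof -
      have "closure {z. 0 < Re z} \<subseteq> {z. 0 \<le> Re z}"
        by (rule closure_minimal) (auto simp: closed_halfspace_Re_ge)
      moreover have "z \<in> \<real>"
        using hyperbolic_nonreal[OF hyperbolic_pos_cone[OF hyp c]] 0 that unfolding F by auto
      moreover have "z \<noteq> 0" using 0 b0 by (auto simp: F)
      ultimately show ?thesis using that by (force simp: complex_is_Real_iff complex_eq_iff)
    qed
    show "of_real s \<in> {z. 0 < Re z}" using \<open>0 < s\<close> by simp
    show "poly (F 0) z \<noteq> 0" if "z \<in> {z. 0 < Re z}" for z
    proof
      assume 0: "poly (F 0) z = 0"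
      then have "z \<in> \<real>" using hyperbolic_nonreal[OF hyp] unfolding F by (auto simp: c_def)
      then obtain r where r: "z = of_real r" by (auto elim: Reals_cases)
      have "mpol_eval p (\<lambda>i. complex_of_real ((b + r *\<^sub>R e) $ i)) = 0" using 0 by (simp add: F r c_def)
      then have "mpol_eval p (($) (b + r *\<^sub>R e)) = 0" unfolding mpol_eval_of_real by (simp only: of_real_eq_0_iff)
      with b that r show False by (auto simp: pos_cone_def)
    qed
  qed
  moreover have "poly (F 1) (of_real s) = mpol_eval p (\<lambda>i. complex_of_real ((b + s *\<^sub>R a) $ i))"
    by (simp add: F c_def)
  ultimately show False using eq unfolding mpol_eval_of_real by (simp only: of_real_0)
qed

lemma pos_cone_eq:
  assumes "hyperbolic d p e" "a \<in> pos_cone p e"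
  shows "pos_cone p a = pos_cone p e"
proof
  show "pos_cone p e \<subseteq> pos_cone p a" using pos_cone_change_dir[OF assms] by blast
  then have "e \<in> pos_cone p a" using pos_cone_self[OF assms(1)] by blast
  then show "pos_cone p a \<subseteq> pos_cone p e"
    using pos_cone_change_dir[OF hyperbolic_pos_cone[OF assms]] by blast
qed

text \<open>Convexity of the cone: adding a multiple of the direction is harmless, and
  \<open>a\<close> may be taken as the direction.\<close>

lemma pos_cone_add:
  assumes "hyperbolic d p e" "a \<in> pos_cone p e" "b \<in> pos_cone p e"
  shows "a + b \<in> pos_cone p e"
  using pos_cone_add_dir[of b p a 1] pos_cone_change_dir[OF assms] pos_cone_eq[OF assms(1,2)]
  by (simp add: add.commute)

section \<open>The closed hyperbolicity cone\<close>

text \<open>Homogeneity with the factor -1 turns an eigenvalue \<open>t\<close> of \<open>x\<close>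
  into the zero \<open>-t\<close> of \<open>s \<mapsto> p(x + s e)\<close>. Approaching the closed
  cone through the open one makes its closure properties consequences of those of
  \<open>pos_cone\<close>.\<close>

lemma mem_hyperbolicity_cone:
  assumes hyp: "hyperbolic d p e"
  shows "x \<in> hyperbolicity_cone p e \<longleftrightarrow> (\<forall>s>0. x + s *\<^sub>R e \<in> pos_cone p e)"
proof -
  have hom: "homogeneous d p" using hyp by (simp add: hyperbolic_def)
  \<comment> \<open>The zero polynomial has no \<open>proots\<close>, so it would not report its
    zeros; but it would have the nonreal root \<i>.\<close>
  have "line_poly p e x \<noteq> 0"
  proof
    assume "line_poly p e x = 0"
    then have "mpol_eval p (\<lambda>i. \<i> * of_real (e $ i) - of_real (x $ i)) = 0"
      by (simp flip: poly_line_poly_complex)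
    then have "\<i> \<in> \<real>" using hyp unfolding hyperbolic_def by blast
    then show False by (simp add: complex_is_Real_iff)
  qed
  then have "set (hyp_eigenvalues p e x) = {t. mpol_eval p (($) (t *\<^sub>R e - x)) = 0}"
    by (simp add: hyp_eigenvalues_def poly_line_poly)
  then have "x \<in> hyperbolicity_cone p e \<longleftrightarrow> (\<forall>t. mpol_eval p (($) (t *\<^sub>R e - x)) = 0 \<longrightarrow> 0 \<le> t)"
    by (simp add: hyperbolicity_cone_def)
  also have "\<dots> \<longleftrightarrow> (\<forall>s>0. mpol_eval p (($) (x + s *\<^sub>R e)) \<noteq> 0)"
  proof -
    have "mpol_eval p (($) (t *\<^sub>R e - x)) = 0 \<longleftrightarrow> mpol_eval p (($) (x + (- t) *\<^sub>R e)) = 0" for t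
      using mpol_eval_scaleR[OF hom, of "-1" "x + (- t) *\<^sub>R e"] by simp
    then show ?thesis by (metis add.inverse_inverse neg_0_less_iff_less not_le)
  qed
  also have "\<dots> \<longleftrightarrow> (\<forall>s>0. x + s *\<^sub>R e \<in> pos_cone p e)"
    by (auto simp: pos_cone_def add.assoc simp flip: scaleR_left_distrib)
      (metis add.right_neutral order_refl)
  finally show ?thesis .
qed

lemma pos_cone_subset_hyperbolicity_cone:
  "hyperbolic d p e \<Longrightarrow> pos_cone p e \<subseteq> hyperbolicity_cone p e"
  using pos_cone_add_dir by (fastforce simp: mem_hyperbolicity_cone)

text \<open>A small multiple of \<open>e\<close> is moved from \<open>a\<close>, which can spare it,
  to \<open>x\<close>, which it brings into the open cone.\<close>

lemma hyperbolicity_cone_add_pos: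
  assumes "hyperbolic d p e" "x \<in> hyperbolicity_cone p e" "a \<in> pos_cone p e"
  shows "x + a \<in> pos_cone p e"
proof -
  obtain s where s: "0 < s" "a - s *\<^sub>R e \<in> pos_cone p e"
    using pos_cone_sub_dir assms(1,3) by blast
  have "x + s *\<^sub>R e \<in> pos_cone p e" using assms s(1) mem_hyperbolicity_cone by blast
  from pos_cone_add[OF assms(1) this s(2)] show ?thesis by simp
qed

lemma hyperbolicity_cone_add:
  assumes "hyperbolic d p e" "x \<in> hyperbolicity_cone p e" "y \<in> hyperbolicity_cone p e"
  shows "x + y \<in> hyperbolicity_cone p e"
  unfolding mem_hyperbolicity_cone[OF assms(1)]
  using assms hyperbolicity_cone_add_pos[OF assms(1,2)] by (metis add.assoc mem_hyperbolicity_cone)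

lemma hyperbolicity_cone_scale:
  assumes "hyperbolic d p e" "x \<in> hyperbolicity_cone p e" "0 \<le> r"
  shows "r *\<^sub>R x \<in> hyperbolicity_cone p e"
proof (cases "r = 0")
  case True
  then show ?thesis
    using assms(1) pos_cone_scale[OF assms(1) pos_cone_self[OF assms(1)]]
    by (simp add: mem_hyperbolicity_cone)
next
  case False
  show ?thesis
    unfolding mem_hyperbolicity_cone[OF assms(1)]
  proof safe
    fix s :: real assume "0 < s"
    then have "r *\<^sub>R (x + (s / r) *\<^sub>R e) \<in> pos_cone p e"
      using assms False mem_hyperbolicity_cone[OF assms(1)] by (intro pos_cone_scale[OF assms(1)]) auto
    then show "r *\<^sub>R x + s *\<^sub>R e \<in> pos_cone p e" using False by (simp add: scaleR_right_distrib)
  qed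
qed

lemma hyperbolicity_cone_sum:
  assumes "hyperbolic d p e" "\<And>i. i \<in> A \<Longrightarrow> f i \<in> hyperbolicity_cone p e"
  shows "(\<Sum>i\<in>A. f i) \<in> hyperbolicity_cone p e"
  using assms(2)
proof (induction A rule: infinite_finite_induct)
  case (insert x A)
  then show ?case using hyperbolicity_cone_add[OF assms(1)] by simp
qed (use hyperbolicity_cone_scale[OF assms(1), of e 0] pos_cone_self[OF assms(1)]
    pos_cone_subset_hyperbolicity_cone[OF assms(1)] in auto)

text \<open>No eigenvalue is followed to the limit: \<open>x + s e\<close> is a member
  \<open>X n\<close> of the cone plus \<open>s w\<close> with \<open>w\<close> close to
  \<open>e\<close>, and the open cone contains a ball around \<open>e\<close>.\<close>

lemma closed_hyperbolicity_cone:
  assumes hyp: "hyperbolic d p e"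
  shows "closed (hyperbolicity_cone p e)"
proof -
  have hom: "homogeneous d p" using hyp by (simp add: hyperbolic_def)
  have "mpol_eval p (($) e) \<noteq> 0" using hyp by (simp add: hyperbolic_def)
  then obtain \<delta> where \<delta>: "0 < \<delta>" "\<And>w. dist w e < \<delta> \<Longrightarrow> mpol_eval p (($) w) \<noteq> 0"
    using continuous_on_open_avoid[of UNIV "\<lambda>w. mpol_eval p (($) w)" e 0]
    by (force intro: continuous_on_mpol_eval_vec simp: dist_commute)
  \<comment> \<open>Rescaling \<open>w + s e\<close> by \<open>1 / (1 + s)\<close> brings it no
    farther from \<open>e\<close> than \<open>w\<close>, so nonvanishing on the ball settles all
    \<open>s\<close> at once.\<close>
  have ball: "w \<in> pos_cone p e" if w: "dist w e < \<delta>" for w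
    unfolding pos_cone_def
  proof safe
    fix s :: real assume s: "0 \<le> s" "mpol_eval p (($) (w + s *\<^sub>R e)) = 0"
    let ?u = "(1 / (1 + s)) *\<^sub>R (w + s *\<^sub>R e)"
    have "w + s *\<^sub>R e = (1 + s) *\<^sub>R ?u" using s by simp
    then have "mpol_eval p (($) ?u) = 0" using s mpol_eval_scaleR[OF hom, of "1 + s" ?u] by auto
    moreover have "?u - e = (1 / (1 + s)) *\<^sub>R (w + s *\<^sub>R e - (1 + s) *\<^sub>R e)"
      using s by (simp add: scaleR_diff_right)
    then have "?u - e = (1 / (1 + s)) *\<^sub>R (w - e)" by (simp add: algebra_simps)
    then have "dist ?u e = dist w e / (1 + s)" using s by (simp add: dist_norm)
    then have "dist ?u e \<le> dist w e" using s by (simp add: divide_le_eq mult_left_mono algebra_simps)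
    ultimately show False using \<delta>(2)[of ?u] w by simp
  qed
  show ?thesis
    unfolding closed_sequential_limits
  proof safe
    fix X x assume X: "\<forall>n::nat. X n \<in> hyperbolicity_cone p e" "X \<longlonglongrightarrow> x"
    show "x \<in> hyperbolicity_cone p e"
      unfolding mem_hyperbolicity_cone[OF hyp]
    proof safe
      fix s :: real assume s: "0 < s"
      then obtain n where n: "dist (X n) x < s * \<delta>"
        using X(2) \<delta>(1) unfolding lim_sequentially by (metis mult_pos_pos order_refl)
      let ?w = "e + (1 / s) *\<^sub>R (x - X n)"
      have "dist ?w e = dist (X n) x / s" using s by (simp add: dist_norm norm_minus_commute)
      also have "\<dots> < \<delta>" using n s by (simp add: divide_less_eq mult.commute)
      finally have "s *\<^sub>R ?w \<in> pos_cone p e" using pos_cone_scale[OF hyp ball s] by simp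
      then have "X n + s *\<^sub>R ?w \<in> pos_cone p e" using hyperbolicity_cone_add_pos[OF hyp] X(1) by blast
      then show "x + s *\<^sub>R e \<in> pos_cone p e" using s by (simp add: scaleR_right_distrib algebra_simps)
    qed
  qed
qed

section \<open>Partial fractions with nonnegative weights\<close>

lemma Im_of_real_mult: "Im (of_real x * z) = x * Im z"
  by simp

text \<open>Approach \<rho> along the ray in the direction \<zeta>: the factor
  \<open>cnj (z - \<rho>) ^ k\<close> becomes \<open>h ^ k * cnj \<zeta> ^ k\<close>, and the
  positive \<open>h ^ k\<close> can be divided out before the limit. Order 1 yields the sign of a
  residue; for higher order the freedom in \<zeta> yields contradictory signs.\<close>

lemma tendsto_boundary_sign:
  fixes f g :: "complex \<Rightarrow> complex" and \<rho> :: real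
  assumes "isCont f (of_real \<rho>)" "isCont g (of_real \<rho>)"
    and im: "\<And>z. 0 < Im z \<Longrightarrow> Im (f z * cnj ((z - of_real \<rho>) ^ k * g z)) \<le> 0"
    and "0 < Im \<zeta>"
  shows "Im (f (of_real \<rho>) * cnj (g (of_real \<rho>)) * cnj \<zeta> ^ k) \<le> 0"
proof -
  define z where "z h = of_real \<rho> + of_real h * \<zeta>" for h
  have "(z \<longlongrightarrow> of_real \<rho> + of_real 0 * \<zeta>) (at_right 0)"
    unfolding z_def by (intro tendsto_intros)
  then have z: "(z \<longlongrightarrow> of_real \<rho>) (at_right 0)" by simp
  have fz: "((\<lambda>h. f (z h)) \<longlongrightarrow> f (of_real \<rho>)) (at_right 0)"
    by (rule isCont_tendsto_compose[OF assms(1) z])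
  have gz: "((\<lambda>h. g (z h)) \<longlongrightarrow> g (of_real \<rho>)) (at_right 0)"
    by (rule isCont_tendsto_compose[OF assms(2) z])
  have "((\<lambda>h. Im (f (z h) * cnj (g (z h)) * cnj \<zeta> ^ k))
      \<longlongrightarrow> Im (f (of_real \<rho>) * cnj (g (of_real \<rho>)) * cnj \<zeta> ^ k)) (at_right 0)"
    by (intro tendsto_Im tendsto_mult tendsto_cnj fz gz tendsto_const)
  moreover have "\<forall>\<^sub>F h in at_right 0. Im (f (z h) * cnj (g (z h)) * cnj \<zeta> ^ k) \<le> 0"
    using eventually_at_right_less[of 0]
  proof eventually_elim
    case (elim h)
    have "f (z h) * cnj ((z h - of_real \<rho>) ^ k * g (z h))
        = of_real (h ^ k) * (f (z h) * cnj (g (z h)) * cnj \<zeta> ^ k)"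
      by (simp add: z_def power_mult_distrib)
    moreover have "0 < Im (z h)" using elim \<open>0 < Im \<zeta>\<close> by (simp add: z_def)
    ultimately have "h ^ k * Im (f (z h) * cnj (g (z h)) * cnj \<zeta> ^ k) \<le> 0"
      using im[of "z h"] by (simp only: Im_of_real_mult)
    moreover have "0 < h ^ k" using elim by simp
    ultimately show ?case by (simp only: mult_le_0_iff) linarith
  qed
  ultimately show ?thesis by (rule tendsto_upperbound) simp
qed

lemma isCont_prod_diff: "isCont (\<lambda>z::complex. \<Prod>j\<in>A. z - of_real (\<rho> j)) a"
  by (intro continuous_intros)

lemma poly_map_poly_of_real:
  "poly (map_poly of_real q) (complex_of_real x) = of_real (poly q x)"
  by (induction q) (simp_all add: map_poly_pCons)

text \<open>Cleared of denominators, so that the \<rho> may repeat. For distinct \<rho> this is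
  Lagrange interpolation, with the residues as weights. A quotient that maps the upper half-plane to
  the closed lower one has no pole of order 2 or more, so at a repeated root the numerator vanishes
  and one factor cancels.\<close>

lemma partial_fractions_nonneg:
  fixes \<rho> :: "'i \<Rightarrow> real" and r :: "real poly"
  assumes "finite A" "\<And>k. card A \<le> k \<Longrightarrow> coeff r k = 0"
    and "\<And>z. 0 < Im z \<Longrightarrow>
      Im (poly (map_poly of_real r) z * cnj (\<Prod>k\<in>A. z - of_real (\<rho> k))) \<le> 0"
  shows "\<exists>w. (\<forall>k\<in>A. 0 \<le> w k) \<and> (\<forall>x. poly r x = (\<Sum>k\<in>A. w k * (\<Prod>j\<in>A - {k}. x - \<rho> j)))"
  using assms
proof (induction "card A" arbitrary: A r)
  case 0
  then have "A = {}" "r = 0" by (auto intro: poly_eqI)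
  then show ?case by auto
next
  case (Suc n)
  note im = Suc.prems(3)
  let ?R = "poly (map_poly of_real r) :: complex \<Rightarrow> complex"
  show ?case
  proof (cases "inj_on \<rho> A")
    case True
    \<comment> \<open>The residue at \<open>\<rho> k\<close>. Its sign comes from the boundary limit
      along the vertical ray, of direction \<i>.\<close>
    define w where "w k = poly r (\<rho> k) / (\<Prod>j\<in>A - {k}. \<rho> k - \<rho> j)" for k
    have nz: "(\<Prod>j\<in>A - {k}. \<rho> k - \<rho> j) \<noteq> 0" if "k \<in> A" for k
      using True that Suc.prems(1) by (auto simp: inj_on_def)
    have "0 \<le> w k" if k: "k \<in> A" for k
    proof -
      let ?g = "\<lambda>z::complex. \<Prod>j\<in>A - {k}. z - of_real (\<rho> j)"
      have "Im (?R z * cnj ((z - of_real (\<rho> k)) ^ 1 * ?g z)) \<le> 0" if "0 < Im z" for z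
        using im[OF that] prod.remove[OF Suc.prems(1) k, of "\<lambda>j. z - of_real (\<rho> j)"] by simp
      then have "Im (?R (of_real (\<rho> k)) * cnj (?g (of_real (\<rho> k))) * cnj \<i> ^ 1) \<le> 0"
        by (intro tendsto_boundary_sign isCont_prod_diff) auto
      moreover have "?R (of_real (\<rho> k)) * cnj (?g (of_real (\<rho> k)))
          = of_real (poly r (\<rho> k) * (\<Prod>j\<in>A - {k}. \<rho> k - \<rho> j))"
        by (simp add: poly_map_poly_of_real)
      ultimately have "0 \<le> poly r (\<rho> k) * (\<Prod>j\<in>A - {k}. \<rho> k - \<rho> j)"
        by (simp only: Im_of_real_mult) simp
      then show ?thesis by (simp add: w_def zero_le_divide_iff zero_le_mult_iff)
    qed
    moreover have "r = (\<Sum>k\<in>A. smult (w k) (\<Prod>j\<in>A - {k}. [:- \<rho> j, 1:]))" (is "r = ?s")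
    proof (rule poly_eqI_degree[where A = "\<rho> ` A"])
      have card: "card (\<rho> ` A) = Suc n" using True Suc.hyps(2) by (simp add: card_image)
      show "degree r < card (\<rho> ` A)"
        unfolding card using Suc.prems(2) Suc.hyps(2) by (intro degree_lessI) auto
      have "degree (\<Prod>j\<in>A - {k}. [:- \<rho> j, 1:]) \<le> n" if "k \<in> A" for k
        using that Suc.hyps(2) Suc.prems(1)
          degree_prod_sum_le[of "A - {k}" "\<lambda>j. [:- \<rho> j, 1:]"] by (simp add: o_def)
      then have "degree ?s \<le> n"
        by (intro degree_sum_le Suc.prems(1) order.trans[OF degree_smult_le])
      then show "degree ?s < card (\<rho> ` A)" unfolding card by simp
      fix x assume "x \<in> \<rho> ` A"
      then obtain k where k: "k \<in> A" "x = \<rho> k" by blast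
      have "poly ?s x = (\<Sum>l\<in>A. w l * (\<Prod>j\<in>A - {l}. x - \<rho> j))"
        by (simp add: poly_sum poly_prod)
      also have "\<dots> = (\<Sum>l\<in>{k}. w l * (\<Prod>j\<in>A - {l}. x - \<rho> j))"
        using k Suc.prems(1) by (intro sum.mono_neutral_right) auto
      also have "\<dots> = poly r x" using nz[OF k(1)] k by (simp add: w_def)
      finally show "poly r x = poly ?s x" by simp
    qed
    then have "poly r x = (\<Sum>k\<in>A. w k * (\<Prod>j\<in>A - {k}. x - \<rho> j))" for x
      using arg_cong[of r _ "\<lambda>q. poly q x"] by (simp add: poly_sum poly_prod)
    ultimately show ?thesis by blast
  next
    case False
    then obtain a b where ab: "a \<in> A" "b \<in> A" "a \<noteq> b" "\<rho> a = \<rho> b" by (auto simp: inj_on_def)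
    define k where "k = card {j\<in>A. \<rho> j = \<rho> a}"
    let ?g = "\<lambda>z::complex. \<Prod>j\<in>{j\<in>A. \<rho> j \<noteq> \<rho> a}. z - of_real (\<rho> j)"
    define c where "c = poly r (\<rho> a) * (\<Prod>j\<in>{j\<in>A. \<rho> j \<noteq> \<rho> a}. \<rho> a - \<rho> j)"
    have "card {a, b} \<le> k"
      unfolding k_def using ab Suc.prems(1) by (intro card_mono) auto
    then have k2: "2 \<le> k" using ab(3) by simp
    have split: "(\<Prod>j\<in>A. z - of_real (\<rho> j)) = (z - of_real (\<rho> a)) ^ k * ?g z" for z :: complex
    proof -
      have "(\<Prod>j\<in>A. z - of_real (\<rho> j)) =
          (\<Prod>j\<in>{j\<in>A. \<rho> j = \<rho> a}. z - of_real (\<rho> j)) * ?g z"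
        using Suc.prems(1) by (subst prod.union_disjoint[symmetric]) (auto intro!: prod.cong)
      then show ?thesis by (simp add: k_def)
    qed
    have sgn: "Im (of_real c * cnj \<zeta> ^ k) \<le> 0" if "0 < Im \<zeta>" for \<zeta>
    proof -
      have "Im (?R (of_real (\<rho> a)) * cnj (?g (of_real (\<rho> a))) * cnj \<zeta> ^ k) \<le> 0"
        using im that by (intro tendsto_boundary_sign isCont_prod_diff) (auto simp: split)
      moreover have "?R (of_real (\<rho> a)) * cnj (?g (of_real (\<rho> a))) = of_real c"
        by (simp add: poly_map_poly_of_real c_def)
      ultimately show ?thesis by (simp only:)
    qed
    have cis: "cnj (cis (x / k)) ^ k = cis (- x)" for x
      using k2 by (simp only: cis_cnj Complex.DeMoivre) simp
    \<comment> \<open>Both angles lie below \<open>pi\<close> because \<open>k \<ge> 2\<close>.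
      Their directions give \<open>cnj \<zeta> ^ k\<close> the opposite values -\<i> and \<i>, which
      forces \<open>c = 0\<close>.\<close>
    have "0 < pi / 2 / k" "pi / 2 / k < pi" "0 < 3 * pi / 2 / k" "3 * pi / 2 / k < pi"
      using k2 pi_gt_zero by (auto simp: divide_less_eq intro: less_le_trans[of _ "pi * 2"])
    then have "0 < Im (cis (pi / 2 / k))" "0 < Im (cis (3 * pi / 2 / k))"
      by (simp_all add: sin_gt_zero)
    from this[THEN sgn] have "Im (of_real c * cis (- (pi / 2))) \<le> 0" "Im (of_real c * cis (- (3 * pi / 2))) \<le> 0"
      unfolding cis by auto
    moreover have "sin (3 * pi / 2) = - 1" using sin_3over2_pi by (simp add: mult.commute)
    ultimately have "c = 0" by simp
    then have "poly r (\<rho> a) = 0"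
      using Suc.prems(1) by (auto simp: c_def)
    then obtain s where s: "r = [:- \<rho> a, 1:] * s" by (auto simp: poly_eq_0_iff_dvd elim: dvdE)
    \<comment> \<open>Only one copy of the repeated root is removed. The sign condition then changes
      by the positive factor \<open>(cmod (z - \<rho> a))\<^sup>2\<close>, and the removed index
      receives weight 0.\<close>
    define B where "B = A - {a}"
    have B: "finite B" "card B = n" using Suc.hyps(2) Suc.prems(1) ab by (auto simp: B_def)
    have "coeff s j = 0" if "card B \<le> j" for j
    proof (cases "s = 0")
      case False
      then have "degree r = Suc (degree s)" unfolding s by (subst degree_mult_eq) auto
      moreover have "degree r < Suc n"
        using Suc.prems(2) Suc.hyps(2) by (intro degree_lessI) auto
      ultimately show ?thesis using that B by (intro coeff_eq_0) simp
    qed simp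
    moreover have "Im (poly (map_poly of_real s) z * cnj (\<Prod>k\<in>B. z - of_real (\<rho> k))) \<le> 0"
      if z: "0 < Im z" for z
    proof -
      have "?R z * cnj (\<Prod>k\<in>A. z - of_real (\<rho> k)) = ((z - of_real (\<rho> a)) * cnj (z - of_real (\<rho> a))) *
         (poly (map_poly of_real s) z * cnj (\<Prod>k\<in>B. z - of_real (\<rho> k)))"
        unfolding prod.remove[OF Suc.prems(1) ab(1)] B_def
        by (simp add: s poly_of_real_mult map_poly_pCons del: mult_pCons_left)
      also have "\<dots> = of_real ((cmod (z - of_real (\<rho> a)))\<^sup>2) *
         (poly (map_poly of_real s) z * cnj (\<Prod>k\<in>B. z - of_real (\<rho> k)))"
        by (simp only: complex_norm_square)
      finally have "(cmod (z - of_real (\<rho> a)))\<^sup>2 * Im (poly (map_poly of_real s) z * cnj (\<Prod>k\<in>B. z - of_real (\<rho> k))) \<le> 0"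
        using im[OF z] by (simp only: Im_of_real_mult)
      moreover have "z \<noteq> of_real (\<rho> a)" using z by auto
      ultimately show ?thesis by (simp add: mult_le_0_iff)
    qed
    ultimately obtain w where w: "\<And>k. k \<in> B \<Longrightarrow> 0 \<le> w k"
      "\<And>x. poly s x = (\<Sum>k\<in>B. w k * (\<Prod>j\<in>B - {k}. x - \<rho> j))"
      using Suc.hyps(1)[of B s] B by blast
    have "poly r x = (\<Sum>k\<in>A. (w(a := 0)) k * (\<Prod>j\<in>A - {k}. x - \<rho> j))" for x
    proof -
      have "poly r x = (\<Sum>k\<in>B. w k * ((x - \<rho> a) * (\<Prod>j\<in>B - {k}. x - \<rho> j)))"
        by (simp only: s poly_mult w(2) sum_distrib_left) (simp add: mult_ac)
      also have "\<dots> = (\<Sum>k\<in>B. (w(a := 0)) k * (\<Prod>j\<in>A - {k}. x - \<rho> j))"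
      proof (rule sum.cong)
        fix k assume "k \<in> B"
        then have "A - {k} = insert a (B - {k})" "k \<noteq> a" using ab by (auto simp: B_def)
        then show "w k * ((x - \<rho> a) * (\<Prod>j\<in>B - {k}. x - \<rho> j)) = (w(a := 0)) k * (\<Prod>j\<in>A - {k}. x - \<rho> j)"
          using B by (simp add: B_def)
      qed simp
      also have "\<dots> = (\<Sum>k\<in>A. (w(a := 0)) k * (\<Prod>j\<in>A - {k}. x - \<rho> j))"
        unfolding B_def using Suc.prems(1) ab by (subst sum.remove[of A a]) auto
      finally show ?thesis .
    qed
    then show ?thesis using w(1) by (intro exI[of _ "w(a := 0)"]) (auto simp: B_def)
  qed
qed

section \<open>Logarithmic derivatives\<close>

text \<open>For the determinant this is the trace of \<open>v\<close> inverse times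
  \<open>u\<close>; with \<open>u = z\<close> it is the barrier potential.\<close>

definition log_deriv :: "'n::finite mpol \<Rightarrow> real^'n \<Rightarrow> real^'n \<Rightarrow> real" where
  "log_deriv p u v = mpol_eval (dir_deriv u p) (($) v) / mpol_eval p (($) v)"

text \<open>Minus the derivative of \<open>log_deriv p z\<close> in the direction \<open>x\<close>.\<close>

definition log_deriv2 :: "'n::finite mpol \<Rightarrow> real^'n \<Rightarrow> real^'n \<Rightarrow> real^'n \<Rightarrow> real" where
  "log_deriv2 p z x v = log_deriv p x v * log_deriv p z v
     - mpol_eval (dir_deriv x (dir_deriv z p)) (($) v) / mpol_eval p (($) v)"

lemma log_deriv_sum:
  "log_deriv p (\<Sum>k\<in>A. c k *\<^sub>R u k) v = (\<Sum>k\<in>A. c k * log_deriv p (u k) v)"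
  by (simp add: log_deriv_def mpol_eval_dir_deriv_sum sum_divide_distrib)

lemma log_deriv2_sum:
  "log_deriv2 p z (\<Sum>k\<in>A. c k *\<^sub>R u k) v = (\<Sum>k\<in>A. c k * log_deriv2 p z (u k) v)"
  by (simp add: log_deriv2_def log_deriv_sum mpol_eval_dir_deriv_sum sum_divide_distrib
      sum_distrib_left right_diff_distrib sum_subtractf mult_ac)

lemma mpol_eval_line_has_derivative:
  "((\<lambda>t. mpol_eval p (($) (v + t *\<^sub>R u))) has_field_derivative
     mpol_eval (dir_deriv u p) (($) (v + s *\<^sub>R u))) (at s)"
proof -
  have "($) (v + t *\<^sub>R u) = (\<lambda>i. v $ i + t * of_real (u $ i))" for t
    by (simp add: fun_eq_iff)
  then show ?thesis using mpol_eval_has_field_derivative[of p "($) v" u s] by simp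
qed

lemma log_deriv_has_derivative:
  assumes "mpol_eval p (($) (v + s *\<^sub>R x)) \<noteq> 0"
  shows "((\<lambda>t. log_deriv p z (v + t *\<^sub>R x)) has_field_derivative - log_deriv2 p z x (v + s *\<^sub>R x)) (at s)"
proof -
  have "((\<lambda>t. log_deriv p z (v + t *\<^sub>R x)) has_field_derivative
      (mpol_eval (dir_deriv x (dir_deriv z p)) (($) (v + s *\<^sub>R x)) * mpol_eval p (($) (v + s *\<^sub>R x))
        - mpol_eval (dir_deriv z p) (($) (v + s *\<^sub>R x)) * mpol_eval (dir_deriv x p) (($) (v + s *\<^sub>R x)))
      / (mpol_eval p (($) (v + s *\<^sub>R x)) * mpol_eval p (($) (v + s *\<^sub>R x)))) (at s)"
    unfolding log_deriv_def
    by (intro DERIV_divide mpol_eval_line_has_derivative assms)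
  then show ?thesis
    by (rule DERIV_cong) (use assms in \<open>simp add: log_deriv2_def log_deriv_def field_simps\<close>)
qed

lemma log_deriv_of_factorization:
  fixes d :: nat
  assumes fac: "\<And>t. mpol_eval p (($) (v + t *\<^sub>R x)) = c * (\<Prod>k<d. 1 + t * \<mu> k)"
    and "c \<noteq> 0" and pos: "\<And>k. k < d \<Longrightarrow> 1 + s * \<mu> k \<noteq> 0"
  shows "log_deriv p x (v + s *\<^sub>R x) = (\<Sum>k<d. \<mu> k / (1 + s * \<mu> k))"
proof -
  have "((\<lambda>t. c * (\<Prod>k<d. 1 + t * \<mu> k)) has_field_derivative
      c * (\<Sum>k<d. \<mu> k * (\<Prod>j\<in>{..<d} - {k}. 1 + s * \<mu> j))) (at s)"
    by (intro DERIV_cmult has_field_derivative_prod) (auto intro!: derivative_eq_intros)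
  moreover have "((\<lambda>t. c * (\<Prod>k<d. 1 + t * \<mu> k)) has_field_derivative
      mpol_eval (dir_deriv x p) (($) (v + s *\<^sub>R x))) (at s)"
    using mpol_eval_line_has_derivative[of p v x s] by (simp only: fac)
  ultimately have "mpol_eval (dir_deriv x p) (($) (v + s *\<^sub>R x)) =
      c * (\<Sum>k<d. \<mu> k * (\<Prod>j\<in>{..<d} - {k}. 1 + s * \<mu> j))"
    by (rule DERIV_unique[rotated])
  also have "\<dots> = c * (\<Sum>k<d. \<mu> k / (1 + s * \<mu> k) * (\<Prod>j<d. 1 + s * \<mu> j))"
  proof (intro arg_cong[of _ _ "(*) c"] sum.cong refl)
    fix k assume k: "k \<in> {..<d}"
    then have "(\<Prod>j<d. 1 + s * \<mu> j) = (1 + s * \<mu> k) * (\<Prod>j\<in>{..<d} - {k}. 1 + s * \<mu> j)"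
      by (intro prod.remove) auto
    then show "\<mu> k * (\<Prod>j\<in>{..<d} - {k}. 1 + s * \<mu> j) = \<mu> k / (1 + s * \<mu> k) * (\<Prod>j<d. 1 + s * \<mu> j)"
      using pos[of k] k by simp
  qed
  also have "\<dots> = (\<Sum>k<d. \<mu> k / (1 + s * \<mu> k)) * mpol_eval p (($) (v + s *\<^sub>R x))"
    by (simp add: fac sum_distrib_left sum_distrib_right mult_ac)
  finally show ?thesis
    using assms by (simp add: log_deriv_def fac)
qed

text \<open>Fills the gap at \<open>t = 0\<close> left by identities that are obtained by
  substituting \<open>1 / t\<close>.\<close>

lemma continuous_on_eq_at_zero:
  fixes f g :: "real \<Rightarrow> real"
  assumes "continuous_on UNIV f" "continuous_on UNIV g" "\<And>t. t \<noteq> 0 \<Longrightarrow> f t = g t"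
  shows "f 0 = g 0"
proof -
  have "f \<midarrow>0\<rightarrow> f 0" "g \<midarrow>0\<rightarrow> g 0"
    using assms(1,2) by (simp_all add: continuous_on_eq_continuous_at isCont_def)
  moreover have "f \<midarrow>0\<rightarrow> g 0 \<longleftrightarrow> g \<midarrow>0\<rightarrow> g 0"
    using assms(3) by (intro LIM_equal) auto
  ultimately show ?thesis using LIM_unique by blast
qed

lemma poly_map_affine_poly:
  "poly (map_poly of_real (affine_poly p v a)) (z :: complex)
     = mpol_eval p (\<lambda>i. of_real (v i) + z * of_real (a i))"
proof -
  have smult: "poly (map_poly of_real (smult c q)) z = of_real c * poly (map_poly of_real q) z"
    for c :: real and q
    using poly_of_real_mult[of "[:c:]" q z] by (simp add: map_poly_pCons)
  show ?thesis
    by (simp add: affine_poly_def mpol_eval_def poly_of_real_sum smult poly_of_real_prod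
        poly_of_real_power map_poly_pCons)
qed

lemma poly_affine_poly_vec: "poly (affine_poly p (($) v) (($) a)) t = mpol_eval p (($) (v + t *\<^sub>R a))"
proof -
  have "($) (v + t *\<^sub>R a) = (\<lambda>i. v $ i + t * a $ i)" by (simp add: fun_eq_iff)
  then show ?thesis by (simp add: poly_affine_poly)
qed

text \<open>For fixed \<open>\<xi>\<close> with imaginary part in the cone, all roots of \<open>s \<mapsto> p(\<xi> + s z)\<close> lie in the
  lower half-plane, so its logarithmic derivative at \<open>0\<close> has negative imaginary part.\<close>

lemma Im_log_deriv_nonpos:
  assumes hyp: "hyperbolic d p e" and M: "M \<in> pos_cone p e" and z: "z \<in> pos_cone p e"
    and \<tau>: "0 < Im \<tau>"
  shows "Im (mpol_eval (dir_deriv z p) (\<lambda>i. of_real (x $ i) + \<tau> * of_real (M $ i))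
    * cnj (mpol_eval p (\<lambda>i. of_real (x $ i) + \<tau> * of_real (M $ i)))) \<le> 0"
proof -
  have hom: "homogeneous d p" using hyp by (simp add: hyperbolic_def)
  define \<xi> where "\<xi> i = of_real (x $ i) + \<tau> * of_real (M $ i)" for i
  let ?c = "mpol_eval p (($) z)"
  let ?f = "affine_poly p \<xi> (\<lambda>i. complex_of_real (z $ i))"
  have c: "coeff ?f d = of_real ?c" unfolding affine_poly_top(2)[OF hom] mpol_eval_of_real ..
  have "?c \<noteq> 0" using pos_cone_nonzero[OF z] .
  then obtain \<sigma> where \<sigma>: "\<And>s. poly ?f s = of_real ?c * (\<Prod>k<d. s - \<sigma> k)"
    using complex_poly_factorization[of ?f d] affine_poly_top(1)[OF hom, of \<xi>] c by auto
  have nz: "poly ?f s \<noteq> 0" if s: "0 \<le> Im s" for s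
  proof -
    \<comment> \<open>This vector is the imaginary part of \<open>\<xi> + s z\<close>, so
      nonvanishing there is hyperbolicity in its direction, at the parameter \<i>.\<close>
    have "Im \<tau> *\<^sub>R M + Im s *\<^sub>R z \<in> pos_cone p e"
    proof (cases "Im s = 0")
      case True
      then show ?thesis using pos_cone_scale[OF hyp M \<tau>] by simp
    next
      case False
      then show ?thesis
        using pos_cone_add[OF hyp pos_cone_scale[OF hyp M \<tau>] pos_cone_scale[OF hyp z, of "Im s"]] s by simp
    qed
    from hyperbolic_nonreal[OF hyperbolic_pos_cone[OF hyp this], of \<i> "x + Re \<tau> *\<^sub>R M + Re s *\<^sub>R z"]
    have nz: "mpol_eval p (\<lambda>i. of_real ((x + Re \<tau> *\<^sub>R M + Re s *\<^sub>R z) $ i)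
      + \<i> * of_real ((Im \<tau> *\<^sub>R M + Im s *\<^sub>R z) $ i)) \<noteq> 0" by (simp add: complex_is_Real_iff)
    have eq: "of_real ((x + Re \<tau> *\<^sub>R M + Re s *\<^sub>R z) $ i) + \<i> * of_real ((Im \<tau> *\<^sub>R M + Im s *\<^sub>R z) $ i)
        = \<xi> i + s * of_real (z $ i)" for i
      by (simp add: \<xi>_def complex_eq_iff algebra_simps)
    show ?thesis using nz unfolding eq poly_affine_poly .
  qed
  have \<sigma>_neg: "Im (\<sigma> k) < 0" if "k < d" for k
    using nz[of "\<sigma> k"] that by (force simp: \<sigma>)
  define Q where "Q k = (\<Prod>j\<in>{..<d} - {k}. - \<sigma> j)" for k
  have "(poly ?f has_field_derivative of_real ?c * (\<Sum>k<d. 1 * (\<Prod>j\<in>{..<d} - {k}. 0 - \<sigma> j))) (at 0)"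
    unfolding \<sigma> by (intro DERIV_cmult has_field_derivative_prod) (auto intro!: derivative_eq_intros)
  moreover have "(poly ?f has_field_derivative mpol_eval (dir_deriv z p) \<xi>) (at 0)"
    using mpol_eval_has_field_derivative[of p \<xi> z 0] by (simp add: poly_affine_poly[abs_def])
  ultimately have "mpol_eval (dir_deriv z p) \<xi> = of_real ?c * (\<Sum>k<d. Q k)"
    using DERIV_unique by (fastforce simp: Q_def)
  moreover have "mpol_eval p \<xi> = of_real ?c * (\<Prod>k<d. - \<sigma> k)"
    using \<sigma>[of 0] by (simp add: poly_affine_poly)
  ultimately have "mpol_eval (dir_deriv z p) \<xi> * cnj (mpol_eval p \<xi>)
      = of_real (?c\<^sup>2) * (\<Sum>k<d. Q k * cnj (\<Prod>k<d. - \<sigma> k))"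
    by (simp add: sum_distrib_left sum_distrib_right power2_eq_square mult_ac)
  \<comment> \<open>The logarithmic derivative is a sum of reciprocals of the
    \<open>- \<sigma> k\<close>. Multiplied by the squared modulus of the product, each term is a
    nonnegative number times \<open>cnj (- \<sigma> k)\<close>, whose imaginary part is that of
    \<open>\<sigma> k\<close>.\<close>
  also have "(\<Sum>k<d. Q k * cnj (\<Prod>k<d. - \<sigma> k)) = (\<Sum>k<d. of_real ((cmod (Q k))\<^sup>2) * cnj (- \<sigma> k))"
  proof (rule sum.cong)
    fix k assume "k \<in> {..<d}"
    then have "(\<Prod>k<d. - \<sigma> k) = - \<sigma> k * Q k" unfolding Q_def by (intro prod.remove) auto
    then show "Q k * cnj (\<Prod>k<d. - \<sigma> k) = of_real ((cmod (Q k))\<^sup>2) * cnj (- \<sigma> k)"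
      unfolding complex_norm_square by (simp add: mult_ac)
  qed simp
  finally have "Im (mpol_eval (dir_deriv z p) \<xi> * cnj (mpol_eval p \<xi>))
      = ?c\<^sup>2 * (\<Sum>k<d. (cmod (Q k))\<^sup>2 * Im (\<sigma> k))"
    by (simp only: Im_of_real_mult Im_sum) simp
  moreover have "(\<Sum>k<d. (cmod (Q k))\<^sup>2 * Im (\<sigma> k)) \<le> 0"
    using \<sigma>_neg by (intro sum_nonpos mult_nonneg_nonpos) (auto intro: less_imp_le)
  ultimately show ?thesis by (simp add: \<xi>_def[abs_def] mult_nonneg_nonpos)
qed

section \<open>Expansions along lines through the open cone\<close>

text \<open>The \<open>\<mu> k\<close> are the eigenvalues of \<open>x\<close> relative to
  \<open>M\<close>. They are real because \<open>M\<close> is a direction of hyperbolicity; a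
  positive root would be a zero of \<open>p\<close> in the open cone.\<close>

lemma hyperbolic_factorization:
  assumes hyp: "hyperbolic d p e" and M: "M \<in> pos_cone p e" and x: "x \<in> hyperbolicity_cone p e"
  obtains \<mu> where "\<And>k. k < d \<Longrightarrow> 0 \<le> \<mu> k"
    and "affine_poly p (($) x) (($) M) = smult (mpol_eval p (($) M)) (\<Prod>k<d. [:\<mu> k, 1:])"
proof -
  have hom: "homogeneous d p" using hyp by (simp add: hyperbolic_def)
  let ?q = "affine_poly p (($) x) (($) M)" and ?c = "mpol_eval p (($) M)"
  have c: "coeff ?q d = ?c" "?c \<noteq> 0" using affine_poly_top(2)[OF hom] pos_cone_nonzero[OF M] by auto
  have "z \<in> \<real>" if "poly (map_poly of_real ?q) z = 0" for z :: complex
    using hyperbolic_nonreal[OF hyperbolic_pos_cone[OF hyp M], of z x] that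
    by (auto simp: poly_map_affine_poly)
  then obtain \<rho> where \<rho>: "\<And>t. poly ?q t = ?c * (\<Prod>k<d. t - \<rho> k)"
    using real_rooted_factorization[of ?q d] affine_poly_top(1)[OF hom] c by metis
  have "\<rho> k \<le> 0" if k: "k < d" for k
  proof (rule ccontr)
    assume "\<not> ?thesis"
    then have "x + \<rho> k *\<^sub>R M \<in> pos_cone p e"
      using hyperbolicity_cone_add_pos[OF hyp x pos_cone_scale[OF hyp M]] by simp
    moreover have "poly ?q (\<rho> k) = 0" using k by (auto simp: \<rho>)
    ultimately show False using pos_cone_nonzero by (auto simp: poly_affine_poly_vec)
  qed
  moreover have "?q = smult ?c (\<Prod>k<d. [:- \<rho> k, 1:])"
    by (simp add: poly_eq_poly_eq_iff[symmetric] fun_eq_iff \<rho> poly_prod)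
  ultimately show ?thesis by (intro that[of "\<lambda>k. - \<rho> k"]) auto
qed

text \<open>The expansion is first made for \<open>x + \<tau> M\<close>, whose top coefficient
  \<open>p(M)\<close> is nonzero, whereas \<open>p(x)\<close> may vanish and the degree along
  \<open>M + t x\<close> may drop. Homogeneity with \<open>\<tau> = 1 / t\<close> carries it over to
  \<open>M + t x\<close>. Positivity of \<open>d\<close> puts the degree of the numerator below
  \<open>d\<close>.\<close>

lemma log_deriv_partial_fractions:
  assumes hyp: "hyperbolic d p e" and d: "0 < d"
    and M: "M \<in> pos_cone p e" and z: "z \<in> pos_cone p e" and x: "x \<in> hyperbolicity_cone p e"
  obtains \<mu> w where "\<forall>k<d. 0 \<le> \<mu> k" "\<forall>k<d. 0 \<le> w k"
    "log_deriv p x M = (\<Sum>k<d. \<mu> k)" "log_deriv2 p z x M = (\<Sum>k<d. w k * \<mu> k)"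
    "\<forall>t. mpol_eval p (($) (M + t *\<^sub>R x)) = mpol_eval p (($) M) * (\<Prod>k<d. 1 + t * \<mu> k)"
    "\<forall>t. (\<forall>k<d. 0 < 1 + t * \<mu> k) \<longrightarrow>
       M + t *\<^sub>R x \<in> pos_cone p e \<and> log_deriv p z (M + t *\<^sub>R x) = (\<Sum>k<d. w k / (1 + t * \<mu> k))"
proof -
  have hom: "homogeneous d p" using hyp by (simp add: hyperbolic_def)
  let ?c = "mpol_eval p (($) M)"
  have c: "0 < ?c" using pos_cone_pos[OF hyp M] .
  obtain \<mu> where \<mu>: "\<And>k. k < d \<Longrightarrow> 0 \<le> \<mu> k"
    and fac: "affine_poly p (($) x) (($) M) = smult ?c (\<Prod>k<d. [:\<mu> k, 1:])"
    using hyperbolic_factorization[OF hyp M x] by blast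
  let ?r = "affine_poly (dir_deriv z p) (($) x) (($) M)"
  have "coeff ?r k = 0" if "card {..<d} \<le> k" for k
    using that d affine_poly_top(1)[OF homogeneous_dir_deriv[OF hom, of z], of "($) x" "($) M"]
    by (intro coeff_eq_0) simp
  moreover have "Im (poly (map_poly of_real ?r) \<tau> * cnj (\<Prod>k<d. \<tau> - of_real (- \<mu> k))) \<le> 0"
    if \<tau>: "0 < Im \<tau>" for \<tau>
  proof -
    have "mpol_eval p (\<lambda>i. of_real (x $ i) + \<tau> * of_real (M $ i))
        = of_real ?c * (\<Prod>k<d. \<tau> - of_real (- \<mu> k))"
      unfolding poly_map_affine_poly[symmetric] fac
      using poly_of_real_mult[of "[:?c:]" "\<Prod>k<d. [:\<mu> k, 1:]" \<tau>]
      by (simp add: map_poly_pCons poly_of_real_prod add.commute)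
    with Im_log_deriv_nonpos[OF hyp M z \<tau>, of x]
    have "Im (of_real ?c * (poly (map_poly of_real ?r) \<tau> * cnj (\<Prod>k<d. \<tau> - of_real (- \<mu> k)))) \<le> 0"
      by (simp add: poly_map_affine_poly mult_ac)
    then show ?thesis using c by (simp only: Im_of_real_mult mult_le_0_iff) linarith
  qed
  ultimately obtain w0 where w0: "\<And>k. k < d \<Longrightarrow> 0 \<le> w0 k"
    and pf: "\<And>t. poly ?r t = (\<Sum>k<d. w0 k * (\<Prod>j\<in>{..<d} - {k}. t - - \<mu> j))"
    using partial_fractions_nonneg[of "{..<d}" ?r "\<lambda>k. - \<mu> k"] by auto
  define w where "w k = w0 k / ?c" for k
  have fac_nz: "mpol_eval p (($) (M + t *\<^sub>R x)) = ?c * (\<Prod>k<d. 1 + t * \<mu> k)" if t: "t \<noteq> 0" for t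
  proof -
    have "M + t *\<^sub>R x = t *\<^sub>R (x + (1 / t) *\<^sub>R M)" using t by (simp add: scaleR_right_distrib add.commute)
    then have "mpol_eval p (($) (M + t *\<^sub>R x)) = t ^ d * (?c * (\<Prod>k<d. 1 / t + \<mu> k))"
      using mpol_eval_scaleR[OF hom, of t] poly_affine_poly_vec[of p x M "1 / t"]
      by (simp add: fac poly_prod add.commute)
    also have "t ^ d * (?c * (\<Prod>k<d. 1 / t + \<mu> k)) = ?c * (\<Prod>k<d. t * (1 / t + \<mu> k))"
      by (simp add: prod.distrib mult_ac)
    also have "(\<Prod>k<d. t * (1 / t + \<mu> k)) = (\<Prod>k<d. 1 + t * \<mu> k)"
      using t by (intro prod.cong) (auto simp: algebra_simps)
    finally show ?thesis .
  qed
  have fac_t: "mpol_eval p (($) (M + t *\<^sub>R x)) = ?c * (\<Prod>k<d. 1 + t * \<mu> k)" for t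
    using fac_nz[of t] by (cases "t = 0") auto
  have pf_nz: "mpol_eval (dir_deriv z p) (($) (M + t *\<^sub>R x))
      = ?c * (\<Sum>k<d. w k * (\<Prod>j\<in>{..<d} - {k}. 1 + t * \<mu> j))" if t: "t \<noteq> 0" for t
  proof -
    have "M + t *\<^sub>R x = t *\<^sub>R (x + (1 / t) *\<^sub>R M)" using t by (simp add: scaleR_right_distrib add.commute)
    then have "mpol_eval (dir_deriv z p) (($) (M + t *\<^sub>R x)) =
        t ^ (d - 1) * (\<Sum>k<d. w0 k * (\<Prod>j\<in>{..<d} - {k}. 1 / t + \<mu> j))"
      using mpol_eval_scaleR[OF homogeneous_dir_deriv[OF hom, of z], of t]
        poly_affine_poly_vec[of "dir_deriv z p" x M "1 / t"] pf[of "1 / t"]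
      by (simp add: add.commute)
    also have "\<dots> = (\<Sum>k<d. w0 k * (\<Prod>j\<in>{..<d} - {k}. 1 + t * \<mu> j))"
      unfolding sum_distrib_left
    proof (rule sum.cong)
      fix k assume k: "k \<in> {..<d}"
      have "(\<Prod>j\<in>{..<d} - {k}. 1 + t * \<mu> j) = (\<Prod>j\<in>{..<d} - {k}. t * (1 / t + \<mu> j))"
        using t by (intro prod.cong) (auto simp: algebra_simps)
      also have "\<dots> = t ^ (d - 1) * (\<Prod>j\<in>{..<d} - {k}. 1 / t + \<mu> j)"
        using k by (simp add: prod.distrib)
      finally show "t ^ (d - 1) * (w0 k * (\<Prod>j\<in>{..<d} - {k}. 1 / t + \<mu> j)) =
          w0 k * (\<Prod>j\<in>{..<d} - {k}. 1 + t * \<mu> j)" by simp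
    qed simp
    finally show ?thesis using c by (simp add: w_def sum_distrib_left)
  qed
  have pf_t: "mpol_eval (dir_deriv z p) (($) (M + t *\<^sub>R x))
      = ?c * (\<Sum>k<d. w k * (\<Prod>j\<in>{..<d} - {k}. 1 + t * \<mu> j))" for t
  proof (cases "t = 0")
    case True
    let ?f = "\<lambda>t. mpol_eval (dir_deriv z p) (($) (M + t *\<^sub>R x))"
    let ?g = "\<lambda>t. ?c * (\<Sum>k<d. w k * (\<Prod>j\<in>{..<d} - {k}. 1 + t * \<mu> j))"
    have "?f 0 = ?g 0"
      by (rule continuous_on_eq_at_zero[of ?f ?g]) (intro continuous_intros, intro continuous_intros, rule pf_nz)
    then show ?thesis using True by simp
  qed (use pf_nz in blast)
  have w: "0 \<le> w k" if "k < d" for k using w0[OF that] c by (simp add: w_def)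
  have ld: "log_deriv p z (M + t *\<^sub>R x) = (\<Sum>k<d. w k / (1 + t * \<mu> k))"
    if nz: "\<And>k. k < d \<Longrightarrow> 0 < 1 + t * \<mu> k" for t
  proof -
    have "w k * (\<Prod>j\<in>{..<d} - {k}. 1 + t * \<mu> j) = w k / (1 + t * \<mu> k) * (\<Prod>j<d. 1 + t * \<mu> j)"
      if k: "k < d" for k
    proof -
      have "(\<Prod>j<d. 1 + t * \<mu> j) = (1 + t * \<mu> k) * (\<Prod>j\<in>{..<d} - {k}. 1 + t * \<mu> j)"
        using k by (intro prod.remove) auto
      then show ?thesis using nz[OF k] by simp
    qed
    then have "mpol_eval (dir_deriv z p) (($) (M + t *\<^sub>R x))
        = ?c * (\<Sum>k<d. w k / (1 + t * \<mu> k) * (\<Prod>j<d. 1 + t * \<mu> j))"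
      unfolding pf_t by simp
    also have "\<dots> = (\<Sum>k<d. w k / (1 + t * \<mu> k)) * mpol_eval p (($) (M + t *\<^sub>R x))"
      by (simp add: fac_t sum_distrib_right sum_distrib_left mult_ac)
    moreover have "mpol_eval p (($) (M + t *\<^sub>R x)) \<noteq> 0"
      using c nz by (fastforce simp: fac_t)
    ultimately show ?thesis by (simp add: log_deriv_def)
  qed
  show ?thesis
  proof (rule that[of \<mu> w])
    show "log_deriv p x M = (\<Sum>k<d. \<mu> k)"
      using log_deriv_of_factorization[OF fac_t, of 0] c by simp
    show "log_deriv2 p z x M = (\<Sum>k<d. w k * \<mu> k)"
    proof -
      \<comment> \<open>For \<open>\<bar>t\<bar> < \<delta>\<close> every
        \<open>1 + t * \<mu> k\<close> is positive, so the expansion holds around 0 and can be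
        differentiated there.\<close>
      define \<delta> where "\<delta> = 1 / (1 + (\<Sum>k<d. \<mu> k))"
      have S: "0 \<le> (\<Sum>k<d. \<mu> k)" using \<mu> by (intro sum_nonneg) auto
      have \<delta>: "0 < \<delta>" using S by (simp add: \<delta>_def)
      have near: "0 < 1 + t * \<mu> k" if "k < d" "t \<in> ball 0 \<delta>" for t k
      proof -
        have "\<mu> k \<le> (\<Sum>k<d. \<mu> k)" using that \<mu> by (intro member_le_sum) auto
        then have "\<bar>t\<bar> * \<mu> k \<le> \<bar>t\<bar> * (1 + (\<Sum>k<d. \<mu> k))" by (intro mult_left_mono) auto
        also have "\<dots> < 1" using that S by (simp add: \<delta>_def pos_less_divide_eq)
        finally have "\<bar>t * \<mu> k\<bar> < 1" using \<mu>[OF that(1)] by (simp add: abs_mult)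
        then show ?thesis by linarith
      qed
      have "((\<lambda>t. \<Sum>k<d. w k / (1 + t * \<mu> k)) has_field_derivative (\<Sum>k<d. - (w k * \<mu> k))) (at 0)"
        by (intro DERIV_sum) (auto intro!: derivative_eq_intros)
      then have "((\<lambda>t. log_deriv p z (M + t *\<^sub>R x)) has_field_derivative (\<Sum>k<d. - (w k * \<mu> k))) (at 0)"
        by (rule has_field_derivative_transform_within_open[of _ _ _ "ball 0 \<delta>"])
          (use \<delta> ld near in auto)
      moreover have "((\<lambda>t. log_deriv p z (M + t *\<^sub>R x)) has_field_derivative - log_deriv2 p z x M) (at 0)"
        using log_deriv_has_derivative[of p M 0 x z] c by simp
      ultimately show ?thesis using DERIV_unique by (fastforce simp: sum_negf)
    qed
    show "\<forall>t. (\<forall>k<d. 0 < 1 + t * \<mu> k) \<longrightarrow>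
       M + t *\<^sub>R x \<in> pos_cone p e \<and> log_deriv p z (M + t *\<^sub>R x) = (\<Sum>k<d. w k / (1 + t * \<mu> k))"
    proof (intro allI impI conjI)
      fix t assume nz: "\<forall>k<d. 0 < 1 + t * \<mu> k"
      \<comment> \<open>Tested in the direction \<open>M\<close>, since adding \<open>s M\<close>
        only rescales the line: \<open>M + t x + s M\<close> is \<open>1 + s\<close> times a point
        to which the factorization applies.\<close>
      have "M + t *\<^sub>R x \<in> pos_cone p M"
        unfolding pos_cone_def
      proof safe
        fix s :: real assume s: "0 \<le> s" "mpol_eval p (($) (M + t *\<^sub>R x + s *\<^sub>R M)) = 0"
        have "M + t *\<^sub>R x + s *\<^sub>R M = (1 + s) *\<^sub>R (M + (t / (1 + s)) *\<^sub>R x)"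
          using s by (simp add: scaleR_add_right) (simp add: scaleR_add_left)
        then have "(\<Prod>k<d. 1 + t / (1 + s) * \<mu> k) = 0"
          using s c mpol_eval_scaleR[OF hom, of "1 + s"] by (simp add: fac_t)
        then obtain k where k: "k < d" "1 + t / (1 + s) * \<mu> k = 0" by auto
        then have "1 + s + t * \<mu> k = 0" using s by (simp add: field_simps)
        with nz k(1) s show False by fastforce
      qed
      then show "M + t *\<^sub>R x \<in> pos_cone p e" using pos_cone_eq[OF hyp M] by simp
      show "log_deriv p z (M + t *\<^sub>R x) = (\<Sum>k<d. w k / (1 + t * \<mu> k))"
        using ld nz by blast
    qed
    show "\<forall>k<d. 0 \<le> \<mu> k" "\<forall>k<d. 0 \<le> w k" using \<mu> w by blast+
    show "\<forall>t. mpol_eval p (($) (M + t *\<^sub>R x)) = ?c * (\<Prod>k<d. 1 + t * \<mu> k)" using fac_t by blast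
  qed
qed

lemma log_deriv_nonneg:
  assumes "hyperbolic d p e" "0 < d" "M \<in> pos_cone p e" "z \<in> pos_cone p e" "x \<in> hyperbolicity_cone p e"
  shows "0 \<le> log_deriv p x M" "0 \<le> log_deriv2 p z x M"
  by (rule log_deriv_partial_fractions[OF assms], auto intro!: sum_nonneg)+

text \<open>Write \<open>1 / (1 + t * \<mu> k)\<close> as
  \<open>1 - t * \<mu> k / (1 + t * \<mu> k)\<close> and use that \<open>\<mu> k\<close> is at most
  the sum of all \<open>\<mu>\<close>, which is \<open>log_deriv p x M\<close>. The estimate goes
  the same way for both signs of \<open>t\<close>, so it serves both barriers. If only one
  \<open>\<mu> k\<close> is nonzero, it is the Sherman-Morrison equality.\<close>

lemma log_deriv_step:
  assumes hyp: "hyperbolic d p e" and d: "0 < d"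
    and M: "M \<in> pos_cone p e" and z: "z \<in> pos_cone p e" and x: "x \<in> hyperbolicity_cone p e"
    and t: "0 < 1 + t * log_deriv p x M"
  shows "M + t *\<^sub>R x \<in> pos_cone p e"
    and "log_deriv p z (M + t *\<^sub>R x) \<le> log_deriv p z M - t * log_deriv2 p z x M / (1 + t * log_deriv p x M)"
proof -
  obtain \<mu> w where \<mu>': "\<forall>k<d. 0 \<le> \<mu> k" and w': "\<forall>k<d. 0 \<le> w k"
    and G: "log_deriv p x M = (\<Sum>k<d. \<mu> k)" and A: "log_deriv2 p z x M = (\<Sum>k<d. w k * \<mu> k)"
    and pf: "\<forall>t. (\<forall>k<d. 0 < 1 + t * \<mu> k) \<longrightarrow>
       M + t *\<^sub>R x \<in> pos_cone p e \<and> log_deriv p z (M + t *\<^sub>R x) = (\<Sum>k<d. w k / (1 + t * \<mu> k))"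
    by (rule log_deriv_partial_fractions[OF hyp d M z x]) (rule that)
  have \<mu>: "0 \<le> \<mu> k" and w: "0 \<le> w k" if "k < d" for k using \<mu>' w' that by auto
  let ?S = "\<Sum>k<d. \<mu> k"
  have le: "\<mu> k \<le> ?S" if "k < d" for k using that \<mu> by (intro member_le_sum) auto
  have pos: "0 < 1 + t * \<mu> k" if k: "k < d" for k
  proof (cases "0 \<le> t")
    case True
    then have "0 \<le> t * \<mu> k" using \<mu>[OF k] by simp
    then show ?thesis by linarith
  next
    case False
    then have "t * ?S \<le> t * \<mu> k" using le[OF k] by (intro mult_left_mono_neg) auto
    then show ?thesis using t unfolding G by linarith
  qed
  show "M + t *\<^sub>R x \<in> pos_cone p e" using pf pos by blast
  have "log_deriv p z M = (\<Sum>k<d. w k)" using pf by (auto dest: spec[of _ 0])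
  moreover have "log_deriv p z (M + t *\<^sub>R x) = (\<Sum>k<d. w k / (1 + t * \<mu> k))" using pf pos by blast
  moreover have "(\<Sum>k<d. w k / (1 + t * \<mu> k)) \<le> (\<Sum>k<d. w k - t * (w k * \<mu> k) / (1 + t * ?S))"
  proof (rule sum_mono)
    fix k assume "k \<in> {..<d}"
    then have k: "k < d" by simp
    have "t * \<mu> k / (1 + t * ?S) \<le> t * \<mu> k / (1 + t * \<mu> k)"
    proof (cases "0 \<le> t")
      case True
      then have "t * \<mu> k \<le> t * ?S" using le[OF k] by (intro mult_left_mono) auto
      then show ?thesis using True \<mu>[OF k] pos[OF k] by (intro divide_left_mono) (auto intro!: mult_pos_pos)
    next
      case False
      then have "t * ?S \<le> t * \<mu> k" using le[OF k] by (intro mult_left_mono_neg) auto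
      moreover have "t * \<mu> k \<le> 0" using False \<mu>[OF k] by (simp add: mult_nonpos_nonneg)
      ultimately show ?thesis using t G pos[OF k] by (intro divide_left_mono_neg) (auto intro!: mult_pos_pos)
    qed
    then have "1 / (1 + t * \<mu> k) \<le> 1 - t * \<mu> k / (1 + t * ?S)"
      using pos[OF k] by (simp add: field_simps)
    from mult_left_mono[OF this w[OF k]]
    show "w k / (1 + t * \<mu> k) \<le> w k - t * (w k * \<mu> k) / (1 + t * ?S)"
      by (simp add: algebra_simps)
  qed
  ultimately show "log_deriv p z (M + t *\<^sub>R x) \<le>
      log_deriv p z M - t * log_deriv2 p z x M / (1 + t * log_deriv p x M)"
    by (simp add: G A sum_subtractf sum_distrib_left sum_divide_distrib)
qed

section \<open>The barrier argument\<close>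

text \<open>The \<open>\<mu> k\<close> are the reciprocals of the eigenvalues of \<open>M\<close>
  relative to \<open>z\<close>, which are nonzero because \<open>p(M)\<close> is.\<close>

lemma dir_factorization:
  assumes hyp: "hyperbolic d p e" and M: "M \<in> pos_cone p e" and z: "z \<in> pos_cone p e"
  obtains \<mu> where "\<forall>k<d. 0 < \<mu> k"
    and "\<forall>t. mpol_eval p (($) (M + t *\<^sub>R z)) = mpol_eval p (($) M) * (\<Prod>k<d. 1 + t * \<mu> k)"
proof -
  have "M \<in> hyperbolicity_cone p e" using M pos_cone_subset_hyperbolicity_cone[OF hyp] by blast
  then obtain \<nu> where \<nu>: "\<And>k. k < d \<Longrightarrow> 0 \<le> \<nu> k"
    and fac: "affine_poly p (($) M) (($) z) = smult (mpol_eval p (($) z)) (\<Prod>k<d. [:\<nu> k, 1:])"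
    using hyperbolic_factorization[OF hyp z] by blast
  have ev: "mpol_eval p (($) (M + t *\<^sub>R z)) = mpol_eval p (($) z) * (\<Prod>k<d. \<nu> k + t)" for t
    using poly_affine_poly_vec[of p M z t] by (simp add: fac poly_prod)
  have M0: "mpol_eval p (($) M) = mpol_eval p (($) z) * (\<Prod>k<d. \<nu> k)" using ev[of 0] by simp
  have \<nu>_pos: "0 < \<nu> k" if "k < d" for k
  proof -
    have "\<nu> k \<noteq> 0"
    proof
      assume "\<nu> k = 0"
      then have "(\<Prod>k<d. \<nu> k) = 0" using that by (intro prod_zero) auto
      then show False using M0 pos_cone_nonzero[OF M] by simp
    qed
    then show ?thesis using \<nu>[OF that] by simp
  qed
  have "mpol_eval p (($) (M + t *\<^sub>R z)) = mpol_eval p (($) M) * (\<Prod>k<d. 1 + t * (1 / \<nu> k))" for t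
  proof -
    have "(\<Prod>k<d. \<nu> k) * (\<Prod>k<d. 1 + t * (1 / \<nu> k)) = (\<Prod>k<d. \<nu> k + t)"
      unfolding prod.distrib[symmetric]
    proof (rule prod.cong)
      fix k assume "k \<in> {..<d}"
      then show "\<nu> k * (1 + t * (1 / \<nu> k)) = \<nu> k + t" using \<nu>_pos[of k] by (simp add: field_simps)
    qed simp
    then show ?thesis unfolding ev M0 by (simp only: mult.assoc)
  qed
  then show ?thesis using \<nu>_pos by (intro that[of "\<lambda>k. 1 / \<nu> k"]) auto
qed

lemma shift_along_dir:
  assumes hyp: "hyperbolic d p e" and M: "M \<in> pos_cone p e" and z: "z \<in> pos_cone p e"
    and \<mu>: "\<forall>k<d. 0 < \<mu> k"
    and fac: "\<forall>t. mpol_eval p (($) (M + t *\<^sub>R z)) = mpol_eval p (($) M) * (\<Prod>k<d. 1 + t * \<mu> k)"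
    and s: "\<forall>k<d. 0 < 1 + s * \<mu> k"
  shows "M + s *\<^sub>R z \<in> pos_cone p e"
    and "log_deriv p z (M + s *\<^sub>R z) = (\<Sum>k<d. \<mu> k / (1 + s * \<mu> k))"
    and "log_deriv2 p z z (M + s *\<^sub>R z) = (\<Sum>k<d. (\<mu> k / (1 + s * \<mu> k))\<^sup>2)"
proof -
  have c: "mpol_eval p (($) M) \<noteq> 0" using pos_cone_nonzero[OF M] .
  have nz: "mpol_eval p (($) (M + t *\<^sub>R z)) \<noteq> 0" if "\<forall>k<d. 0 < 1 + t * \<mu> k" for t
    using c that fac by (fastforce simp: prod_zero_iff)
  have "M + s *\<^sub>R z \<in> pos_cone p z"
    unfolding pos_cone_def
  proof safe
    fix r :: real assume r: "0 \<le> r" "mpol_eval p (($) (M + s *\<^sub>R z + r *\<^sub>R z)) = 0"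
    have "0 < 1 + (s + r) * \<mu> k" if k: "k < d" for k
    proof -
      have "0 \<le> r * \<mu> k" using r(1) \<mu> k by (simp add: less_imp_le)
      then show ?thesis using s k by (simp add: ring_distribs add_pos_nonneg flip: add.assoc)
    qed
    from nz[of "s + r"] this r(2) show False by (simp add: scaleR_add_left add.assoc)
  qed
  then show "M + s *\<^sub>R z \<in> pos_cone p e" using pos_cone_eq[OF hyp z] by simp
  have ld: "log_deriv p z (M + t *\<^sub>R z) = (\<Sum>k<d. \<mu> k / (1 + t * \<mu> k))"
    if "\<forall>k<d. 0 < 1 + t * \<mu> k" for t
    by (rule log_deriv_of_factorization[of p M z "mpol_eval p (($) M)"])
      (use fac c that in fastforce)+
  from ld[OF s] show "log_deriv p z (M + s *\<^sub>R z) = (\<Sum>k<d. \<mu> k / (1 + s * \<mu> k))" .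
  \<comment> \<open>The closed form of the potential is known only where all factors are positive;
    differentiating it at \<open>s\<close> requires this set to be open.\<close>
  define S where "S = (\<Inter>k<d. {t. 0 < 1 + t * \<mu> k})"
  have "open S" unfolding S_def by (intro open_INT open_Collect_less continuous_intros ballI) auto
  have "((\<lambda>t. \<Sum>k<d. \<mu> k / (1 + t * \<mu> k)) has_field_derivative
      (\<Sum>k<d. - (\<mu> k / (1 + s * \<mu> k))\<^sup>2)) (at s)"
  proof (rule DERIV_sum)
    fix k assume "k \<in> {..<d}"
    then have "1 + s * \<mu> k \<noteq> 0" using s by fastforce
    then show "((\<lambda>t. \<mu> k / (1 + t * \<mu> k)) has_field_derivative - (\<mu> k / (1 + s * \<mu> k))\<^sup>2) (at s)"
      by (auto intro!: derivative_eq_intros simp: power2_eq_square)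
  qed
  then have "((\<lambda>t. log_deriv p z (M + t *\<^sub>R z)) has_field_derivative
      (\<Sum>k<d. - (\<mu> k / (1 + s * \<mu> k))\<^sup>2)) (at s)"
    by (rule has_field_derivative_transform_within_open[OF _ \<open>open S\<close>])
      (use s ld in \<open>auto simp: S_def\<close>)
  moreover have "((\<lambda>t. log_deriv p z (M + t *\<^sub>R z)) has_field_derivative
      - log_deriv2 p z z (M + s *\<^sub>R z)) (at s)"
    by (rule log_deriv_has_derivative[OF nz[OF s]])
  ultimately show "log_deriv2 p z z (M + s *\<^sub>R z) = (\<Sum>k<d. (\<mu> k / (1 + s * \<mu> k))\<^sup>2)"
    using DERIV_unique by (fastforce simp: sum_negf)
qed

text \<open>The shift replaces \<mu> by \<kappa> with
  \<open>\<mu> - \<kappa> = \<delta> * \<mu> * \<kappa>\<close>, so \<open>\<Delta>\<close> is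
  \<delta> times the sum of \<open>\<mu> k * \<kappa> k\<close>. As \<open>\<kappa> < \<mu>\<close>,
  that sum exceeds the sum of the squares of \<kappa>, which is the second derivative.\<close>

lemma upper_barrier_shift:
  assumes hyp: "hyperbolic d p e" and d: "0 < d" and M: "M \<in> pos_cone p e" and z: "z \<in> pos_cone p e"
    and \<delta>: "0 < \<delta>"
  defines "M' \<equiv> M + \<delta> *\<^sub>R z"
  defines "\<Delta> \<equiv> log_deriv p z M - log_deriv p z M'"
  shows "M' \<in> pos_cone p e" "0 < \<Delta>"
    "log_deriv2 p z z M' / \<Delta> + log_deriv p z M' < 1 / \<delta> + log_deriv p z M"
proof -
  obtain \<mu> where \<mu>: "\<forall>k<d. 0 < \<mu> k"
    and fac: "\<forall>t. mpol_eval p (($) (M + t *\<^sub>R z)) = mpol_eval p (($) M) * (\<Prod>k<d. 1 + t * \<mu> k)"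
    by (rule dir_factorization[OF hyp M z])
  define \<kappa> where "\<kappa> k = \<mu> k / (1 + \<delta> * \<mu> k)" for k
  have pos: "\<forall>k<d. 0 < 1 + \<delta> * \<mu> k" using \<mu> \<delta> by (simp add: add_pos_pos)
  note sh = shift_along_dir[OF hyp M z \<mu> fac]
  show "M' \<in> pos_cone p e" unfolding M'_def using sh(1)[OF pos] .
  have ld': "log_deriv p z M' = (\<Sum>k<d. \<kappa> k)" using sh(2)[OF pos] by (simp add: M'_def \<kappa>_def)
  have ld2: "log_deriv2 p z z M' = (\<Sum>k<d. (\<kappa> k)\<^sup>2)" using sh(3)[OF pos] by (simp add: M'_def \<kappa>_def)
  have ld: "log_deriv p z M = (\<Sum>k<d. \<mu> k)" using sh(2)[of 0] by simp
  have \<kappa>: "0 < \<kappa> k" "\<mu> k - \<kappa> k = \<delta> * (\<mu> k * \<kappa> k)" if "k < d" for k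
  proof -
    have "0 < \<mu> k" "0 < 1 + \<delta> * \<mu> k" using \<mu> pos that by auto
    then show "0 < \<kappa> k" "\<mu> k - \<kappa> k = \<delta> * (\<mu> k * \<kappa> k)" by (simp_all add: \<kappa>_def field_simps)
  qed
  have \<kappa>_less: "\<kappa> k < \<mu> k" if "k < d" for k
    using \<kappa>[OF that] \<mu> \<delta> that by (metis diff_gt_0_iff_gt mult_pos_pos)
  have ne: "{..<d} \<noteq> {}" using d by auto
  have \<Delta>: "\<Delta> = \<delta> * (\<Sum>k<d. \<mu> k * \<kappa> k)"
    using \<kappa>(2) by (simp add: \<Delta>_def ld ld' sum_distrib_left flip: sum_subtractf)
  have a: "0 < (\<Sum>k<d. \<mu> k * \<kappa> k)" using \<kappa>(1) \<mu> ne by (intro sum_pos) auto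
  with \<delta> show "0 < \<Delta>" by (simp add: \<Delta>)
  have "(\<Sum>k<d. (\<kappa> k)\<^sup>2) < (\<Sum>k<d. \<mu> k * \<kappa> k)"
    using \<kappa>(1) \<kappa>_less ne by (intro sum_strict_mono) (auto simp: power2_eq_square)
  then have "log_deriv2 p z z M' / \<Delta> < 1 / \<delta>"
    using a \<delta> by (simp add: \<Delta> ld2 field_simps)
  then show "log_deriv2 p z z M' / \<Delta> + log_deriv p z M' < 1 / \<delta> + log_deriv p z M"
    using \<open>0 < \<Delta>\<close> by (simp add: \<Delta>_def)
qed

text \<open>Each \<open>\<mu> k\<close> is at most the potential, so the bound on \<delta> stops the
  shift before the first pole. The quotient of the second derivative by \<open>\<Delta>\<close>
  exceeds \<open>1 / \<delta>\<close> by \<open>b / a\<close>, and this excess must cover the growth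
  \<open>\<delta> * a\<close> of the potential. Cauchy-Schwarz gives
  \<open>a\<^sup>2 \<le> b * log_deriv p z M\<close>, and the bound on \<delta> does the
  rest.\<close>

lemma lower_barrier_shift:
  assumes hyp: "hyperbolic d p e" and d: "0 < d" and M: "M \<in> pos_cone p e" and z: "z \<in> pos_cone p e"
    and \<delta>: "0 < \<delta>" "\<delta> * log_deriv p z M < 1"
  defines "M' \<equiv> M - \<delta> *\<^sub>R z"
  defines "\<Delta> \<equiv> log_deriv p z M' - log_deriv p z M"
  shows "M' \<in> pos_cone p e" "0 < \<Delta>"
    "1 / \<delta> - log_deriv p z M \<le> log_deriv2 p z z M' / \<Delta> - log_deriv p z M'"
proof -
  obtain \<mu> where \<mu>: "\<forall>k<d. 0 < \<mu> k"
    and fac: "\<forall>t. mpol_eval p (($) (M + t *\<^sub>R z)) = mpol_eval p (($) M) * (\<Prod>k<d. 1 + t * \<mu> k)"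
    by (rule dir_factorization[OF hyp M z])
  define \<kappa> where "\<kappa> k = \<mu> k / (1 - \<delta> * \<mu> k)" for k
  note sh = shift_along_dir[OF hyp M z \<mu> fac]
  have ld: "log_deriv p z M = (\<Sum>k<d. \<mu> k)" using sh(2)[of 0] by simp
  have pos: "\<forall>k<d. 0 < 1 + (- \<delta>) * \<mu> k"
  proof safe
    fix k assume k: "k < d"
    have "\<mu> k \<le> (\<Sum>k<d. \<mu> k)" using \<mu> k by (intro member_le_sum) (auto intro: less_imp_le)
    then have "\<delta> * \<mu> k \<le> \<delta> * log_deriv p z M" using \<delta>(1) by (simp add: ld)
    then show "0 < 1 + (- \<delta>) * \<mu> k" using \<delta>(2) by simp
  qed
  have M': "M' = M + (- \<delta>) *\<^sub>R z" by (simp add: M'_def)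
  show "M' \<in> pos_cone p e" unfolding M' using sh(1)[OF pos] .
  have ld': "log_deriv p z M' = (\<Sum>k<d. \<kappa> k)" using sh(2)[OF pos] by (simp add: M'_def \<kappa>_def)
  have ld2: "log_deriv2 p z z M' = (\<Sum>k<d. (\<kappa> k)\<^sup>2)" using sh(3)[OF pos] by (simp add: M'_def \<kappa>_def)
  have \<kappa>: "0 < \<kappa> k" "\<kappa> k - \<mu> k = \<delta> * (\<kappa> k * \<mu> k)" if "k < d" for k
  proof -
    have "0 < \<mu> k" "0 < 1 - \<delta> * \<mu> k" using \<mu> pos that by auto
    then show "0 < \<kappa> k" "\<kappa> k - \<mu> k = \<delta> * (\<kappa> k * \<mu> k)" by (simp_all add: \<kappa>_def field_simps)
  qed
  have ne: "{..<d} \<noteq> {}" using d by auto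
  define a where "a = (\<Sum>k<d. \<kappa> k * \<mu> k)"
  define b where "b = (\<Sum>k<d. (\<kappa> k)\<^sup>2 * \<mu> k)"
  have \<Delta>: "\<Delta> = \<delta> * a"
    using \<kappa>(2) by (simp add: \<Delta>_def ld ld' a_def sum_distrib_left flip: sum_subtractf)
  have a: "0 < a" unfolding a_def using \<kappa>(1) \<mu> ne by (intro sum_pos) auto
  with \<delta> show "0 < \<Delta>" by (simp add: \<Delta>)
  have b: "0 \<le> b" unfolding b_def using \<mu> by (intro sum_nonneg) (auto intro: less_imp_le)
  have "(\<kappa> k)\<^sup>2 = \<kappa> k * \<mu> k + \<delta> * ((\<kappa> k)\<^sup>2 * \<mu> k)" if "k < d" for k
  proof -
    have "(\<kappa> k)\<^sup>2 = \<kappa> k * \<mu> k + \<kappa> k * (\<kappa> k - \<mu> k)" by (simp add: power2_eq_square algebra_simps)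
    also have "\<kappa> k * (\<kappa> k - \<mu> k) = \<delta> * ((\<kappa> k)\<^sup>2 * \<mu> k)"
      unfolding \<kappa>(2)[OF that] by (simp add: power2_eq_square mult_ac)
    finally show ?thesis .
  qed
  then have "(\<Sum>k<d. (\<kappa> k)\<^sup>2) = (\<Sum>k<d. \<kappa> k * \<mu> k + \<delta> * ((\<kappa> k)\<^sup>2 * \<mu> k))"
    by (intro sum.cong) auto
  then have ab: "(\<Sum>k<d. (\<kappa> k)\<^sup>2) = a + \<delta> * b"
    by (simp add: a_def b_def sum.distrib sum_distrib_left)
  have "a\<^sup>2 = (\<Sum>k<d. (\<kappa> k * sqrt (\<mu> k)) * sqrt (\<mu> k))\<^sup>2"
    unfolding a_def using \<mu> by (intro arg_cong[of _ _ "\<lambda>x. x\<^sup>2"] sum.cong) (auto simp: less_imp_le)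
  also have "\<dots> \<le> (\<Sum>k<d. (\<kappa> k * sqrt (\<mu> k))\<^sup>2) * (\<Sum>k<d. (sqrt (\<mu> k))\<^sup>2)"
    by (rule Cauchy_Schwarz_ineq_sum)
  also have "\<dots> = b * (\<Sum>k<d. \<mu> k)"
    unfolding b_def using \<mu> by (intro arg_cong2[of _ _ _ _ "(*)"] sum.cong)
      (auto simp: less_imp_le power_mult_distrib)
  finally have "a\<^sup>2 \<le> b * log_deriv p z M" by (simp add: ld)
  then have "\<delta> * a\<^sup>2 \<le> b * (\<delta> * log_deriv p z M)" using \<delta>(1) by (simp add: mult_ac)
  also have "\<dots> \<le> b" using b \<delta>(2) by (intro mult_left_le) auto
  finally have "\<delta> * a \<le> b / a" using a by (simp add: field_simps power2_eq_square)
  moreover have "log_deriv2 p z z M' / \<Delta> = 1 / \<delta> + b / a"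
    using a \<delta>(1) by (simp add: \<Delta> ld2 ab field_simps)
  ultimately show "1 / \<delta> - log_deriv p z M \<le> log_deriv2 p z z M' / \<Delta> - log_deriv p z M'"
    using \<Delta> by (simp add: \<Delta>_def)
qed

text \<open>Euler's identity. It places the initial barriers: at offset \<open>d / a\<close> along
  \<open>z\<close> the potential is exactly \<open>a\<close>.\<close>

lemma log_deriv_scaled_dir:
  assumes hyp: "hyperbolic d p e" and z: "z \<in> pos_cone p e" and a: "0 < a"
  shows "log_deriv p z (a *\<^sub>R z) = d / a"
proof -
  have hom: "homogeneous d p" using hyp by (simp add: hyperbolic_def)
  have eq: "mpol_eval p (($) (0 + t *\<^sub>R z)) = t ^ d * mpol_eval p (($) z)" for t
    using mpol_eval_scaleR[OF hom, of t z] by simp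
  have "((\<lambda>t. t ^ d * mpol_eval p (($) z)) has_field_derivative mpol_eval (dir_deriv z p) (($) (a *\<^sub>R z))) (at a)"
    using mpol_eval_line_has_derivative[of p 0 z a] unfolding eq by simp
  moreover have "((\<lambda>t. t ^ d * mpol_eval p (($) z)) has_field_derivative d * a ^ (d - 1) * mpol_eval p (($) z)) (at a)"
    by (auto intro!: derivative_eq_intros)
  ultimately have "mpol_eval (dir_deriv z p) (($) (a *\<^sub>R z)) = d * a ^ (d - 1) * mpol_eval p (($) z)"
    by (rule DERIV_unique)
  then show ?thesis
    using eq[of a] pos_cone_nonzero[OF z] a by (cases d) (auto simp: log_deriv_def)
qed

text \<open>Averaging: over the family the upper scores sum to less than
  \<open>1 / \<delta>U + \<epsilon>U\<close> and the lower ones to at least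
  \<open>1 / \<delta>L - \<epsilon>L\<close>. So some \<open>x i\<close> has its lower score above
  its upper score, which leaves room for a weight that both barriers accept.\<close>

lemma barrier_step:
  fixes x :: "'i \<Rightarrow> real^'n"
  assumes hyp: "hyperbolic d p e" and d: "0 < d" and z: "z \<in> pos_cone p e"
    and x: "\<And>i. i \<in> J \<Longrightarrow> x i \<in> hyperbolicity_cone p e" "(\<Sum>i\<in>J. x i) = z"
    and U: "U \<in> pos_cone p e" "log_deriv p z U \<le> \<epsilon>U"
    and L: "L \<in> pos_cone p e" "log_deriv p z L \<le> \<epsilon>L"
    and \<delta>: "0 < \<delta>U" "0 < \<delta>L" "\<delta>L * \<epsilon>L < 1" "1 / \<delta>U + \<epsilon>U \<le> 1 / \<delta>L - \<epsilon>L"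
  shows "\<exists>i\<in>J. \<exists>t>0.
    U + \<delta>U *\<^sub>R z - t *\<^sub>R x i \<in> pos_cone p e \<and> log_deriv p z (U + \<delta>U *\<^sub>R z - t *\<^sub>R x i) \<le> \<epsilon>U \<and>
    L - \<delta>L *\<^sub>R z + t *\<^sub>R x i \<in> pos_cone p e \<and> log_deriv p z (L - \<delta>L *\<^sub>R z + t *\<^sub>R x i) \<le> \<epsilon>L"
proof -
  let ?U = "U + \<delta>U *\<^sub>R z" and ?L = "L - \<delta>L *\<^sub>R z"
  let ?\<Delta>U = "log_deriv p z U - log_deriv p z ?U" and ?\<Delta>L = "log_deriv p z ?L - log_deriv p z L"
  have "\<delta>L * log_deriv p z L \<le> \<delta>L * \<epsilon>L" using \<delta>(2) L(2) by simp
  then have \<delta>L: "\<delta>L * log_deriv p z L < 1" using \<delta>(3) by linarith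
  note up = upper_barrier_shift[OF hyp d U(1) z \<delta>(1)]
  note lo = lower_barrier_shift[OF hyp d L(1) z \<delta>(2) \<delta>L]
  \<comment> \<open>By \<open>log_deriv_step\<close>, adding \<open>t *\<^sub>R x i\<close>
    preserves the upper potential bound if \<open>t * fU i \<le> 1\<close> and
    \<open>1 - t * log_deriv p (x i) ?U\<close> is positive, and the lower bound if
    \<open>t * fL i \<ge> 1\<close>.\<close>
  define fU where "fU i = log_deriv2 p z (x i) ?U / ?\<Delta>U + log_deriv p (x i) ?U" for i
  define fL where "fL i = log_deriv2 p z (x i) ?L / ?\<Delta>L - log_deriv p (x i) ?L" for i
  have ld_sum: "(\<Sum>i\<in>J. log_deriv p (x i) v) = log_deriv p z v"
    and ld2_sum: "(\<Sum>i\<in>J. log_deriv2 p z (x i) v) = log_deriv2 p z z v" for v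
    using log_deriv_sum[where c = "\<lambda>_. 1" and u = x and A = J and p = p and v = v]
      log_deriv2_sum[where c = "\<lambda>_. 1" and u = x and A = J and p = p and v = v and z = z] by (simp_all add: x(2))
  have "(\<Sum>i\<in>J. fU i) = log_deriv2 p z z ?U / ?\<Delta>U + log_deriv p z ?U"
    unfolding fU_def sum.distrib ld_sum by (simp add: ld2_sum flip: sum_divide_distrib)
  also have "\<dots> < 1 / \<delta>U + \<epsilon>U" using up(3) U(2) by linarith
  also have "\<dots> \<le> 1 / \<delta>L - log_deriv p z L" using \<delta>(4) L(2) by linarith
  also have "\<dots> \<le> log_deriv2 p z z ?L / ?\<Delta>L - log_deriv p z ?L" by (rule lo(3))
  also have "\<dots> = (\<Sum>i\<in>J. fL i)"
    unfolding fL_def sum_subtractf ld_sum by (simp add: ld2_sum flip: sum_divide_distrib)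
  finally have "\<not> (\<Sum>i\<in>J. fL i) \<le> (\<Sum>i\<in>J. fU i)" by simp
  then obtain i where i: "i \<in> J" "fU i < fL i" by (meson not_le sum_mono)
  note xi = x(1)[OF i(1)]
  note nnU = log_deriv_nonneg[OF hyp d up(1) z xi] and nnL = log_deriv_nonneg[OF hyp d lo(1) z xi]
  have "0 \<le> fU i" using nnU up(2) by (simp add: fU_def)
  then have fL: "0 < fL i" using i(2) by simp
  \<comment> \<open>The lower condition is met with equality. The upper one is strict, which also
    keeps the upper slack in the open cone.\<close>
  define t where "t = 1 / fL i"
  have t: "0 < t" "t * fL i = 1" using fL by (simp_all add: t_def)
  have gU: "log_deriv p (x i) ?U \<le> fU i" using nnU(2) up(2) by (simp add: fU_def)
  have "t * log_deriv p (x i) ?U < t * fL i" using gU i(2) t(1) by (intro mult_strict_left_mono) auto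
  then have posU: "0 < 1 + (- t) * log_deriv p (x i) ?U" using t(2) by simp
  have posL: "0 < 1 + t * log_deriv p (x i) ?L" using nnL(1) t(1) by (simp add: add_pos_nonneg)
  note stU = log_deriv_step[OF hyp d up(1) z xi posU]
  note stL = log_deriv_step[OF hyp d lo(1) z xi posL]
  have "t * log_deriv2 p z (x i) ?U = t * ((fU i - log_deriv p (x i) ?U) * ?\<Delta>U)"
    using up(2) by (simp add: fU_def)
  also have "\<dots> \<le> t * ((fL i - log_deriv p (x i) ?U) * ?\<Delta>U)"
    using t(1) i(2) up(2) by (intro mult_left_mono mult_right_mono) auto
  also have "\<dots> = (t * fL i - t * log_deriv p (x i) ?U) * ?\<Delta>U" by (simp add: algebra_simps)
  finally have "t * log_deriv2 p z (x i) ?U \<le> ?\<Delta>U * (1 + (- t) * log_deriv p (x i) ?U)"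
    unfolding t(2) by (simp add: mult.commute)
  then have "t * log_deriv2 p z (x i) ?U / (1 + (- t) * log_deriv p (x i) ?U) \<le> ?\<Delta>U"
    using posU by (simp only: pos_divide_le_eq)
  then have U': "log_deriv p z (?U + (- t) *\<^sub>R x i) \<le> \<epsilon>U" using stU(2) U(2) by simp
  have "t * log_deriv2 p z (x i) ?L = t * ((fL i + log_deriv p (x i) ?L) * ?\<Delta>L)"
    using lo(2) by (simp add: fL_def)
  also have "\<dots> = (t * fL i + t * log_deriv p (x i) ?L) * ?\<Delta>L" by (simp add: algebra_simps)
  finally have "t * log_deriv2 p z (x i) ?L / (1 + t * log_deriv p (x i) ?L) = ?\<Delta>L"
    unfolding t(2) using posL by simp
  then have L': "log_deriv p z (?L + t *\<^sub>R x i) \<le> \<epsilon>L" using stL(2) L(2) by simp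
  show ?thesis
    using i(1) t(1) stU(1) U' stL(1) L' by (intro bexI[of _ i] exI[of _ t]) auto
qed

lemma barrier_iterate:
  fixes x :: "'i \<Rightarrow> real^'n"
  assumes hyp: "hyperbolic d p e" and d: "0 < d" and z: "z \<in> pos_cone p e"
    and J: "finite J" and x: "\<And>i. i \<in> J \<Longrightarrow> x i \<in> hyperbolicity_cone p e" "(\<Sum>i\<in>J. x i) = z"
    and \<epsilon>: "0 < \<epsilon>U" "0 < \<epsilon>L"
    and \<delta>: "0 < \<delta>U" "0 < \<delta>L" "\<delta>L * \<epsilon>L < 1" "1 / \<delta>U + \<epsilon>U \<le> 1 / \<delta>L - \<epsilon>L"
  shows "\<exists>c. (\<forall>i. 0 \<le> c i) \<and> card {i\<in>J. c i \<noteq> 0} \<le> n \<and>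
    (d / \<epsilon>U + n * \<delta>U) *\<^sub>R z - (\<Sum>i\<in>J. c i *\<^sub>R x i) \<in> pos_cone p e \<and>
    log_deriv p z ((d / \<epsilon>U + n * \<delta>U) *\<^sub>R z - (\<Sum>i\<in>J. c i *\<^sub>R x i)) \<le> \<epsilon>U \<and>
    (\<Sum>i\<in>J. c i *\<^sub>R x i) - (n * \<delta>L - d / \<epsilon>L) *\<^sub>R z \<in> pos_cone p e \<and>
    log_deriv p z ((\<Sum>i\<in>J. c i *\<^sub>R x i) - (n * \<delta>L - d / \<epsilon>L) *\<^sub>R z) \<le> \<epsilon>L"
proof (induction n)
  case 0
  have U: "(d / \<epsilon>U) *\<^sub>R z \<in> pos_cone p e" "log_deriv p z ((d / \<epsilon>U) *\<^sub>R z) = \<epsilon>U"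
    using pos_cone_scale[OF hyp z] log_deriv_scaled_dir[OF hyp z] d \<epsilon>(1) by auto
  have L: "(d / \<epsilon>L) *\<^sub>R z \<in> pos_cone p e" "log_deriv p z ((d / \<epsilon>L) *\<^sub>R z) = \<epsilon>L"
    using pos_cone_scale[OF hyp z] log_deriv_scaled_dir[OF hyp z] d \<epsilon>(2) by auto
  show ?case by (rule exI[of _ "\<lambda>_. 0"]) (use U L in simp)
next
  case (Suc n)
  then obtain c where c: "\<forall>i. 0 \<le> c i" "card {i\<in>J. c i \<noteq> 0} \<le> n"
    and U: "(d / \<epsilon>U + n * \<delta>U) *\<^sub>R z - (\<Sum>i\<in>J. c i *\<^sub>R x i) \<in> pos_cone p e"
      "log_deriv p z ((d / \<epsilon>U + n * \<delta>U) *\<^sub>R z - (\<Sum>i\<in>J. c i *\<^sub>R x i)) \<le> \<epsilon>U"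
    and L: "(\<Sum>i\<in>J. c i *\<^sub>R x i) - (n * \<delta>L - d / \<epsilon>L) *\<^sub>R z \<in> pos_cone p e"
      "log_deriv p z ((\<Sum>i\<in>J. c i *\<^sub>R x i) - (n * \<delta>L - d / \<epsilon>L) *\<^sub>R z) \<le> \<epsilon>L"
    by blast
  obtain i t where i: "i \<in> J" "0 < t"
    and U': "(d / \<epsilon>U + n * \<delta>U) *\<^sub>R z - (\<Sum>i\<in>J. c i *\<^sub>R x i) + \<delta>U *\<^sub>R z - t *\<^sub>R x i \<in> pos_cone p e"
      "log_deriv p z ((d / \<epsilon>U + n * \<delta>U) *\<^sub>R z - (\<Sum>i\<in>J. c i *\<^sub>R x i) + \<delta>U *\<^sub>R z - t *\<^sub>R x i) \<le> \<epsilon>U"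
    and L': "(\<Sum>i\<in>J. c i *\<^sub>R x i) - (n * \<delta>L - d / \<epsilon>L) *\<^sub>R z - \<delta>L *\<^sub>R z + t *\<^sub>R x i \<in> pos_cone p e"
      "log_deriv p z ((\<Sum>i\<in>J. c i *\<^sub>R x i) - (n * \<delta>L - d / \<epsilon>L) *\<^sub>R z - \<delta>L *\<^sub>R z + t *\<^sub>R x i) \<le> \<epsilon>L"
    using barrier_step[OF hyp d z x U L \<delta>] by blast
  \<comment> \<open>An index may be chosen repeatedly; then only its weight grows, so the count of
    nonzero weights is bounded by the number of steps.\<close>
  define c' where "c' = c(i := c i + t)"
  have "(\<Sum>j\<in>J. c' j *\<^sub>R x j) = (\<Sum>j\<in>J. c j *\<^sub>R x j + (if j = i then t *\<^sub>R x i else 0))"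
    by (intro sum.cong) (auto simp: c'_def scaleR_add_left)
  then have sum: "(\<Sum>j\<in>J. c' j *\<^sub>R x j) = (\<Sum>j\<in>J. c j *\<^sub>R x j) + t *\<^sub>R x i"
    using i J by (simp add: sum.distrib)
  have "card {j\<in>J. c' j \<noteq> 0} \<le> card (insert i {j\<in>J. c j \<noteq> 0})"
    using J by (intro card_mono) (auto simp: c'_def)
  also have "\<dots> \<le> Suc n" using c(2) J by (simp add: card_insert_if)
  finally have card: "card {j\<in>J. c' j \<noteq> 0} \<le> Suc n" .
  have eqU: "(d / \<epsilon>U + Suc n * \<delta>U) *\<^sub>R z - (\<Sum>j\<in>J. c' j *\<^sub>R x j)
      = (d / \<epsilon>U + n * \<delta>U) *\<^sub>R z - (\<Sum>i\<in>J. c i *\<^sub>R x i) + \<delta>U *\<^sub>R z - t *\<^sub>R x i"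
    unfolding sum by (simp add: algebra_simps)
  have eqL: "(\<Sum>j\<in>J. c' j *\<^sub>R x j) - (Suc n * \<delta>L - d / \<epsilon>L) *\<^sub>R z
      = (\<Sum>i\<in>J. c i *\<^sub>R x i) - (n * \<delta>L - d / \<epsilon>L) *\<^sub>R z - \<delta>L *\<^sub>R z + t *\<^sub>R x i"
    unfolding sum by (simp add: algebra_simps)
  have "\<forall>j. 0 \<le> c' j" using c(1) i(2) by (simp add: c'_def)
  with card U' L' show ?case by (intro exI[of _ c']) (simp only: eqU eqL simp_thms)
qed

text \<open>The parameters are those of Batson, Spielman and Srivastava, with \<open>q = sqrt (N / d)\<close>.\<close>

lemma sparsify_interior:
  fixes x :: "'i \<Rightarrow> real^'n"
  assumes hyp: "hyperbolic d p e" and d: "0 < d" and z: "z \<in> pos_cone p e"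
    and J: "finite J" and x: "\<And>i. i \<in> J \<Longrightarrow> x i \<in> hyperbolicity_cone p e" "(\<Sum>i\<in>J. x i) = z"
    and \<epsilon>: "0 < \<epsilon>" "\<epsilon> < 1" and N: "4 * d / \<epsilon>\<^sup>2 - d \<le> real N"
  shows "\<exists>c. (\<forall>i. 0 \<le> c i) \<and> card {i\<in>J. c i \<noteq> 0} \<le> N \<and>
    (1 + \<epsilon>) *\<^sub>R z - (\<Sum>i\<in>J. c i *\<^sub>R x i) \<in> hyperbolicity_cone p e \<and>
    (\<Sum>i\<in>J. c i *\<^sub>R x i) - (1 - \<epsilon>) *\<^sub>R z \<in> hyperbolicity_cone p e"
proof -
  define q where "q = sqrt (N / d)"
  have q2: "q\<^sup>2 = N / d" by (simp add: q_def)
  have "\<epsilon>\<^sup>2 < 1" using \<epsilon> by (simp add: power_less_one_iff)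
  have q2_ge: "4 / \<epsilon>\<^sup>2 \<le> q\<^sup>2 + 1" using N d by (simp add: q2 field_simps)
  have "4 < 4 / \<epsilon>\<^sup>2" using \<open>\<epsilon>\<^sup>2 < 1\<close> \<epsilon>(1) by (simp add: less_divide_eq)
  then have "1\<^sup>2 < q\<^sup>2" using q2_ge by simp
  then have q: "1 < q" by (rule power_less_imp_less_base) (simp add: q_def)
  define \<epsilon>L where "\<epsilon>L = 1 / q"
  define \<delta>U where "\<delta>U = (q + 1) / (q - 1)"
  define \<epsilon>U where "\<epsilon>U = (q - 1) / (q * (q + 1))"
  have "q \<noteq> 0" "q - 1 \<noteq> 0" "q + 1 \<noteq> 0" using q by auto
  \<comment> \<open>The step condition with lower shift 1, met with equality: both sides are
    \<open>(q - 1) / q\<close>.\<close>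
  then have "1 / \<delta>U + \<epsilon>U = 1 - \<epsilon>L"
    unfolding \<epsilon>L_def \<delta>U_def \<epsilon>U_def by (simp add: divide_simps) (simp add: algebra_simps)
  then have par: "0 < \<epsilon>U" "0 < \<epsilon>L" "0 < \<delta>U" "1 * \<epsilon>L < 1" "1 / \<delta>U + \<epsilon>U \<le> 1 / 1 - \<epsilon>L"
    using q by (simp_all add: \<epsilon>L_def \<delta>U_def \<epsilon>U_def)
  define u where "u = d * q * (q + 1)\<^sup>2 / (q - 1)"
  define l where "l = d * q * (q - 1)"
  have Nq: "real N = d * q\<^sup>2" using q2 d by simp
  have u: "d / \<epsilon>U + N * \<delta>U = u"
  proof -
    have "d / \<epsilon>U + N * \<delta>U = (d * (q * (q + 1)) + d * q\<^sup>2 * (q + 1)) / (q - 1)"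
      by (simp add: Nq \<epsilon>U_def \<delta>U_def flip: add_divide_distrib)
    also have "d * (q * (q + 1)) + d * q\<^sup>2 * (q + 1) = d * q * (q + 1)\<^sup>2"
      by (simp add: power2_eq_square algebra_simps)
    finally show ?thesis by (simp add: u_def)
  qed
  have l: "real N * 1 - d / \<epsilon>L = l"
    unfolding Nq \<epsilon>L_def l_def using q by (simp add: field_simps power2_eq_square)
  obtain c where c: "\<forall>i. 0 \<le> c i" "card {i\<in>J. c i \<noteq> 0} \<le> N"
    and U: "u *\<^sub>R z - (\<Sum>i\<in>J. c i *\<^sub>R x i) \<in> pos_cone p e"
    and L: "(\<Sum>i\<in>J. c i *\<^sub>R x i) - l *\<^sub>R z \<in> pos_cone p e"
    using barrier_iterate[OF hyp d z J x par(1,2,3) zero_less_one par(4,5), of N]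
    unfolding u l by blast
  have ul: "0 < u" "0 < l" using q d by (simp_all add: u_def l_def)
  \<comment> \<open>Chosen so that \<open>(1 + \<eta>) / (1 - \<eta>)\<close> equals the barrier
    ratio \<open>u / l\<close>, which is \<open>((q + 1) / (q - 1))\<^sup>2\<close>. The factor
    \<open>s\<close> then moves the barriers to \<open>1 - \<eta>\<close> and
    \<open>1 + \<eta>\<close>.\<close>
  define \<eta> where "\<eta> = 2 * q / (q\<^sup>2 + 1)"
  define s where "s = (1 - \<eta>) / l"
  have q2p: "0 < q\<^sup>2 + 1" by (simp add: add_nonneg_pos)
  have "0 < (q - 1)\<^sup>2" using q by simp
  then have "2 * q < q\<^sup>2 + 1" by (simp add: power2_eq_square algebra_simps)
  then have "\<eta> < 1" unfolding \<eta>_def using q2p by (simp only: divide_less_eq_1_pos)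
  then have s: "0 < s" using ul by (simp add: s_def)
  have sl: "s * l = 1 - \<eta>" using ul by (simp add: s_def)
  have \<eta>_eq: "(1 - \<eta>) * (q + 1)\<^sup>2 = (1 + \<eta>) * (q - 1)\<^sup>2"
  proof -
    have "\<eta> * (q\<^sup>2 + 1) = 2 * q" using q2p by (simp add: \<eta>_def)
    then show ?thesis by (simp add: power2_eq_square algebra_simps)
  qed
  have "u * (q - 1)\<^sup>2 = l * (q + 1)\<^sup>2"
    using \<open>q - 1 \<noteq> 0\<close> by (simp add: u_def l_def power2_eq_square)
  then have "s * u * (q - 1)\<^sup>2 = s * l * (q + 1)\<^sup>2" by (simp only: mult.assoc)
  then have "s * u * (q - 1)\<^sup>2 = (1 + \<eta>) * (q - 1)\<^sup>2" by (simp only: sl \<eta>_eq)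
  then have su: "s * u = 1 + \<eta>" using \<open>q - 1 \<noteq> 0\<close> by simp
  \<comment> \<open>Bounding \<open>q\<^sup>2\<close> by \<open>q\<^sup>2 + 1\<close> on the left is
    what makes \<open>q\<^sup>2 + 1 \<ge> 4 / \<epsilon>\<^sup>2\<close> suffice and saves
    \<open>d\<close> vectors.\<close>
  have "(2 * q)\<^sup>2 \<le> (\<epsilon> * (q\<^sup>2 + 1))\<^sup>2"
  proof -
    have "(2 * q)\<^sup>2 \<le> 4 * (q\<^sup>2 + 1)" by (simp add: power_mult_distrib)
    also have "\<dots> \<le> (\<epsilon>\<^sup>2 * (q\<^sup>2 + 1)) * (q\<^sup>2 + 1)"
      using q2_ge \<epsilon>(1) by (intro mult_right_mono) (auto simp: divide_le_eq mult.commute)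
    finally show ?thesis by (simp add: power_mult_distrib power2_eq_square mult_ac)
  qed
  then have "2 * q \<le> \<epsilon> * (q\<^sup>2 + 1)" by (rule power2_le_imp_le) (use \<epsilon>(1) in simp)
  then have \<eta>: "\<eta> \<le> \<epsilon>" unfolding \<eta>_def using q2p by (simp only: pos_divide_le_eq)
  have zK: "(\<epsilon> - \<eta>) *\<^sub>R z \<in> hyperbolicity_cone p e"
    using \<eta> z pos_cone_subset_hyperbolicity_cone[OF hyp] by (intro hyperbolicity_cone_scale[OF hyp]) auto
  define y where "y = (\<Sum>i\<in>J. c i *\<^sub>R x i)"
  have sum: "(\<Sum>i\<in>J. (s * c i) *\<^sub>R x i) = s *\<^sub>R y" by (simp add: y_def scaleR_sum_right)
  have "(1 + \<epsilon>) *\<^sub>R z - s *\<^sub>R y = (\<epsilon> - \<eta>) *\<^sub>R z + s *\<^sub>R (u *\<^sub>R z - y)"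
    by (simp add: scaleR_diff_right su algebra_simps)
  then have up: "(1 + \<epsilon>) *\<^sub>R z - s *\<^sub>R y \<in> hyperbolicity_cone p e"
    using hyperbolicity_cone_add_pos[OF hyp zK pos_cone_scale[OF hyp U s]]
      pos_cone_subset_hyperbolicity_cone[OF hyp] by (auto simp: y_def)
  have "s *\<^sub>R (y - l *\<^sub>R z) = s *\<^sub>R y - (1 - \<eta>) *\<^sub>R z" by (simp add: scaleR_diff_right sl)
  then have "s *\<^sub>R y - (1 - \<epsilon>) *\<^sub>R z = (\<epsilon> - \<eta>) *\<^sub>R z + s *\<^sub>R (y - l *\<^sub>R z)"
    by (simp add: algebra_simps)
  then have lo: "s *\<^sub>R y - (1 - \<epsilon>) *\<^sub>R z \<in> hyperbolicity_cone p e"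
    using hyperbolicity_cone_add_pos[OF hyp zK pos_cone_scale[OF hyp L s]]
      pos_cone_subset_hyperbolicity_cone[OF hyp] by (auto simp: y_def)
  show ?thesis
    using c s up lo sum by (intro exI[of _ "\<lambda>i. s * c i"]) auto
qed

section \<open>Boundary points and lifts\<close>

lemma finite_family_convergent_subseq:
  fixes C :: "nat \<Rightarrow> 'i \<Rightarrow> real"
  assumes "finite J" "\<And>i. i \<in> J \<Longrightarrow> bounded (range (\<lambda>n. C n i))"
  shows "\<exists>r L. strict_mono (r :: nat \<Rightarrow> nat) \<and> (\<forall>i\<in>J. (\<lambda>n. C (r n) i) \<longlonglongrightarrow> L i)"
  using assms
proof (induction J rule: finite_induct)
  case empty
  show ?case by (rule exI[of _ id]) (simp add: strict_mono_def)
next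
  case (insert j J)
  then obtain r L where r: "strict_mono (r :: nat \<Rightarrow> nat)" "\<forall>i\<in>J. (\<lambda>n. C (r n) i) \<longlonglongrightarrow> L i"
    by auto
  have "bounded (range (\<lambda>n. C (r n) j))"
    using insert.prems[of j] by (rule bounded_subset) auto
  then obtain l s where s: "strict_mono (s :: nat \<Rightarrow> nat)" "((\<lambda>n. C (r n) j) \<circ> s) \<longlonglongrightarrow> l"
    using bounded_imp_convergent_subsequence by blast
  have "(\<lambda>n. C ((r \<circ> s) n) i) \<longlonglongrightarrow> (L(j := l)) i" if "i \<in> insert j J" for i
  proof (cases "i = j")
    case True
    then show ?thesis using s(2) by (simp add: o_def)
  next
    case False
    then have "(\<lambda>n. C (r n) i) \<longlonglongrightarrow> L i" using r(2) that by auto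
    from LIMSEQ_subseq_LIMSEQ[OF this s(1)] False show ?thesis by (simp add: o_def)
  qed
  then show ?case using strict_mono_o[OF r(1) s(1)] by (intro exI[of _ "r \<circ> s"] exI[of _ "L(j := l)"]) blast
qed

text \<open>A boundary point \<open>z\<close> is moved into the interior by adding the vector \<open>\<eta> e\<close> to the family;
  its weight is automatically at most \<open>1 + \<epsilon>\<close>, because \<open>z\<close> would otherwise dominate a positive
  multiple of \<open>e\<close>.\<close>

lemma sparsify_perturbed:
  fixes x :: "'i \<Rightarrow> real^'n"
  assumes hyp: "hyperbolic d p e" and d: "0 < d" and z: "z \<notin> pos_cone p e"
    and J: "finite J" and x: "\<And>i. i \<in> J \<Longrightarrow> x i \<in> hyperbolicity_cone p e" "(\<Sum>i\<in>J. x i) = z"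
    and \<epsilon>: "0 < \<epsilon>" "\<epsilon> < 1" and N: "4 * d / \<epsilon>\<^sup>2 - d \<le> real N" and \<eta>: "0 < \<eta>"
  shows "\<exists>c. (\<forall>i. 0 \<le> c i) \<and> card {i\<in>J. c i \<noteq> 0} \<le> N \<and>
    (1 + \<epsilon>) *\<^sub>R z + (2 * \<eta>) *\<^sub>R e - (\<Sum>i\<in>J. c i *\<^sub>R x i) \<in> hyperbolicity_cone p e \<and>
    (\<Sum>i\<in>J. c i *\<^sub>R x i) + (2 * \<eta>) *\<^sub>R e - (1 - \<epsilon>) *\<^sub>R z \<in> hyperbolicity_cone p e"
proof -
  let ?K = "hyperbolicity_cone p e"
  \<comment> \<open>\<open>None\<close> indexes the extra vector; leaving it out afterwards cannot
    increase the number of nonzero weights.\<close>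
  define x' where "x' = case_option (\<eta> *\<^sub>R e) x"
  let ?J = "insert None (Some ` J)"
  have e: "r *\<^sub>R e \<in> ?K" if "0 \<le> r" for r
    using pos_cone_self[OF hyp] pos_cone_subset_hyperbolicity_cone[OF hyp] that
    by (intro hyperbolicity_cone_scale[OF hyp]) auto
  have zK: "z \<in> ?K" unfolding x(2)[symmetric] by (intro hyperbolicity_cone_sum[OF hyp] x(1))
  have sum: "(\<Sum>i\<in>?J. c i *\<^sub>R x' i) = c None *\<^sub>R \<eta> *\<^sub>R e + (\<Sum>i\<in>J. c (Some i) *\<^sub>R x i)" for c
    using J by (simp add: x'_def sum.reindex)
  have x'_sum: "(\<Sum>i\<in>?J. x' i) = z + \<eta> *\<^sub>R e"
    using sum[of "\<lambda>_. 1"] x(2) by (simp add: add.commute)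
  have z\<eta>: "z + \<eta> *\<^sub>R e \<in> pos_cone p e"
    using zK \<eta> unfolding mem_hyperbolicity_cone[OF hyp] by simp
  have x'K: "x' i \<in> ?K" if "i \<in> ?J" for i
    using that x(1) e[of \<eta>] \<eta> by (auto simp: x'_def)
  have "finite ?J" using J by simp
  from sparsify_interior[OF hyp d z\<eta> this x'K x'_sum \<epsilon> N]
  obtain c where c: "\<forall>i. 0 \<le> c i" "card {i\<in>?J. c i \<noteq> 0} \<le> N"
    and up: "(1 + \<epsilon>) *\<^sub>R (z + \<eta> *\<^sub>R e) - (\<Sum>i\<in>?J. c i *\<^sub>R x' i) \<in> ?K"
    and lo: "(\<Sum>i\<in>?J. c i *\<^sub>R x' i) - (1 - \<epsilon>) *\<^sub>R (z + \<eta> *\<^sub>R e) \<in> ?K"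
    by blast
  define y where "y = (\<Sum>i\<in>J. c (Some i) *\<^sub>R x i)"
  have yK: "y \<in> ?K"
    unfolding y_def using c x(1)
    by (intro hyperbolicity_cone_sum[OF hyp] hyperbolicity_cone_scale[OF hyp]) auto
  note up = up[unfolded sum y_def[symmetric]] and lo = lo[unfolded sum y_def[symmetric]]
  have c0: "c None \<le> 1 + \<epsilon>"
  proof (rule ccontr)
    assume "\<not> ?thesis"
    then have r: "0 < (c None - (1 + \<epsilon>)) * \<eta>" using \<eta> by simp
    have "((1 + \<epsilon>) *\<^sub>R (z + \<eta> *\<^sub>R e) - (c None *\<^sub>R \<eta> *\<^sub>R e + y) + y) + ((c None - (1 + \<epsilon>)) * \<eta>) *\<^sub>R e
        \<in> pos_cone p e"
      using hyperbolicity_cone_add_pos[OF hyp hyperbolicity_cone_add[OF hyp up yK]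
          pos_cone_scale[OF hyp pos_cone_self[OF hyp] r]] .
    also have "((1 + \<epsilon>) *\<^sub>R (z + \<eta> *\<^sub>R e) - (c None *\<^sub>R \<eta> *\<^sub>R e + y) + y) + ((c None - (1 + \<epsilon>)) * \<eta>) *\<^sub>R e
        = (1 + \<epsilon>) *\<^sub>R z" by (simp add: algebra_simps)
    finally have "(1 + \<epsilon>) *\<^sub>R z \<in> pos_cone p e" .
    then have "(1 / (1 + \<epsilon>)) *\<^sub>R (1 + \<epsilon>) *\<^sub>R z \<in> pos_cone p e"
      by (rule pos_cone_scale[OF hyp]) (use \<epsilon> in simp)
    moreover have "(1 / (1 + \<epsilon>)) *\<^sub>R (1 + \<epsilon>) *\<^sub>R z = z" using \<epsilon> by simp
    ultimately show False using z by (simp only:)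
  qed
  have "card {i\<in>J. c (Some i) \<noteq> 0} = card (Some ` {i\<in>J. c (Some i) \<noteq> 0})" by (simp add: card_image)
  also have "\<dots> \<le> card {i\<in>?J. c i \<noteq> 0}" using J by (intro card_mono) auto
  finally have card: "card {i\<in>J. c (Some i) \<noteq> 0} \<le> N" using c(2) by linarith
  \<comment> \<open>The leftover multiples of \<open>e\<close> are
    \<open>(1 + \<epsilon> - c None) * \<eta>\<close> above and
    \<open>(c None - (1 - \<epsilon>)) * \<eta>\<close> below. Both are at most
    \<open>2 * \<eta>\<close>, the second because of \<open>c0\<close>, and are padded up to
    it.\<close>
  have "(1 + \<epsilon>) *\<^sub>R (z + \<eta> *\<^sub>R e) - (c None *\<^sub>R \<eta> *\<^sub>R e + y) + ((1 - \<epsilon> + c None) * \<eta>) *\<^sub>R e \<in> ?K"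
    using \<epsilon> c(1) \<eta> by (intro hyperbolicity_cone_add[OF hyp up] e) auto
  also have "(1 + \<epsilon>) *\<^sub>R (z + \<eta> *\<^sub>R e) - (c None *\<^sub>R \<eta> *\<^sub>R e + y) + ((1 - \<epsilon> + c None) * \<eta>) *\<^sub>R e
      = (1 + \<epsilon>) *\<^sub>R z + (2 * \<eta>) *\<^sub>R e - y"
  proof -
    have "(1 + \<epsilon>) * \<eta> - c None * \<eta> + (1 - \<epsilon> + c None) * \<eta> = 2 * \<eta>" by (simp add: algebra_simps)
    then have "((1 + \<epsilon>) * \<eta>) *\<^sub>R e - (c None * \<eta>) *\<^sub>R e + ((1 - \<epsilon> + c None) * \<eta>) *\<^sub>R e = (2 * \<eta>) *\<^sub>R e"
      by (metis scaleR_left_diff_distrib scaleR_left_distrib)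
    then show ?thesis by (simp add: scaleR_right_distrib algebra_simps)
  qed
  finally have 1: "(1 + \<epsilon>) *\<^sub>R z + (2 * \<eta>) *\<^sub>R e - y \<in> ?K" .
  have "c None *\<^sub>R \<eta> *\<^sub>R e + y - (1 - \<epsilon>) *\<^sub>R (z + \<eta> *\<^sub>R e) + ((3 - \<epsilon> - c None) * \<eta>) *\<^sub>R e \<in> ?K"
    using \<epsilon> c0 \<eta> by (intro hyperbolicity_cone_add[OF hyp lo] e) auto
  also have "c None *\<^sub>R \<eta> *\<^sub>R e + y - (1 - \<epsilon>) *\<^sub>R (z + \<eta> *\<^sub>R e) + ((3 - \<epsilon> - c None) * \<eta>) *\<^sub>R e
      = y + (2 * \<eta>) *\<^sub>R e - (1 - \<epsilon>) *\<^sub>R z"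
  proof -
    have "c None * \<eta> - (1 - \<epsilon>) * \<eta> + (3 - \<epsilon> - c None) * \<eta> = 2 * \<eta>" by (simp add: algebra_simps)
    then have "(c None * \<eta>) *\<^sub>R e - ((1 - \<epsilon>) * \<eta>) *\<^sub>R e + ((3 - \<epsilon> - c None) * \<eta>) *\<^sub>R e = (2 * \<eta>) *\<^sub>R e"
      by (metis scaleR_left_diff_distrib scaleR_left_distrib)
    then show ?thesis by (simp add: scaleR_right_distrib algebra_simps)
  qed
  finally have 2: "y + (2 * \<eta>) *\<^sub>R e - (1 - \<epsilon>) *\<^sub>R z \<in> ?K" .
  show ?thesis
    using c(1) card 1 2 by (intro exI[of _ "\<lambda>i. c (Some i)"]) (simp add: y_def)
qed

text \<open>Let the perturbation tend to 0. The weights stay bounded: a weight \<open>c\<close> of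
  \<open>x i\<close> puts \<open>w / c - x i\<close> into the cone for a bounded \<open>w\<close>,
  and for large \<open>c\<close> this point would be too close to \<open>- x i\<close>, which lies
  outside the closed cone. The count passes to the limit, as a nonzero limit has eventually nonzero
  terms.\<close>

lemma sparsify_pointed:
  fixes x :: "'i \<Rightarrow> real^'n"
  assumes hyp: "hyperbolic d p e" and d: "0 < d"
    and J: "finite J" and x: "\<And>i. i \<in> J \<Longrightarrow> x i \<in> hyperbolicity_cone p e"
      "\<And>i. i \<in> J \<Longrightarrow> - x i \<notin> hyperbolicity_cone p e" "(\<Sum>i\<in>J. x i) = z"
    and \<epsilon>: "0 < \<epsilon>" "\<epsilon> < 1" and N: "4 * d / \<epsilon>\<^sup>2 - d \<le> real N"
  shows "\<exists>c. (\<forall>i. 0 \<le> c i) \<and> card {i\<in>J. c i \<noteq> 0} \<le> N \<and>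
    (1 + \<epsilon>) *\<^sub>R z - (\<Sum>i\<in>J. c i *\<^sub>R x i) \<in> hyperbolicity_cone p e \<and>
    (\<Sum>i\<in>J. c i *\<^sub>R x i) - (1 - \<epsilon>) *\<^sub>R z \<in> hyperbolicity_cone p e"
proof (cases "z \<in> pos_cone p e")
  case True
  show ?thesis by (rule sparsify_interior[OF hyp d True J x(1,3) \<epsilon> N])
next
  case False
  let ?K = "hyperbolicity_cone p e"
  define \<eta> where "\<eta> n = 1 / real (Suc n)" for n
  have \<eta>: "0 < \<eta> n" "\<eta> n \<le> 1" for n by (simp_all add: \<eta>_def)
  have "\<forall>n. \<exists>c. (\<forall>i. 0 \<le> c i) \<and> card {i\<in>J. c i \<noteq> 0} \<le> N \<and>
    (1 + \<epsilon>) *\<^sub>R z + (2 * \<eta> n) *\<^sub>R e - (\<Sum>i\<in>J. c i *\<^sub>R x i) \<in> ?K \<and>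
    (\<Sum>i\<in>J. c i *\<^sub>R x i) + (2 * \<eta> n) *\<^sub>R e - (1 - \<epsilon>) *\<^sub>R z \<in> ?K"
    by (intro allI sparsify_perturbed[OF hyp d False J x(1,3) \<epsilon> N \<eta>(1)])
  from choice[OF this] obtain C where C: "\<And>n i. 0 \<le> C n i" "\<And>n. card {i\<in>J. C n i \<noteq> 0} \<le> N"
    and up: "\<And>n. (1 + \<epsilon>) *\<^sub>R z + (2 * \<eta> n) *\<^sub>R e - (\<Sum>i\<in>J. C n i *\<^sub>R x i) \<in> ?K"
    and lo: "\<And>n. (\<Sum>i\<in>J. C n i *\<^sub>R x i) + (2 * \<eta> n) *\<^sub>R e - (1 - \<epsilon>) *\<^sub>R z \<in> ?K"
    by blast
  have "bounded (range (\<lambda>n. C n i))" if i: "i \<in> J" for i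
  proof -
    have "open (- ?K)" using closed_hyperbolicity_cone[OF hyp] by (simp add: open_Compl)
    then obtain \<rho> where \<rho>: "0 < \<rho>" "ball (- x i) \<rho> \<subseteq> - ?K"
      using x(2)[OF i] open_contains_ball by blast
    define W where "W = (1 + \<epsilon>) * norm z + 2 * norm e"
    have W: "0 \<le> W" using \<epsilon> by (simp add: W_def)
    have "C n i \<le> W / \<rho>" for n
    proof (cases "C n i = 0")
      case True
      then show ?thesis using W \<rho>(1) by simp
    next
      case False
      then have c: "0 < C n i" using C(1)[of n i] by simp
      define w where "w = (1 + \<epsilon>) *\<^sub>R z + (2 * \<eta> n) *\<^sub>R e"
      have "(\<Sum>j\<in>J - {i}. C n j *\<^sub>R x j) \<in> ?K"
        using C(1) x(1) by (intro hyperbolicity_cone_sum[OF hyp] hyperbolicity_cone_scale[OF hyp]) auto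
      from hyperbolicity_cone_add[OF hyp up[of n] this]
      moreover have "w - (\<Sum>j\<in>J. C n j *\<^sub>R x j) + (\<Sum>j\<in>J - {i}. C n j *\<^sub>R x j) = w - C n i *\<^sub>R x i"
        using sum.remove[OF J i, of "\<lambda>j. C n j *\<^sub>R x j"] by simp
      ultimately have "w - C n i *\<^sub>R x i \<in> ?K" by (simp only: w_def)
      then have "(1 / C n i) *\<^sub>R (w - C n i *\<^sub>R x i) \<in> ?K"
        using c by (intro hyperbolicity_cone_scale[OF hyp]) auto
      then have "(1 / C n i) *\<^sub>R w - x i \<in> ?K" using c by (simp add: scaleR_diff_right)
      then have "\<not> dist (- x i) ((1 / C n i) *\<^sub>R w - x i) < \<rho>" using \<rho>(2) by auto
      then have "\<rho> \<le> norm w / C n i" using c by (simp add: dist_norm)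
      moreover have "norm w \<le> W"
      proof -
        have "norm w \<le> norm ((1 + \<epsilon>) *\<^sub>R z) + norm ((2 * \<eta> n) *\<^sub>R e)" unfolding w_def by (rule norm_triangle_ineq)
        also have "\<dots> = (1 + \<epsilon>) * norm z + \<eta> n * (2 * norm e)" using \<epsilon> \<eta>(1)[of n] by simp
        also have "\<dots> \<le> W" unfolding W_def using mult_right_mono[OF \<eta>(2), of "2 * norm e" n] by simp
        finally show ?thesis .
      qed
      ultimately show ?thesis using c \<rho>(1) by (simp add: field_simps)
    qed
    then show ?thesis using C(1) by (intro boundedI[of _ "W / \<rho>"]) auto
  qed
  then obtain r L where r: "strict_mono (r :: nat \<Rightarrow> nat)"
    and L: "\<And>i. i \<in> J \<Longrightarrow> (\<lambda>n. C (r n) i) \<longlonglongrightarrow> L i"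
    using finite_family_convergent_subseq[OF J, of C] by blast
  define c where "c i = (if i \<in> J then L i else 0)" for i
  have c: "(\<lambda>n. C (r n) i) \<longlonglongrightarrow> c i" if "i \<in> J" for i using L that by (simp add: c_def)
  have "0 \<le> c i" for i
    using c[of i] C(1) by (cases "i \<in> J") (auto intro: LIMSEQ_le_const simp: c_def)
  moreover have "card {i\<in>J. c i \<noteq> 0} \<le> N"
  proof -
    have "\<forall>\<^sub>F n in sequentially. C (r n) i \<noteq> 0" if "i \<in> {i\<in>J. c i \<noteq> 0}" for i
      using c[of i] that by (intro tendsto_imp_eventually_ne) auto
    then have "\<forall>\<^sub>F n in sequentially. \<forall>i\<in>{i\<in>J. c i \<noteq> 0}. C (r n) i \<noteq> 0"
      using J by (intro eventually_ball_finite) auto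
    then obtain n where "\<forall>i\<in>{i\<in>J. c i \<noteq> 0}. C (r n) i \<noteq> 0"
      using eventually_happens by fastforce
    then have "card {i\<in>J. c i \<noteq> 0} \<le> card {i\<in>J. C (r n) i \<noteq> 0}" using J by (intro card_mono) auto
    then show ?thesis using C(2)[of "r n"] by linarith
  qed
  moreover have \<eta>0: "(\<lambda>n. \<eta> (r n)) \<longlonglongrightarrow> 0"
    using LIMSEQ_subseq_LIMSEQ[OF LIMSEQ_inverse_real_of_nat r]
    by (simp add: \<eta>_def o_def inverse_eq_divide)
  have sum: "(\<lambda>n. \<Sum>i\<in>J. C (r n) i *\<^sub>R x i) \<longlonglongrightarrow> (\<Sum>i\<in>J. c i *\<^sub>R x i)"
    by (intro tendsto_sum tendsto_scaleR c tendsto_const)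
  have "(\<lambda>n. (1 + \<epsilon>) *\<^sub>R z + (2 * \<eta> (r n)) *\<^sub>R e - (\<Sum>i\<in>J. C (r n) i *\<^sub>R x i))
      \<longlonglongrightarrow> (1 + \<epsilon>) *\<^sub>R z + (2 * 0) *\<^sub>R e - (\<Sum>i\<in>J. c i *\<^sub>R x i)"
    by (intro tendsto_intros \<eta>0 sum)
  then have "(1 + \<epsilon>) *\<^sub>R z + (2 * 0) *\<^sub>R e - (\<Sum>i\<in>J. c i *\<^sub>R x i) \<in> ?K"
    by (rule closed_sequentially[OF closed_hyperbolicity_cone[OF hyp], rotated]) (rule up)
  moreover have "(\<lambda>n. (\<Sum>i\<in>J. C (r n) i *\<^sub>R x i) + (2 * \<eta> (r n)) *\<^sub>R e - (1 - \<epsilon>) *\<^sub>R z)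
      \<longlonglongrightarrow> (\<Sum>i\<in>J. c i *\<^sub>R x i) + (2 * 0) *\<^sub>R e - (1 - \<epsilon>) *\<^sub>R z"
    by (intro tendsto_intros \<eta>0 sum)
  then have "(\<Sum>i\<in>J. c i *\<^sub>R x i) + (2 * 0) *\<^sub>R e - (1 - \<epsilon>) *\<^sub>R z \<in> ?K"
    by (rule closed_sequentially[OF closed_hyperbolicity_cone[OF hyp], rotated]) (rule lo)
  ultimately show ?thesis by (intro exI[of _ c]) auto
qed

text \<open>Vectors whose negative also lies in the cone get weight 0: their sum \<open>l\<close>
  satisfies \<open>l\<close> and \<open>- l\<close> in the cone, so it corrects both inequalities
  for free. For \<open>d = 0\<close> the cone is the whole space and zero weights suffice.\<close>

lemma sparsify_hyperbolicity_cone: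
  fixes x :: "'i \<Rightarrow> real^'n"
  assumes hyp: "hyperbolic d p e"
    and J: "finite J" and x: "\<And>i. i \<in> J \<Longrightarrow> x i \<in> hyperbolicity_cone p e" "(\<Sum>i\<in>J. x i) = z"
    and \<epsilon>: "0 < \<epsilon>" "\<epsilon> < 1" and N: "4 * d / \<epsilon>\<^sup>2 - d \<le> real N"
  shows "\<exists>c. (\<forall>i. 0 \<le> c i) \<and> card {i\<in>J. c i \<noteq> 0} \<le> N \<and>
    (1 + \<epsilon>) *\<^sub>R z - (\<Sum>i\<in>J. c i *\<^sub>R x i) \<in> hyperbolicity_cone p e \<and>
    (\<Sum>i\<in>J. c i *\<^sub>R x i) - (1 - \<epsilon>) *\<^sub>R z \<in> hyperbolicity_cone p e"
proof (cases "d = 0")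
  case True
  have "hyp_eigenvalues p e v = []" for v using length_hyp_eigenvalues[OF hyp, of v] True by simp
  then have "hyperbolicity_cone p e = UNIV" by (simp add: hyperbolicity_cone_def)
  then show ?thesis by (intro exI[of _ "\<lambda>_. 0"]) simp
next
  case False
  let ?K = "hyperbolicity_cone p e"
  define J' where "J' = {i\<in>J. - x i \<notin> ?K}"
  have J': "finite J'" "J' \<subseteq> J" using J by (auto simp: J'_def)
  have d: "0 < d" using False by simp
  have x': "x i \<in> ?K" "- x i \<notin> ?K" if "i \<in> J'" for i using that x(1) by (auto simp: J'_def)
  from sparsify_pointed[where x = x and J = J', OF hyp d J'(1) x' refl \<epsilon> N]
  obtain c where c: "\<forall>i. 0 \<le> c i" "card {i\<in>J'. c i \<noteq> 0} \<le> N"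
    and up: "(1 + \<epsilon>) *\<^sub>R (\<Sum>i\<in>J'. x i) - (\<Sum>i\<in>J'. c i *\<^sub>R x i) \<in> ?K"
    and lo: "(\<Sum>i\<in>J'. c i *\<^sub>R x i) - (1 - \<epsilon>) *\<^sub>R (\<Sum>i\<in>J'. x i) \<in> ?K"
    by blast
  define l where "l = (\<Sum>i\<in>J - J'. x i)"
  have zl: "z = (\<Sum>i\<in>J'. x i) + l"
    unfolding l_def x(2)[symmetric] using J J'(2) by (metis add.commute sum.subset_diff)
  have lK: "l \<in> ?K" "- l \<in> ?K"
    unfolding l_def sum_negf[symmetric] using x(1)
    by (auto intro!: hyperbolicity_cone_sum[OF hyp] simp: J'_def)
  define c' where "c' i = (if i \<in> J' then c i else 0)" for i
  have sum: "(\<Sum>i\<in>J. c' i *\<^sub>R x i) = (\<Sum>i\<in>J'. c i *\<^sub>R x i)"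
  proof -
    have "(\<Sum>i\<in>J. c' i *\<^sub>R x i) = (\<Sum>i\<in>J'. c' i *\<^sub>R x i)"
      using J J'(2) by (intro sum.mono_neutral_right) (auto simp: c'_def)
    then show ?thesis by (simp add: c'_def)
  qed
  have "{i\<in>J. c' i \<noteq> 0} = {i\<in>J'. c i \<noteq> 0}" using J'(2) by (auto simp: c'_def)
  moreover have "(1 + \<epsilon>) *\<^sub>R z - (\<Sum>i\<in>J. c' i *\<^sub>R x i) \<in> ?K"
    using hyperbolicity_cone_add[OF hyp up hyperbolicity_cone_scale[OF hyp lK(1), of "1 + \<epsilon>"]] \<epsilon>
    unfolding sum zl by (simp add: scaleR_right_distrib algebra_simps)
  moreover have "(\<Sum>i\<in>J. c' i *\<^sub>R x i) - (1 - \<epsilon>) *\<^sub>R z \<in> ?K"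
    using hyperbolicity_cone_add[OF hyp lo hyperbolicity_cone_scale[OF hyp lK(2), of "1 - \<epsilon>"]] \<epsilon>
    unfolding sum zl by (simp add: scaleR_right_distrib algebra_simps)
  ultimately show ?thesis using c by (intro exI[of _ c']) (auto simp: c'_def)
qed

section \<open>Transport along a lift\<close>

lemma sum_diff_scaleR:
  fixes v :: "'i \<Rightarrow> 'b::real_vector"
  shows "(\<Sum>i\<in>J. (a - c i) *\<^sub>R v i) = a *\<^sub>R (\<Sum>i\<in>J. v i) - (\<Sum>i\<in>J. c i *\<^sub>R v i)"
    and "(\<Sum>i\<in>J. (c i - a) *\<^sub>R v i) = (\<Sum>i\<in>J. c i *\<^sub>R v i) - a *\<^sub>R (\<Sum>i\<in>J. v i)"
  by (simp_all add: scaleR_diff_left sum_subtractf scaleR_sum_right)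

text \<open>Choose preimages \<open>w i\<close> of the \<open>x i\<close> in the slice of the cone,
  sparsify these and apply the linear map with the same weights. The sum of the \<open>w i\<close>
  may lie on the boundary of the cone, which is why boundary points were treated.\<close>

lemma sparsify_lift:
  fixes x :: "'i \<Rightarrow> 'a::euclidean_space"
  assumes hyp: "hyperbolic d p e" and lift: "has_lift C (hyperbolicity_cone p e)"
    and J: "finite J" and x: "\<And>i. i \<in> J \<Longrightarrow> x i \<in> C"
    and \<epsilon>: "0 < \<epsilon>" "\<epsilon> < 1" and N: "4 * d / \<epsilon>\<^sup>2 - d \<le> real N"
  shows "\<exists>c. (\<forall>i. 0 \<le> c i) \<and> card {i\<in>J. c i \<noteq> 0} \<le> N \<and>
    (1 + \<epsilon>) *\<^sub>R (\<Sum>i\<in>J. x i) - (\<Sum>i\<in>J. c i *\<^sub>R x i) \<in> C \<and>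
    (\<Sum>i\<in>J. c i *\<^sub>R x i) - (1 - \<epsilon>) *\<^sub>R (\<Sum>i\<in>J. x i) \<in> C"
proof -
  let ?K = "hyperbolicity_cone p e"
  obtain L \<pi> where L\<pi>: "subspace L \<and> L \<subseteq> span ?K \<and> \<pi> ` span ?K \<subseteq> span C \<and>
      (\<forall>x\<in>span ?K. \<forall>y\<in>span ?K. \<pi> (x + y) = \<pi> x + \<pi> y) \<and>
      (\<forall>c. \<forall>x\<in>span ?K. \<pi> (c *\<^sub>R x) = c *\<^sub>R \<pi> x) \<and> C = \<pi> ` (L \<inter> ?K)"
    using lift unfolding has_lift_def by (elim exE) (rule that)
  then have L: "subspace L" and C: "C = \<pi> ` (L \<inter> ?K)"
    and add: "\<And>x y. x \<in> span ?K \<Longrightarrow> y \<in> span ?K \<Longrightarrow> \<pi> (x + y) = \<pi> x + \<pi> y"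
    and scale: "\<And>c x. x \<in> span ?K \<Longrightarrow> \<pi> (c *\<^sub>R x) = c *\<^sub>R \<pi> x"
    by simp_all
  have "\<exists>w. w \<in> L \<inter> ?K \<and> \<pi> w = x i" if "i \<in> J" for i
  proof -
    have "x i \<in> \<pi> ` (L \<inter> ?K)" using x[OF that] by (simp only: C)
    then obtain u where "x i = \<pi> u" "u \<in> L \<inter> ?K" by (rule imageE)
    then show ?thesis by (intro exI[of _ u] conjI) simp_all
  qed
  then have "\<forall>i\<in>J. \<exists>w. w \<in> L \<inter> ?K \<and> \<pi> w = x i" ..
  from bchoice[OF this] obtain w where "\<forall>i\<in>J. w i \<in> L \<inter> ?K \<and> \<pi> (w i) = x i" ..
  then have w: "\<And>i. i \<in> J \<Longrightarrow> w i \<in> L" "\<And>i. i \<in> J \<Longrightarrow> w i \<in> ?K" "\<And>i. i \<in> J \<Longrightarrow> \<pi> (w i) = x i"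
    by simp_all
  from sparsify_hyperbolicity_cone[where x = w and J = J, OF hyp J w(2) refl \<epsilon> N]
  obtain c where c: "\<forall>i. 0 \<le> c i" "card {i\<in>J. c i \<noteq> 0} \<le> N"
    and up: "(1 + \<epsilon>) *\<^sub>R (\<Sum>i\<in>J. w i) - (\<Sum>i\<in>J. c i *\<^sub>R w i) \<in> ?K"
    and lo: "(\<Sum>i\<in>J. c i *\<^sub>R w i) - (1 - \<epsilon>) *\<^sub>R (\<Sum>i\<in>J. w i) \<in> ?K"
    by blast
  have sumL: "(\<Sum>i\<in>J. f i *\<^sub>R w i) \<in> L" for f
    using w(1) L by (intro subspace_sum subspace_scale) auto
  have \<pi>_sum: "\<pi> (\<Sum>i\<in>J. f i *\<^sub>R w i) = (\<Sum>i\<in>J. f i *\<^sub>R x i)" for f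
    using J w
  proof (induction J rule: finite_induct)
    case empty
    show ?case using scale[of 0 0] by (simp add: span_zero)
  next
    case (insert j J)
    have wK: "w i \<in> span ?K" if "i \<in> insert j J" for i using insert.prems(2)[OF that] by (rule span_base)
    then have "(\<Sum>i\<in>J. f i *\<^sub>R w i) \<in> span ?K" by (intro span_sum span_scale) auto
    then show ?case
      using insert wK by (simp add: add scale span_scale)
  qed
  \<comment> \<open>Each gap is written as a single combination of the \<open>w i\<close>, which
    lies in \<open>L\<close> and is mapped by \<open>\<pi>_sum\<close>.\<close>
  have "\<pi> (\<Sum>i\<in>J. (1 + \<epsilon> - c i) *\<^sub>R w i) \<in> C"
    unfolding C using up sumL[of "\<lambda>i. 1 + \<epsilon> - c i"] by (intro imageI IntI) (simp_all only: sum_diff_scaleR)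
  moreover have "\<pi> (\<Sum>i\<in>J. (c i - (1 - \<epsilon>)) *\<^sub>R w i) \<in> C"
    unfolding C using lo sumL[of "\<lambda>i. c i - (1 - \<epsilon>)"] by (intro imageI IntI) (simp_all only: sum_diff_scaleR)
  ultimately show ?thesis
    unfolding \<pi>_sum unfolding sum_diff_scaleR using c by (intro exI[of _ c]) simp
qed

section \<open>The rounded bound as a sparsification function\<close>

lemma antimono_on_floor_inverse_square:
  "antimono_on {0<..<1} (\<lambda>t::real. of_int \<lfloor>4 * real d / t\<^sup>2\<rfloor> :: real)"
proof (rule monotone_onI)
  fix s t :: real assume "s \<in> {0<..<1}" "t \<in> {0<..<1}" "s \<le> t"
  then have "4 * real d / t\<^sup>2 \<le> 4 * real d / s\<^sup>2"
    by (intro divide_left_mono power_mono mult_pos_pos) auto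
  then show "real_of_int \<lfloor>4 * real d / t\<^sup>2\<rfloor> \<le> real_of_int \<lfloor>4 * real d / s\<^sup>2\<rfloor>"
    by (simp add: floor_mono)
qed

text \<open>Near \<open>x\<close> the values of \<open>g\<close> stay below the next integer, so
  rounding down cannot jump up; rounding up can do so next to a point where \<open>g\<close> is an
  integer.\<close>

lemma usc_on_floor:
  assumes "continuous_on S g"
  shows "usc_on S (\<lambda>t. of_int \<lfloor>g t :: real\<rfloor>)"
  unfolding usc_on_def
proof (intro ballI allI impI)
  fix x and y :: real assume x: "x \<in> S" and y: "of_int \<lfloor>g x\<rfloor> < y"
  have "(g \<longlongrightarrow> g x) (at x within S)" using assms x by (simp add: continuous_on_def)
  then have "\<forall>\<^sub>F t in at x within S. g t < of_int \<lfloor>g x\<rfloor> + 1"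
    by (rule order_tendstoD) linarith
  then show "\<forall>\<^sub>F t in at x within S. of_int \<lfloor>g t\<rfloor> < y"
  proof eventually_elim
    case (elim t)
    then have "\<lfloor>g t\<rfloor> \<le> \<lfloor>g x\<rfloor>" by linarith
    then have "real_of_int \<lfloor>g t\<rfloor> \<le> of_int \<lfloor>g x\<rfloor>" by simp
    with y show ?case by linarith
  qed
qed

lemma sparsification_fun_lift:
  fixes C :: "'a::euclidean_space set"
  assumes hyp: "hyperbolic d p e" and lift: "has_lift C (hyperbolicity_cone p e)"
  shows "sparsification_fun C (\<lambda>t. of_int \<lfloor>4 * real d / t\<^sup>2\<rfloor>)"
  unfolding sparsification_fun_def
proof (intro conjI allI impI)
  show "antimono_on {0<..<1} (\<lambda>t::real. of_int \<lfloor>4 * real d / t\<^sup>2\<rfloor> :: real)"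
    by (rule antimono_on_floor_inverse_square)
  show "usc_on {0<..<1} (\<lambda>t::real. of_int \<lfloor>4 * real d / t\<^sup>2\<rfloor>)"
    by (intro usc_on_floor continuous_intros) auto
next
  fix m :: nat and x :: "nat \<Rightarrow> 'a" and v :: 'a and \<epsilon> :: real
  assume *: "(\<forall>i\<in>{1..m}. x i \<in> C) \<and> (\<Sum>i=1..m. x i) = v \<and> v \<in> rel_interior C \<and> 0 < \<epsilon> \<and> \<epsilon> < 1"
  define N where "N = nat \<lfloor>4 * real d / \<epsilon>\<^sup>2\<rfloor>"
  have N: "real N = of_int \<lfloor>4 * real d / \<epsilon>\<^sup>2\<rfloor>" by (simp add: N_def)
  \<comment> \<open>Rounding down loses less than 1, which the spare \<open>d\<close> covers when
    \<open>d \<ge> 1\<close>.\<close>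
  have "4 * real d / \<epsilon>\<^sup>2 - d \<le> real N"
  proof (cases "d = 0")
    case False
    then have "1 \<le> real d" by simp
    then show ?thesis unfolding N by linarith
  qed simp
  then obtain c where c: "\<forall>i. 0 \<le> c i" "card {i\<in>{1..m}. c i \<noteq> 0} \<le> N"
    and up: "(1 + \<epsilon>) *\<^sub>R (\<Sum>i\<in>{1..m}. x i) - (\<Sum>i\<in>{1..m}. c i *\<^sub>R x i) \<in> C"
    and lo: "(\<Sum>i\<in>{1..m}. c i *\<^sub>R x i) - (1 - \<epsilon>) *\<^sub>R (\<Sum>i\<in>{1..m}. x i) \<in> C"
    using sparsify_lift[OF hyp lift, of "{1..m}" x \<epsilon> N] * by auto
  let ?S = "{i\<in>{1..m}. c i \<noteq> 0}"
  have "(\<Sum>i\<in>?S. c i *\<^sub>R x i) = (\<Sum>i\<in>{1..m}. c i *\<^sub>R x i)"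
    by (rule sum.mono_neutral_left) auto
  moreover have "real (card ?S) \<le> of_int \<lfloor>4 * real d / \<epsilon>\<^sup>2\<rfloor>" using c(2) unfolding N[symmetric] by simp
  ultimately show "\<exists>S c. S \<subseteq> {1..m} \<and> real (card S) \<le> of_int \<lfloor>4 * real d / \<epsilon>\<^sup>2\<rfloor> \<and>
      (\<forall>i\<in>S. 0 < c i) \<and> cone_le C ((1 - \<epsilon>) *\<^sub>R v) (\<Sum>i\<in>S. c i *\<^sub>R x i) \<and>
      cone_le C (\<Sum>i\<in>S. c i *\<^sub>R x i) ((1 + \<epsilon>) *\<^sub>R v)"
    using c(1) up lo * by (intro exI[of _ ?S] exI[of _ c]) (auto simp: cone_le_def less_le)
qed

theorem corollary1p9:
  fixes p :: "'n::finite mpol" and d :: nat and e :: "real^'n"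
    and C :: "'a::euclidean_space set"
  assumes "hyperbolic d p e"
    and "closed C" and "convex_cone C"
    and "has_lift C (hyperbolicity_cone p e)"
  shows "\<forall>\<epsilon>\<in>{0<..<1}. sp C \<epsilon> \<le> ereal (of_int \<lceil>4 * real d / \<epsilon>\<^sup>2\<rceil>)"
proof
  fix \<epsilon> :: real
  have "sp C \<epsilon> \<le> ereal (of_int \<lfloor>4 * real d / \<epsilon>\<^sup>2\<rfloor>)"
    unfolding sp_def using sparsification_fun_lift[OF assms(1,4)] by (intro INF_lower2) auto
  also have "\<dots> \<le> ereal (of_int \<lceil>4 * real d / \<epsilon>\<^sup>2\<rceil>)" by (simp add: floor_le_ceiling)
  finally show "sp C \<epsilon> \<le> ereal (of_int \<lceil>4 * real d / \<epsilon>\<^sup>2\<rceil>)" .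
qed

end
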